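(* Let $f(\lambda_1,\ldots,\lambda_n):=\sum_{\mathbf{p}\in\mathbb{Z}_+^n}\lambda^{\mathbf{p}}A_{(\mathbf{p})}$, $A_{(\mathbf{p})}\in B(\mathcal{H})$, be an operator-valued analytic function on $\mathbb{B}_n$ such that $$\limsup_{k\to\infty}\left\|\sum_{\mathbf{p}\in\mathbb{Z}_+^n,|\mathbf{p}|=k}\frac{|\mathbf{p}|!}{\mathbf{p}!}A_{(\mathbf{p})}^*A_{(\mathbf{p})}\right\|^{1/2k}\leq1,$$ $f(0)\geq0$, and $\mathrm{Re}\,f_{\mathrm{sym}}(rS_1,\ldots,rS_n)\leq I$ for $0\leq r<1$. Let $\mathcal{K}$ denote an arbitrary Hilbert space. Then the following statements hold. (i) $\left\|\sum_{|\mathbf{p}|=k}\frac{\mathbf{p}!}{|\mathbf{p}|!}A_{(\mathbf{p})}^*A_{(\mathbf{p})}\right\|^{1/2}\leq2\|I-A_{(0)}\|$ for $k=1,2,\ldots$. (ii) $\sum_{k=0}^\infty r^k\left\|\sum_{|\mathbf{p}|=k}\frac{\mathbf{p}!}{|\mathbf{p}|!}A_{(\mathbf{p})}^*A_{(\mathbf{p})}\right\|^{1/2}\leq\|A_{(0)}\|+\|I-A_{(0)}\|$ for $0\leq r\leq\frac13$. (iii) If $\{Y_{(\mathbf{p})}\}_{\mathbf{p}\in\mathbb{Z}_+^n}$ is a sequence of operators in $B(\mathcal{K})$ such that $$\|Y_{(0)}\|\leq1\quad\text{and}\quad\sum_{k=1}^\infty\left\|\sum_{|\mathbf{p}|=k}\frac{|\mathbf{p}|!}{\mathbf{p}!}Y_{(\mathbf{p})}^*Y_{(\mathbf{p})}\right\|^{1/2}\leq\frac12,$$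 then $$\left\|\sum_{k=0}^\infty\left(\sum_{|\mathbf{p}|=k}B^{\mathbf{p}}\otimes A_{(\mathbf{p})}\otimes Y_{(\mathbf{p})}\right)\right\|\leq1.$$ In particular, $\left\|\sum_{k=0}^\infty\left(\sum_{|\mathbf{p}|=k}\lambda^{\mathbf{p}}A_{(\mathbf{p})}\otimes Y_{(\mathbf{p})}\right)\right\|\leq1$ for any $\lambda\in\mathbb{B}_n$. (iv) If $Y_1,\ldots,Y_n\in B(\mathcal{K})$ are commuting and $\|[Y_1^*,\ldots,Y_n^*]\|\leq\frac13$, then $$\left\|\sum_{k=0}^\infty\left(\sum_{|\mathbf{p}|=k}B^{\mathbf{p}}\otimes Y^{\mathbf{p}}\otimes A_{(\mathbf{p})}\right)\right\|\leq1.$$ (v) If $(T_1,\ldots,T_n)\in[B(\mathcal{K})^n]_{1/3}$ and $T_1,\ldots,T_n$ are commuting operators, then $$\sum_{k=0}^\infty\left\|\sum_{|\mathbf{p}|=k}T^{\mathbf{p}}\otimes A_{(\mathbf{p})}\right\|\leq\|A_{(0)}\|+\|I-A_{(0)}\|.$$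
   Context: $\mathbb{B}_n$ is the open unit ball of $\mathbb{C}^n$. For $\mathbf{p}=(p_1,\dots,p_n)\in\mathbb{Z}_+^n$: $|\mathbf{p}|:=p_1+\cdots+p_n$, $\mathbf{p}!:=p_1!\cdots p_n!$, $\lambda^{\mathbf{p}}:=\lambda_1^{p_1}\cdots\lambda_n^{p_n}$, and similarly $T^{\mathbf{p}}$ for commuting operators. All inner sums are over $\mathbf{p}\in\mathbb{Z}_+^n$ with the indicated $|\mathbf{p}|$. $A_{(0)}$, $Y_{(0)}$ are the coefficients at $\mathbf{p}=(0,\dots,0)$; $f(0)=A_{(0)}$. $H_n$ is an $n$-dimensional complex Hilbert space with orthonormal basis $e_1,\dots,e_n$; $F^2(H_n)=\bigoplus_{k\ge0}H_n^{\otimes k}$ (with $H_n^{\otimes0}=\mathbb{C}1$) is the full Fock space, $S_i\varphi=e_i\otimes\varphi$ the left creation operators, $F_s^2(H_n)\subset F^2(H_n)$ the symmetric Fock space (symmetric tensors), and $B_i:=P_{F_s^2(H_n)}S_i|_{F_s^2(H_n)}$, $i=1,\dots,n$, the (commuting) creation operators on it. $\mathbb{F}_n^+$ is the unital free semigroup on $g_1,\dots,g_n$ with identity $g_0$; $S_\alpha:=S_{i_1}\cdots S_{i_k}$ and $\lambda_\alpha:=\lambda_{i_1}\cdots\lambda_{i_k}$ for $\alpha=g_{i_1}\cdots g_{i_k}$ ($S_{g_0}=I$, $\lambda_{g_0}=1$). Let $\Lambda_{\mathbf{p}}:=\{\alpha\in\mathbb{F}_n^+:\lambda_\alpha=\lambda^{\mathbf{p}}\text{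 for all }\lambda\in\mathbb{B}_n\}$, $(\lambda^{\mathbf{p}})_{\mathrm{sym}}(S_1,\ldots,S_n):=\frac{\mathbf{p}!}{|\mathbf{p}|!}\sum_{\alpha\in\Lambda_{\mathbf{p}}}S_\alpha$, and $f_{\mathrm{sym}}(rS_1,\ldots,rS_n):=\sum_{k=0}^\infty\sum_{|\mathbf{p}|=k}r^k\,(\lambda^{\mathbf{p}})_{\mathrm{sym}}(S_1,\ldots,S_n)\otimes A_{(\mathbf{p})}$ (norm convergent in $k$ for $0\le r<1$ under the stated limsup condition). $[B(\mathcal{K})^n]_r:=\{(T_1,\ldots,T_n):\|T_1T_1^*+\cdots+T_nT_n^*\|^{1/2}\le r\}$; $\|[Y_1^*,\dots,Y_n^*]\|=\|\sum_iY_i^*Y_i\|^{1/2}$; $\mathrm{Re}\,A=\frac12(A+A^* )$. *)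

theory Defs
  imports "HOL-Analysis.Analysis" "HOL-Library.Multiset"
begin

section \<open>Complex Hilbert spaces\<close>

class complex_vector = real_vector +
  fixes scaleC :: "complex \<Rightarrow> 'a \<Rightarrow> 'a" (infixr "*\<^sub>C" 75)
  assumes scaleC_add_right: "c *\<^sub>C (x + y) = c *\<^sub>C x + c *\<^sub>C y"
    and scaleC_add_left: "(c + d) *\<^sub>C x = c *\<^sub>C x + d *\<^sub>C x"
    and scaleC_scaleC: "c *\<^sub>C (d *\<^sub>C x) = (c * d) *\<^sub>C x"
    and scaleR_scaleC: "r *\<^sub>R x = complex_of_real r *\<^sub>C x"

class complex_normed_vector = complex_vector + real_normed_vector +
  assumes norm_scaleC: "norm (c *\<^sub>C x) = cmod c * norm x"

text \<open>The inner product is linear in the first argument. The norm is the one of \<open>real_inner\<close>,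
  so that it comes from the real part of \<open>cinner\<close>.\<close>

class complex_inner = complex_vector + real_inner +
  fixes cinner :: "'a \<Rightarrow> 'a \<Rightarrow> complex"
  assumes cinner_commute: "cinner x y = cnj (cinner y x)"
    and cinner_add_left: "cinner (x + y) z = cinner x z + cinner y z"
    and cinner_scaleC_left: "cinner (c *\<^sub>C x) y = c * cinner x y"
    and inner_eq_Re_cinner: "inner x y = Re (cinner x y)"

lemma cinner_add_right: "cinner (x::'a::complex_inner) (y + z) = cinner x y + cinner x z"
  by (metis cinner_commute cinner_add_left complex_cnj_add)

lemma cinner_scaleC_right: "cinner (x::'a::complex_inner) (c *\<^sub>C y) = cnj c * cinner x y"
  by (metis cinner_commute cinner_scaleC_left complex_cnj_mult)

lemma cinner_self: "cinner (x::'a::complex_inner) x = complex_of_real ((norm x)\<^sup>2)"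
proof (rule complex_eqI)
  show "Re (cinner x x) = Re (complex_of_real ((norm x)\<^sup>2))"
    by (simp add: inner_eq_Re_cinner[symmetric] power2_norm_eq_inner)
  have "Im (cinner x x) = - Im (cinner x x)"
    using arg_cong[OF cinner_commute[of x x], of Im] by simp
  then show "Im (cinner x x) = Im (complex_of_real ((norm x)\<^sup>2))" by simp
qed

lemma norm_scaleC_inner: "norm (c *\<^sub>C (x::'a::complex_inner)) = cmod c * norm x"
proof -
  have "complex_of_real ((norm (c *\<^sub>C x))\<^sup>2) = c * cnj c * complex_of_real ((norm x)\<^sup>2)"
    by (simp only: cinner_self[symmetric] cinner_scaleC_left cinner_scaleC_right) (simp add: mult_ac)
  also have "\<dots> = complex_of_real ((cmod c * norm x)\<^sup>2)"
    by (simp add: complex_norm_square[symmetric] power_mult_distrib)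
  finally have "(norm (c *\<^sub>C x))\<^sup>2 = (cmod c * norm x)\<^sup>2"
    using of_real_eq_iff by blast
  then show ?thesis by (simp add: power2_eq_iff_nonneg)
qed

instance complex_inner \<subseteq> complex_normed_vector
  by standard (rule norm_scaleC_inner)

class complex_hilbert = complex_inner + complete_space

instantiation complex :: complex_hilbert
begin
definition scaleC_complex :: "complex \<Rightarrow> complex \<Rightarrow> complex" where
  "scaleC_complex c x = c * x"
definition cinner_complex :: "complex \<Rightarrow> complex \<Rightarrow> complex" where
  "cinner_complex x y = x * cnj y"
instance
  by standard (auto simp: scaleC_complex_def cinner_complex_def algebra_simps scaleR_conv_of_real
      inner_complex_def)
end

lemma scaleC_simps [simp]:
  fixes x :: "'a::complex_vector"
  shows "c *\<^sub>C (0::'a) = 0" "0 *\<^sub>C x = 0" "1 *\<^sub>C x = x" "c *\<^sub>C (- x) = - (c *\<^sub>C x)"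
proof -
  show "c *\<^sub>C (0::'a) = 0" by (metis add_0 add_cancel_right_right scaleC_add_right)
  show 0: "0 *\<^sub>C x = 0" by (metis add_0 add_cancel_right_right scaleC_add_left)
  show "1 *\<^sub>C x = x" by (metis of_real_1 scaleR_one scaleR_scaleC)
  show "c *\<^sub>C (- x) = - (c *\<^sub>C x)"
    by (metis \<open>c *\<^sub>C 0 = 0\<close> add.right_inverse add_eq_0_iff scaleC_add_right)
qed

lemma scaleC_diff_right: "c *\<^sub>C (x - y) = c *\<^sub>C x - c *\<^sub>C (y::'a::complex_vector)"
  using scaleC_add_right[of c x "-y"] by simp

lemma cinner_zero [simp]: "cinner (0::'a::complex_inner) x = 0" "cinner x (0::'a::complex_inner) = 0"
  by (metis cinner_scaleC_left mult_zero_left scaleC_simps(2),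
      metis cinner_scaleC_right complex_cnj_zero mult_zero_left scaleC_simps(2))

lemma cinner_minus [simp]:
  "cinner (- (x::'a::complex_inner)) y = - cinner x y" "cinner x (- (y::'a::complex_inner)) = - cinner x y"
  by (metis add.right_inverse add_eq_0_iff cinner_add_left cinner_zero(1),
      metis add.right_inverse add_eq_0_iff cinner_add_right cinner_zero(2))

lemma cinner_diff_left: "cinner (x - y) z = cinner x z - cinner y (z::'a::complex_inner)"
  using cinner_add_left[of x "-y" z] by simp

lemma cinner_diff_right: "cinner z (x - y) = cinner z x - cinner (z::'a::complex_inner) y"
  using cinner_add_right[of z x "-y"] by simp

lemma norm_cinner_le: "cmod (cinner (x::'a::complex_inner) y) \<le> norm x * norm y"
proof (cases "cinner x y = 0")
  case False
  define c where "c = cnj (sgn (cinner x y))"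
  have c: "cmod c = 1" using False by (simp add: c_def norm_sgn)
  have "cinner (c *\<^sub>C x) y = complex_of_real (cmod (cinner x y))"
    using False by (simp add: c_def cinner_scaleC_left sgn_eq complex_norm_square[symmetric]
        power2_eq_square field_simps)
  then have "cmod (cinner x y) = inner (c *\<^sub>C x) y"
    by (simp add: inner_eq_Re_cinner)
  also have "\<dots> \<le> norm (c *\<^sub>C x) * norm y" by (rule norm_cauchy_schwarz)
  finally show ?thesis by (simp add: norm_scaleC c)
qed simp

lemma orthogonal_decomposition:
  fixes M :: "'a::{real_inner,complete_space} set"
  assumes M: "subspace M" "closed M"
  shows "\<exists>m\<in>M. \<forall>y\<in>M. inner (x - m) y = 0"
proof -
  define d where "d = infdist x M"
  have ne: "M \<noteq> {}" using M(1) subspace_0 by blast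
  have d_le: "d \<le> norm (x - y)" if "y \<in> M" for y
    using infdist_le[OF that] by (simp add: d_def dist_norm)
  have d0: "0 \<le> d" by (simp add: d_def infdist_nonneg)
  have "\<exists>y\<in>M. norm (x - y) < d + e" if "e > 0" for e
  proof (rule ccontr)
    assume "\<not> ?thesis"
    then have "d + e \<le> dist x y" if "y \<in> M" for y using that by (auto simp: dist_norm not_less)
    then have "d + e \<le> infdist x M" using ne by (simp add: infdist_notempty cINF_greatest)
    with \<open>e > 0\<close> show False by (simp add: d_def)
  qed
  then have "\<forall>n. \<exists>y\<in>M. norm (x - y) < d + 1 / Suc n" by simp
  then obtain s where s: "\<And>n. s n \<in> M" "\<And>n. norm (x - s n) < d + 1 / Suc n" by metis
  have par: "(norm (y - z))\<^sup>2 \<le> 2 * (norm (x - y))\<^sup>2 + 2 * (norm (x - z))\<^sup>2 - 4 * d\<^sup>2"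
    if "y \<in> M" "z \<in> M" for y z
  proof -
    have "(1/2) *\<^sub>R (y + z) \<in> M" using M that by (simp add: subspace_add subspace_scale)
    then have "d \<le> norm (x - (1/2) *\<^sub>R (y + z))" by (rule d_le)
    then have "d\<^sup>2 \<le> (norm (x - (1/2) *\<^sub>R (y + z)))\<^sup>2" using d0 by (rule power_mono)
    moreover have "4 * (norm (x - (1/2) *\<^sub>R (y + z)))\<^sup>2 + (norm (y - z))\<^sup>2
        = 2 * (norm (x - y))\<^sup>2 + 2 * (norm (x - z))\<^sup>2"
      unfolding power2_norm_eq_inner
      by (simp add: inner_diff_left inner_diff_right inner_add_left inner_add_right inner_commute field_simps)
    ultimately show ?thesis by linarith
  qed
  have lim: "(\<lambda>n. norm (x - s n)) \<longlonglongrightarrow> d"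
  proof (rule tendsto_sandwich[of "\<lambda>_. d" _ _ "\<lambda>n. d + 1 / Suc n"])
    show "(\<lambda>n. d + 1 / Suc n) \<longlonglongrightarrow> d"
      using tendsto_add[OF tendsto_const[of d] LIMSEQ_inverse_real_of_nat] by (simp add: field_simps)
    show "\<forall>\<^sub>F n in sequentially. norm (x - s n) \<le> d + 1 / Suc n"
      by (intro always_eventually allI less_imp_le s(2))
  qed (use d_le s(1) in auto)
  have "Cauchy s"
  proof (rule metric_CauchyI)
    fix e :: real assume e: "e > 0"
    have "(\<lambda>n. (norm (x - s n))\<^sup>2) \<longlonglongrightarrow> d\<^sup>2" by (intro tendsto_power lim)
    moreover have "d\<^sup>2 < d\<^sup>2 + e\<^sup>2 / 4" using e by simp
    ultimately have "\<forall>\<^sub>F n in sequentially. (norm (x - s n))\<^sup>2 < d\<^sup>2 + e\<^sup>2 / 4" by (rule order_tendstoD)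
    then obtain N where N: "\<And>n. n \<ge> N \<Longrightarrow> (norm (x - s n))\<^sup>2 < d\<^sup>2 + e\<^sup>2 / 4"
      by (auto simp: eventually_sequentially)
    show "\<exists>N. \<forall>m\<ge>N. \<forall>n\<ge>N. dist (s m) (s n) < e"
    proof (intro exI allI impI)
      fix m n assume "m \<ge> N" "n \<ge> N"
      then have "(norm (s m - s n))\<^sup>2 < e\<^sup>2"
        using par[OF s(1) s(1), of m n] N[of m] N[of n] by linarith
      then show "dist (s m) (s n) < e" using e by (simp add: dist_norm power_less_imp_less_base)
    qed
  qed
  then obtain m where m: "s \<longlonglongrightarrow> m" using Cauchy_convergent convergent_def by blast
  have mM: "m \<in> M" using closed_sequentially[OF M(2)] s(1) m by blast
  have "(\<lambda>n. norm (x - s n)) \<longlonglongrightarrow> norm (x - m)" by (intro tendsto_intros m)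
  then have dm: "norm (x - m) = d" using lim LIMSEQ_unique by blast
  have "inner (x - m) y = 0" if y: "y \<in> M" for y
  proof (cases "y = 0")
    case False
    define t where "t = inner (x - m) y / inner y y"
    have "m + t *\<^sub>R y \<in> M" using M mM y by (simp add: subspace_add subspace_scale)
    then have "d \<le> norm (x - (m + t *\<^sub>R y))" by (rule d_le)
    then have "(norm (x - m))\<^sup>2 \<le> (norm (x - (m + t *\<^sub>R y)))\<^sup>2"
      unfolding dm using d0 by (rule power_mono)
    also have "\<dots> = (norm (x - m))\<^sup>2 - (inner (x - m) y)\<^sup>2 / inner y y"
      using False unfolding power2_norm_eq_inner t_def
      by (simp add: inner_diff_left inner_diff_right inner_add_left inner_add_right inner_commute
          power2_eq_square field_simps)
    finally show ?thesis
      using False by (smt (verit) divide_pos_pos inner_gt_zero_iff zero_less_power2)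
  qed simp
  with mM show ?thesis by blast
qed

instantiation blinfun :: (real_normed_vector, complex_normed_vector) complex_normed_vector
begin

lift_definition scaleC_blinfun :: "complex \<Rightarrow> 'a \<Rightarrow>\<^sub>L 'b \<Rightarrow> 'a \<Rightarrow>\<^sub>L 'b" is "\<lambda>c T x. c *\<^sub>C T x"
proof -
  fix c :: complex and T :: "'a \<Rightarrow> 'b" assume "bounded_linear T"
  then interpret T: bounded_linear T .
  have "bounded_linear (\<lambda>x::'b. c *\<^sub>C x)"
    by (rule bounded_linear_intro[where K = "cmod c"])
      (auto simp: scaleC_add_right norm_scaleC scaleR_scaleC scaleC_scaleC mult.commute)
  then show "bounded_linear (\<lambda>x. c *\<^sub>C T x)"
    using T.bounded_linear_axioms bounded_linear_compose by blast
qed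

instance
proof
  fix c d :: complex and S T :: "'a \<Rightarrow>\<^sub>L 'b" and r :: real
  show "c *\<^sub>C (S + T) = c *\<^sub>C S + c *\<^sub>C T" by transfer (simp add: scaleC_add_right)
  show "(c + d) *\<^sub>C S = c *\<^sub>C S + d *\<^sub>C S" by transfer (simp add: scaleC_add_left)
  show "c *\<^sub>C (d *\<^sub>C S) = (c * d) *\<^sub>C S" by transfer (simp add: scaleC_scaleC)
  show "r *\<^sub>R S = complex_of_real r *\<^sub>C S" by transfer (simp add: scaleR_scaleC)
  have le: "norm (c *\<^sub>C T) \<le> cmod c * norm T" for c and T :: "'a \<Rightarrow>\<^sub>L 'b"
  proof (rule norm_blinfun_bound)
    show "norm (blinfun_apply (c *\<^sub>C T) x) \<le> cmod c * norm T * norm x" for x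
      using mult_left_mono[OF norm_blinfun[of T x], of "cmod c"]
      by (simp add: scaleC_blinfun.rep_eq norm_scaleC mult.assoc)
  qed simp
  show "norm (c *\<^sub>C T) = cmod c * norm T"
  proof (cases "c = 0")
    case True
    then show ?thesis using le[of c T] by simp
  next
    case False
    have "T = inverse c *\<^sub>C (c *\<^sub>C T)"
      using False by transfer (simp add: scaleC_scaleC)
    then have "norm T \<le> inverse (cmod c) * norm (c *\<^sub>C T)"
      using le[of "inverse c" "c *\<^sub>C T"] by (simp add: norm_inverse)
    then have "cmod c * norm T \<le> norm (c *\<^sub>C T)"
      using False by (simp add: field_simps)
    with le[of c T] show ?thesis by simp
  qed
qed

end

section \<open>Orthonormal bases\<close>

definition orthonormal_basis :: "'a::complex_inner set \<Rightarrow> bool" where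
  "orthonormal_basis E \<longleftrightarrow> (\<forall>e\<in>E. norm e = 1) \<and> (\<forall>e\<in>E. \<forall>e'\<in>E. e \<noteq> e' \<longrightarrow> cinner e e' = 0) \<and>
     (\<forall>x. (\<forall>e\<in>E. cinner x e = 0) \<longrightarrow> x = 0)"

definition onb :: "'a::complex_inner set" where
  "onb = (SOME E. orthonormal_basis E)"

lemma onb: "orthonormal_basis (onb :: 'a::complex_inner set)"
proof -
  define A where "A = {E::'a set. (\<forall>e\<in>E. norm e = 1) \<and> (\<forall>e\<in>E. \<forall>e'\<in>E. e \<noteq> e' \<longrightarrow> cinner e e' = 0)}"
  have "\<exists>M\<in>A. \<forall>X\<in>A. M \<subseteq> X \<longrightarrow> X = M"
  proof (rule subset_Zorn)
    fix C assume C: "subset.chain A C"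
    have "\<Union>C \<in> A"
      unfolding A_def
    proof (intro CollectI conjI ballI impI)
      fix e assume "e \<in> \<Union>C"
      then show "norm e = 1" using C by (auto simp: A_def subset.chain_def)
    next
      fix e e' assume "e \<in> \<Union>C" "e' \<in> \<Union>C" and ne: "e \<noteq> e'"
      then obtain X Y where XY: "e \<in> X" "X \<in> C" "e' \<in> Y" "Y \<in> C" by blast
      then have "X \<subseteq> Y \<or> Y \<subseteq> X" using C by (auto simp: subset.chain_def)
      then obtain Z where "Z \<in> C" "e \<in> Z" "e' \<in> Z" using XY by blast
      moreover have "Z \<in> A" using C \<open>Z \<in> C\<close> by (auto simp: subset.chain_def)
      ultimately show "cinner e e' = 0" using ne by (simp add: A_def)
    qed
    then show "\<exists>U\<in>A. \<forall>X\<in>C. X \<subseteq> U" by blast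
  qed
  then obtain E where E: "E \<in> A" "\<And>X. X \<in> A \<Longrightarrow> E \<subseteq> X \<Longrightarrow> X = E" by blast
  have "x = 0" if x: "\<forall>e\<in>E. cinner x e = 0" for x
  proof (rule ccontr)
    assume "x \<noteq> 0"
    define u where "u = complex_of_real (inverse (norm x)) *\<^sub>C x"
    have u: "norm u = 1" using \<open>x \<noteq> 0\<close> by (simp add: u_def norm_scaleC norm_inverse)
    have ul: "cinner u e = 0" if "e \<in> E" for e using x that by (simp add: u_def cinner_scaleC_left)
    then have ur: "cinner e u = 0" if "e \<in> E" for e
      using that by (metis cinner_commute complex_cnj_zero)
    have "insert u E \<in> A" using E(1) u ul ur by (auto simp: A_def)
    then have "u \<in> E" using E(2) by blast
    then have "cinner u u = 0" using ul by blast
    then show False using u by (simp add: cinner_self)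
  qed
  then have "orthonormal_basis E" using E(1) by (auto simp: orthonormal_basis_def A_def)
  then show ?thesis unfolding onb_def by (rule someI)
qed

lemma cinner_sum_left: "cinner (\<Sum>i\<in>F. f i) (y::'a::complex_inner) = (\<Sum>i\<in>F. cinner (f i) y)"
  by (induction F rule: infinite_finite_induct) (auto simp: cinner_add_left)

lemma cinner_sum_right: "cinner (y::'a::complex_inner) (\<Sum>i\<in>F. f i) = (\<Sum>i\<in>F. cinner y (f i))"
  by (induction F rule: infinite_finite_induct) (auto simp: cinner_add_right)

lemma partial_expansion:
  fixes x :: "'a::complex_inner"
  assumes E: "orthonormal_basis E" and F: "finite F" "F \<subseteq> E"
  shows "(norm (x - (\<Sum>e\<in>F. cinner x e *\<^sub>C e)))\<^sup>2 = (norm x)\<^sup>2 - (\<Sum>e\<in>F. (cmod (cinner x e))\<^sup>2)"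
proof -
  define P where "P = (\<Sum>e\<in>F. cinner x e *\<^sub>C e)"
  have Pe: "cinner P e = cinner x e" if "e \<in> F" for e
  proof -
    have "cinner P e = (\<Sum>e'\<in>F. if e' = e then cinner x e else 0)"
      unfolding P_def cinner_sum_left
    proof (rule sum.cong[OF refl])
      fix e' assume "e' \<in> F"
      then show "cinner (cinner x e' *\<^sub>C e') e = (if e' = e then cinner x e else 0)"
        using E F that by (auto simp: cinner_scaleC_left orthonormal_basis_def cinner_self subset_eq)
    qed
    then show ?thesis using F that by simp
  qed
  have 0: "cinner (x - P) P = 0"
    by (subst (2) P_def) (simp add: cinner_sum_right cinner_scaleC_right cinner_diff_left Pe)
  have xP: "cinner x P = complex_of_real (\<Sum>e\<in>F. (cmod (cinner x e))\<^sup>2)"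
    unfolding P_def cinner_sum_right cinner_scaleC_right
    by (simp add: complex_norm_square mult.commute del: of_real_power)
  have "complex_of_real ((norm (x - P))\<^sup>2) = cinner (x - P) x"
    using 0 by (metis cinner_diff_right cinner_self diff_zero)
  also have "\<dots> = cinner x x - cnj (cinner x P)"
    by (metis cinner_commute cinner_diff_left)
  also have "\<dots> = complex_of_real ((norm x)\<^sup>2 - (\<Sum>e\<in>F. (cmod (cinner x e))\<^sup>2))"
    unfolding xP cinner_self by simp
  finally show ?thesis unfolding P_def using of_real_eq_iff by blast
qed

lemma bessel:
  fixes x :: "'a::complex_inner"
  assumes "orthonormal_basis E" "finite F" "F \<subseteq> E"
  shows "(\<Sum>e\<in>F. (cmod (cinner x e))\<^sup>2) \<le> (norm x)\<^sup>2"
  using partial_expansion[OF assms, of x] zero_le_power2[of "norm (x - (\<Sum>e\<in>F. cinner x e *\<^sub>C e))"]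
  by linarith

lemma bounded_linear_cinner_left: "bounded_linear (\<lambda>x. cinner x (y::'a::complex_inner))"
  by (rule bounded_linear_intro[where K = "norm y"])
    (auto simp: cinner_add_left scaleR_scaleC cinner_scaleC_left norm_cinner_le scaleC_complex_def)

lemma bounded_linear_cinner_right: "bounded_linear (\<lambda>x. cinner (y::'a::complex_inner) x)"
  by (rule bounded_linear_intro[where K = "norm y"])
    (auto simp: cinner_add_right scaleR_scaleC cinner_scaleC_right norm_cinner_le mult.commute
       scaleC_complex_def intro: order_trans[OF norm_cinner_le])

lemma bounded_linear_scaleC: "bounded_linear (\<lambda>x::'a::complex_normed_vector. c *\<^sub>C x)"
  by (rule bounded_linear_intro[where K = "cmod c"])
      (auto simp: scaleC_add_right norm_scaleC scaleR_scaleC scaleC_scaleC mult.commute)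

lemma cinner_zero_if_inner_zero:
  fixes w :: "'a::complex_inner"
  assumes "\<And>c. inner w (c *\<^sub>C y) = 0"
  shows "cinner w y = 0"
  using assms[of 1] assms[of \<i>] by (intro complex_eqI) (auto simp: inner_eq_Re_cinner cinner_scaleC_right)

lemma onb_expansion:
  fixes x :: "'a::complex_hilbert"
  assumes E: "orthonormal_basis E"
  shows "((\<lambda>e. cinner x e *\<^sub>C e) has_sum x) E"
proof -
  define M where "M = {x::'a. ((\<lambda>e. cinner x e *\<^sub>C e) has_sum x) E}"
  have crit: "x \<in> M \<longleftrightarrow> (\<forall>\<epsilon>>0. \<exists>F. finite F \<and> F \<subseteq> E \<and> norm (x - (\<Sum>e\<in>F. cinner x e *\<^sub>C e)) < \<epsilon>)"
    (is "_ \<longleftrightarrow> ?R x") for x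
  proof
    assume "x \<in> M"
    then have "((\<lambda>e. cinner x e *\<^sub>C e) has_sum x) E" by (simp add: M_def)
    then show "?R x" unfolding has_sum_def tendsto_iff eventually_finite_subsets_at_top
      by (metis dist_commute dist_norm order_refl)
  next
    assume R: "?R x"
    have "((\<lambda>e. cinner x e *\<^sub>C e) has_sum x) E"
      unfolding has_sum_def tendsto_iff eventually_finite_subsets_at_top
    proof (intro allI impI)
      fix \<epsilon> :: real assume "\<epsilon> > 0"
      with R obtain F where F: "finite F" "F \<subseteq> E" "norm (x - (\<Sum>e\<in>F. cinner x e *\<^sub>C e)) < \<epsilon>" by blast
      have "dist (\<Sum>e\<in>G. cinner x e *\<^sub>C e) x < \<epsilon>" if G: "finite G" "F \<subseteq> G" "G \<subseteq> E" for G
      proof -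
        have "(\<Sum>e\<in>F. (cmod (cinner x e))\<^sup>2) \<le> (\<Sum>e\<in>G. (cmod (cinner x e))\<^sup>2)"
          using G by (intro sum_mono2) auto
        then have "(norm (x - (\<Sum>e\<in>G. cinner x e *\<^sub>C e)))\<^sup>2 \<le> (norm (x - (\<Sum>e\<in>F. cinner x e *\<^sub>C e)))\<^sup>2"
          using partial_expansion[OF E, of F x] partial_expansion[OF E, of G x] F G by simp
        then have "norm (x - (\<Sum>e\<in>G. cinner x e *\<^sub>C e)) \<le> norm (x - (\<Sum>e\<in>F. cinner x e *\<^sub>C e))"
          by simp
        then show ?thesis using F by (simp add: dist_norm norm_minus_commute)
      qed
      then show "\<exists>X. finite X \<and> X \<subseteq> E \<and> (\<forall>Y. finite Y \<and> X \<subseteq> Y \<and> Y \<subseteq> E \<longrightarrow>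
          dist (\<Sum>e\<in>Y. cinner x e *\<^sub>C e) x < \<epsilon>)" using F by blast
    qed
    then show "x \<in> M" by (simp add: M_def)
  qed
  have scale: "c *\<^sub>C x \<in> M" if "x \<in> M" for c x
    using has_sum_bounded_linear[OF bounded_linear_scaleC[of c], of "\<lambda>e. cinner x e *\<^sub>C e" E x] that
    by (simp add: M_def cinner_scaleC_left scaleC_scaleC o_def)
  have "subspace M"
  proof (rule subspaceI)
    show "0 \<in> M" by (simp add: M_def)
    show "x + y \<in> M" if "x \<in> M" "y \<in> M" for x y
      using that has_sum_add[of "\<lambda>e. cinner x e *\<^sub>C e" E x "\<lambda>e. cinner y e *\<^sub>C e" y]
      by (simp add: M_def cinner_add_left scaleC_add_left)
    show "r *\<^sub>R x \<in> M" if "x \<in> M" for r x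
      using scale that by (simp add: scaleR_scaleC)
  qed
  moreover have "closed M"
    unfolding closed_sequential_limits
  proof (intro allI impI, elim conjE)
    fix s x assume s: "\<forall>n. s n \<in> M" "s \<longlonglongrightarrow> x"
    show "x \<in> M" unfolding crit
    proof (intro allI impI)
      fix \<epsilon> :: real assume "\<epsilon> > 0"
      then obtain n where n: "dist (s n) x < \<epsilon> / 2"
        using s(2) by (metis LIMSEQ_iff_nz dist_norm half_gt_zero le_refl)
      obtain F where F: "finite F" "F \<subseteq> E" "norm (s n - (\<Sum>e\<in>F. cinner (s n) e *\<^sub>C e)) < \<epsilon> / 2"
        using s(1) \<open>\<epsilon> > 0\<close> crit by (meson half_gt_zero)
      define z where "z = x - s n"
      have "(norm (z - (\<Sum>e\<in>F. cinner z e *\<^sub>C e)))\<^sup>2 \<le> (norm z)\<^sup>2"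
        using partial_expansion[OF E F(1,2), of z] by (simp add: sum_nonneg)
      then have "norm (z - (\<Sum>e\<in>F. cinner z e *\<^sub>C e)) \<le> norm z" by simp
      also have "\<dots> < \<epsilon> / 2" using n by (simp add: z_def dist_norm norm_minus_commute)
      moreover have "x - (\<Sum>e\<in>F. cinner x e *\<^sub>C e) = (z - (\<Sum>e\<in>F. cinner z e *\<^sub>C e))
          + (s n - (\<Sum>e\<in>F. cinner (s n) e *\<^sub>C e))"
      proof -
        have "cinner x e = cinner z e + cinner (s n) e" for e
          by (simp add: z_def cinner_diff_left)
        then show ?thesis by (simp add: z_def scaleC_add_left sum.distrib)
      qed
      ultimately have "norm (x - (\<Sum>e\<in>F. cinner x e *\<^sub>C e)) < \<epsilon>"
        using F(3) norm_triangle_ineq[of "z - (\<Sum>e\<in>F. cinner z e *\<^sub>C e)" "s n - (\<Sum>e\<in>F. cinner (s n) e *\<^sub>C e)"]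
        by simp
      then show "\<exists>F. finite F \<and> F \<subseteq> E \<and> norm (x - (\<Sum>e\<in>F. cinner x e *\<^sub>C e)) < \<epsilon>" using F by blast
    qed
  qed
  ultimately obtain m where m: "m \<in> M" "\<And>y. y \<in> M \<Longrightarrow> inner (x - m) y = 0"
    using orthogonal_decomposition[of M x] by blast
  have "e \<in> M" if "e \<in> E" for e
    unfolding crit
  proof (intro allI impI exI[of _ "{e}"])
    show "finite {e} \<and> {e} \<subseteq> E \<and> norm (e - (\<Sum>e'\<in>{e}. cinner e e' *\<^sub>C e')) < \<epsilon>" if "\<epsilon> > 0" for \<epsilon>
      using \<open>e \<in> E\<close> E that by (simp add: orthonormal_basis_def cinner_self)
  qed
  then have "cinner (x - m) e = 0" if "e \<in> E" for e
    using that by (intro cinner_zero_if_inner_zero m(2) scale)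
  then have "x - m = 0" using E unfolding orthonormal_basis_def by blast
  then have "x \<in> M" using m(1) by simp
  then show ?thesis by (simp add: M_def)
qed

lemma parseval:
  fixes x y :: "'a::complex_hilbert"
  assumes "orthonormal_basis E"
  shows "((\<lambda>e. cinner x e * cinner e y) has_sum cinner x y) E"
  using has_sum_bounded_linear[OF bounded_linear_cinner_left[of y] onb_expansion[OF assms, of x]]
  by (simp add: o_def cinner_scaleC_left)

section \<open>Bounded operators\<close>

text \<open>\<open>'a \<Rightarrow>\<^sub>L 'b\<close> consists of the bounded real-linear maps; \<open>bounded_ops\<close> is the set of the
  complex-linear ones among them.\<close>

definition bounded_ops :: "('a::complex_hilbert \<Rightarrow>\<^sub>L 'b::complex_hilbert) set" where
  "bounded_ops = {T. \<forall>c x. blinfun_apply T (c *\<^sub>C x) = c *\<^sub>C blinfun_apply T x}"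

definition adj :: "('a::complex_hilbert \<Rightarrow>\<^sub>L 'b::complex_hilbert) \<Rightarrow> ('b \<Rightarrow>\<^sub>L 'a)" where
  "adj T = (THE S. \<forall>x y. cinner (blinfun_apply T x) y = cinner x (blinfun_apply S y))"

lemma riesz:
  fixes f :: "'a::complex_hilbert \<Rightarrow> complex"
  assumes f: "bounded_linear f" "\<And>c x. f (c *\<^sub>C x) = c * f x"
  shows "\<exists>z. \<forall>x. f x = cinner x z"
proof (cases "\<forall>x. f x = 0")
  case True
  then show ?thesis by (intro exI[of _ 0]) simp
next
  case False
  then obtain x0 where x0: "f x0 \<noteq> 0" by blast
  interpret f: bounded_linear f by fact
  have ker: "subspace {x. f x = 0}" by (rule subspaceI) (auto simp: f.add f.scaleR)
  have "closed {x. f x = 0}"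
    by (rule closed_Collect_eq[OF linear_continuous_on[OF f(1)] continuous_on_const])
  from orthogonal_decomposition[OF ker this, of x0]
  obtain m where m: "f m = 0" and mo: "\<forall>y\<in>{x. f x = 0}. inner (x0 - m) y = 0" by blast
  define w where "w = x0 - m"
  have w: "f w \<noteq> 0" using x0 m by (simp add: w_def f.diff)
  have wy: "cinner w y = 0" if "f y = 0" for y
    unfolding w_def by (rule cinner_zero_if_inner_zero, rule bspec[OF mo]) (simp add: f(2) that)
  have "f x = cinner x (cnj (f w / cinner w w) *\<^sub>C w)" for x
  proof -
    have ww: "cinner w w \<noteq> 0" using w f.zero by (auto simp: cinner_self)
    have "f (x - (f x / f w) *\<^sub>C w) = 0" using w by (simp add: f.diff f(2))
    then have "cinner w (x - (f x / f w) *\<^sub>C w) = 0" by (rule wy)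
    then have "cinner (x - (f x / f w) *\<^sub>C w) w = 0" by (metis cinner_commute complex_cnj_zero)
    then have "cinner x w = (f x / f w) * cinner w w"
      by (simp add: cinner_diff_left cinner_scaleC_left)
    then show ?thesis using w ww by (simp add: cinner_scaleC_right)
  qed
  then show ?thesis by blast
qed

lemma cinner_ext: "(\<And>x. cinner x y = cinner x z) \<Longrightarrow> y = (z::'a::complex_inner)"
proof -
  assume "\<And>x. cinner x y = cinner x z"
  then have "cinner (y - z) (y - z) = 0" by (simp add: cinner_diff_right)
  then show "y = z" by (simp add: cinner_self)
qed

lemma adj:
  fixes T :: "'a::complex_hilbert \<Rightarrow>\<^sub>L 'b::complex_hilbert"
  assumes T: "T \<in> bounded_ops"
  shows "cinner (blinfun_apply T x) y = cinner x (blinfun_apply (adj T) y)"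
proof -
  have "\<exists>z. \<forall>x. cinner (blinfun_apply T x) y = cinner x z" for y
  proof (rule riesz)
    show "bounded_linear (\<lambda>x. cinner (blinfun_apply T x) y)"
      by (intro bounded_linear_compose[OF bounded_linear_cinner_left] blinfun.bounded_linear_right)
    show "cinner (blinfun_apply T (c *\<^sub>C x)) y = c * cinner (blinfun_apply T x) y" for c x
      using T by (simp add: bounded_ops_def cinner_scaleC_left)
  qed
  then obtain S where S: "\<And>x y. cinner (blinfun_apply T x) y = cinner x (S y)" by metis
  have "bounded_linear S"
  proof (rule bounded_linear_intro[where K = "norm T"])
    show "S (x + y) = S x + S y" for x y
      by (rule cinner_ext) (simp add: cinner_add_right S[symmetric])
    show "S (r *\<^sub>R x) = r *\<^sub>R S x" for r x
      by (rule cinner_ext) (simp add: cinner_scaleC_right S[symmetric] scaleR_scaleC)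
    fix y
    have "(norm (S y))\<^sup>2 = cmod (cinner (S y) (S y))" unfolding cinner_self norm_of_real by simp
    also have "\<dots> = cmod (cinner (blinfun_apply T (S y)) y)" by (simp add: S)
    also have "\<dots> \<le> norm (blinfun_apply T (S y)) * norm y" by (rule norm_cinner_le)
    also have "\<dots> \<le> norm T * norm (S y) * norm y" by (intro mult_right_mono norm_blinfun) auto
    finally have "norm (S y) * norm (S y) \<le> norm (S y) * (norm y * norm T)"
      by (simp add: power2_eq_square mult_ac)
    then show "norm (S y) \<le> norm y * norm T"
      by (cases "norm (S y) = 0") auto
  qed
  then have B: "\<forall>x y. cinner (blinfun_apply T x) y = cinner x (blinfun_apply (Blinfun S) y)"
    using S by (simp add: bounded_linear_Blinfun_apply)
  have "adj T = Blinfun S"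
    unfolding adj_def
  proof (rule the_equality)
    show "\<forall>x y. cinner (blinfun_apply T x) y = cinner x (blinfun_apply (Blinfun S) y)" by (rule B)
  next
    fix S' assume "\<forall>x y. cinner (blinfun_apply T x) y = cinner x (blinfun_apply S' y)"
    then show "S' = Blinfun S"
      by - (rule blinfun_eqI, rule cinner_ext, metis B)
  qed
  then show ?thesis using B by simp
qed

definition re_part :: "('a::complex_hilbert \<Rightarrow>\<^sub>L 'a) \<Rightarrow> ('a \<Rightarrow>\<^sub>L 'a)" where
  "re_part T = (1/2) *\<^sub>R (T + adj T)"

definition op_nonneg :: "('a::complex_hilbert \<Rightarrow>\<^sub>L 'a) \<Rightarrow> bool" where
  "op_nonneg T \<longleftrightarrow> (\<forall>x. cinner (blinfun_apply T x) x \<in> \<real> \<and> 0 \<le> Re (cinner (blinfun_apply T x) x))"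

definition op_le :: "('a::complex_hilbert \<Rightarrow>\<^sub>L 'a) \<Rightarrow> ('a \<Rightarrow>\<^sub>L 'a) \<Rightarrow> bool" where
  "op_le S T \<longleftrightarrow> op_nonneg (T - S)"

section \<open>Square-summable families\<close>

typedef (overloaded) ('i, 'a) l2 = "{f :: 'i \<Rightarrow> 'a::complex_inner. (\<lambda>i. (norm (f i))\<^sup>2) summable_on UNIV}"
  morphisms l2_nth Abs_l2
  by (rule exI[of _ "\<lambda>_. 0"]) simp

setup_lifting type_definition_l2

lemma sq_summable_add:
  fixes f g :: "'i \<Rightarrow> 'a::real_normed_vector"
  assumes "(\<lambda>i. (norm (f i))\<^sup>2) summable_on A" "(\<lambda>i. (norm (g i))\<^sup>2) summable_on A"
  shows "(\<lambda>i. (norm (f i + g i))\<^sup>2) summable_on A"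
proof (rule summable_on_comparison_test)
  show "(\<lambda>i. 2 * (norm (f i))\<^sup>2 + 2 * (norm (g i))\<^sup>2) summable_on A"
    by (intro summable_on_add summable_on_cmult_right assms)
  fix i
  have "(norm (f i + g i))\<^sup>2 \<le> (norm (f i) + norm (g i))\<^sup>2"
    by (intro power_mono norm_triangle_ineq) simp
  also have "\<dots> \<le> 2 * (norm (f i))\<^sup>2 + 2 * (norm (g i))\<^sup>2"
    using sum_squares_bound[of "norm (f i)" "norm (g i)"] by (simp add: power2_sum)
  finally show "(norm (f i + g i))\<^sup>2 \<le> 2 * (norm (f i))\<^sup>2 + 2 * (norm (g i))\<^sup>2" .
qed simp

lemma sq_summable_scaleC:
  fixes f :: "'i \<Rightarrow> 'a::complex_normed_vector"
  assumes "(\<lambda>i. (norm (f i))\<^sup>2) summable_on A"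
  shows "(\<lambda>i. (norm (c *\<^sub>C f i))\<^sup>2) summable_on A"
  using summable_on_cmult_right[OF assms, of "(cmod c)\<^sup>2"] by (simp add: norm_scaleC power_mult_distrib)

lemma cinner_summable:
  fixes f g :: "'i \<Rightarrow> 'a::complex_inner"
  assumes "(\<lambda>i. (norm (f i))\<^sup>2) summable_on A" "(\<lambda>i. (norm (g i))\<^sup>2) summable_on A"
  shows "(\<lambda>i. cinner (f i) (g i)) summable_on A"
proof (rule abs_summable_summable, rule summable_on_comparison_test)
  show "(\<lambda>i. (norm (f i))\<^sup>2 + (norm (g i))\<^sup>2) summable_on A"
    by (intro summable_on_add assms)
  fix i
  have "norm (cinner (f i) (g i)) \<le> norm (f i) * norm (g i)" by (rule norm_cinner_le)
  also have "\<dots> \<le> (norm (f i))\<^sup>2 + (norm (g i))\<^sup>2"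
    using sum_squares_bound[of "norm (f i)" "norm (g i)"] mult_nonneg_nonneg[of "norm (f i)" "norm (g i)"]
    by (simp add: mult.assoc del: mult_nonneg_nonneg)
  finally show "norm (cinner (f i) (g i)) \<le> (norm (f i))\<^sup>2 + (norm (g i))\<^sup>2" .
qed simp

instantiation l2 :: (type, complex_inner) complex_inner
begin

lift_definition zero_l2 :: "('a, 'b) l2" is "\<lambda>_. 0" by simp
lift_definition plus_l2 :: "('a, 'b) l2 \<Rightarrow> ('a, 'b) l2 \<Rightarrow> ('a, 'b) l2" is "\<lambda>f g i. f i + g i"
  by (rule sq_summable_add)
lift_definition uminus_l2 :: "('a, 'b) l2 \<Rightarrow> ('a, 'b) l2" is "\<lambda>f i. - f i" by simp
lift_definition minus_l2 :: "('a, 'b) l2 \<Rightarrow> ('a, 'b) l2 \<Rightarrow> ('a, 'b) l2" is "\<lambda>f g i. f i - g i"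
  using sq_summable_add[where g = "\<lambda>i. - _ i"] by simp
lift_definition scaleC_l2 :: "complex \<Rightarrow> ('a, 'b) l2 \<Rightarrow> ('a, 'b) l2" is "\<lambda>c f i. c *\<^sub>C f i"
  by (rule sq_summable_scaleC)
lift_definition scaleR_l2 :: "real \<Rightarrow> ('a, 'b) l2 \<Rightarrow> ('a, 'b) l2" is "\<lambda>r f i. r *\<^sub>R f i"
  by (simp only: scaleR_scaleC) (rule sq_summable_scaleC)
lift_definition cinner_l2 :: "('a, 'b) l2 \<Rightarrow> ('a, 'b) l2 \<Rightarrow> complex" is
  "\<lambda>f g. \<Sum>\<^sub>\<infinity>i. cinner (f i) (g i)" .
definition inner_l2 :: "('a, 'b) l2 \<Rightarrow> ('a, 'b) l2 \<Rightarrow> real" where "inner_l2 x y = Re (cinner x y)"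
definition norm_l2 :: "('a, 'b) l2 \<Rightarrow> real" where "norm_l2 x = sqrt (inner x x)"
definition dist_l2 :: "('a, 'b) l2 \<Rightarrow> ('a, 'b) l2 \<Rightarrow> real" where "dist_l2 x y = norm (x - y)"
definition sgn_l2 :: "('a, 'b) l2 \<Rightarrow> ('a, 'b) l2" where "sgn_l2 x = inverse (norm x) *\<^sub>R x"
definition uniformity_l2 :: "(('a, 'b) l2 \<times> ('a, 'b) l2) filter" where
  "uniformity_l2 = (INF e\<in>{0 <..}. principal {(x, y). dist x y < e})"
definition open_l2 :: "('a, 'b) l2 set \<Rightarrow> bool" where
  "open_l2 S \<longleftrightarrow> (\<forall>x\<in>S. \<forall>\<^sub>F (x', y) in uniformity. x' = x \<longrightarrow> y \<in> S)"

instance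
proof
  fix x y z :: "('a, 'b) l2" and c d :: complex and r s :: real
  show "x + y + z = x + (y + z)" by transfer (simp add: add.assoc)
  show "x + y = y + x" by transfer (simp add: add.commute)
  show "0 + x = x" by transfer simp
  show "- x + x = 0" by transfer simp
  show "x - y = x + - y" by transfer simp
  show "r *\<^sub>R (x + y) = r *\<^sub>R x + r *\<^sub>R y" by transfer (simp add: scaleR_add_right)
  show "(r + s) *\<^sub>R x = r *\<^sub>R x + s *\<^sub>R x" by transfer (simp add: scaleR_add_left)
  show "r *\<^sub>R s *\<^sub>R x = (r * s) *\<^sub>R x" by transfer simp
  show "1 *\<^sub>R x = x" by transfer simp
  show "c *\<^sub>C (x + y) = c *\<^sub>C x + c *\<^sub>C y" by transfer (simp add: scaleC_add_right)
  show "(c + d) *\<^sub>C x = c *\<^sub>C x + d *\<^sub>C x" by transfer (simp add: scaleC_add_left)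
  show "c *\<^sub>C d *\<^sub>C x = (c * d) *\<^sub>C x" by transfer (simp add: scaleC_scaleC)
  show "r *\<^sub>R x = complex_of_real r *\<^sub>C x" by transfer (simp add: scaleR_scaleC)
  show comm: "cinner x y = cnj (cinner y x)" for x y :: "('a, 'b) l2"
    by transfer (simp only: infsum_cnj[symmetric] cinner_commute[symmetric])
  show addl: "cinner (x + y) z = cinner x z + cinner y z" for x y z :: "('a, 'b) l2"
    by transfer (simp add: cinner_add_left infsum_add cinner_summable)
  show scl: "cinner (c *\<^sub>C x) y = c * cinner x y" for c and x y :: "('a, 'b) l2"
    by transfer (simp add: cinner_scaleC_left infsum_cmult_right cinner_summable)
  show "inner x y = Re (cinner x y)" by (simp add: inner_l2_def)
  show "inner x y = inner y x" using comm[of x y] by (simp add: inner_l2_def)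
  show "inner (x + y) z = inner x z + inner y z" by (simp add: inner_l2_def addl)
  have sc: "r *\<^sub>R x = complex_of_real r *\<^sub>C x" by transfer (simp add: scaleR_scaleC)
  show "inner (r *\<^sub>R x) y = r * inner x y" by (simp add: inner_l2_def sc scl)
  have self: "inner x x = (\<Sum>\<^sub>\<infinity>i. (norm (l2_nth x i))\<^sup>2)"
    using infsum_Re[OF cinner_summable, of "l2_nth x" UNIV "l2_nth x"] l2_nth[of x]
    by (simp add: inner_l2_def cinner_l2.rep_eq cinner_self flip: of_real_power)
  show "0 \<le> inner x x" unfolding self by (rule infsum_nonneg) simp
  show "inner x x = 0 \<longleftrightarrow> x = 0"
  proof
    assume "inner x x = 0"
    then have "(norm (l2_nth x i))\<^sup>2 = 0" for i
      unfolding self using l2_nth[of x] by (intro nonneg_infsum_le_0D[where A = UNIV]) auto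
    then show "x = 0" by transfer auto
  next
    assume "x = 0"
    then show "inner x x = 0" unfolding self by (simp add: zero_l2.rep_eq)
  qed
  show "norm x = sqrt (inner x x)" by (simp add: norm_l2_def)
qed (simp_all add: dist_l2_def sgn_l2_def uniformity_l2_def open_l2_def)

end

lemma norm_l2_sq: "(norm x)\<^sup>2 = (\<Sum>\<^sub>\<infinity>i. (norm (l2_nth x i))\<^sup>2)"
proof -
  have "(norm x)\<^sup>2 = inner x x" by (simp add: power2_norm_eq_inner)
  then show ?thesis
    using infsum_Re[OF cinner_summable, of "l2_nth x" UNIV "l2_nth x"] l2_nth[of x]
    by (simp add: inner_l2_def cinner_l2.rep_eq cinner_self flip: of_real_power)
qed

lemma sum_norm_l2_nth_le: "finite F \<Longrightarrow> (\<Sum>i\<in>F. (norm (l2_nth x i))\<^sup>2) \<le> (norm x)\<^sup>2"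
  unfolding norm_l2_sq using l2_nth[of x] by (intro finite_sum_le_infsum) auto

lemma norm_l2_nth_le: "norm (l2_nth x i) \<le> norm x"
  using sum_norm_l2_nth_le[of "{i}" x] by simp

lemma bounded_linear_l2_nth: "bounded_linear (\<lambda>x. l2_nth x i)"
  by (rule bounded_linear_intro[where K = 1])
    (simp_all add: plus_l2.rep_eq scaleR_l2.rep_eq norm_l2_nth_le)

instance l2 :: (type, complex_hilbert) complex_hilbert
proof
  fix X :: "nat \<Rightarrow> ('a, 'b) l2" assume X: "Cauchy X"
  have "Cauchy (\<lambda>n. l2_nth (X n) i)" for i
    using X by (rule bounded_linear.Cauchy[OF bounded_linear_l2_nth])
  then have "\<forall>i. \<exists>l. (\<lambda>n. l2_nth (X n) i) \<longlonglongrightarrow> l"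
    using Cauchy_convergent convergent_def by blast
  from choice[OF this] obtain f where f: "\<And>i. (\<lambda>n. l2_nth (X n) i) \<longlonglongrightarrow> f i" by blast
  have fin: "(\<Sum>i\<in>F. (norm (l2_nth (X m) i - f i))\<^sup>2) \<le> \<epsilon>\<^sup>2"
    if N: "\<And>m n. m \<ge> N \<Longrightarrow> n \<ge> N \<Longrightarrow> norm (X m - X n) < \<epsilon>" and "m \<ge> N" "finite F" for N m \<epsilon> F
  proof (rule LIMSEQ_le_const2)
    show "(\<lambda>n. \<Sum>i\<in>F. (norm (l2_nth (X m) i - l2_nth (X n) i))\<^sup>2) \<longlonglongrightarrow>
        (\<Sum>i\<in>F. (norm (l2_nth (X m) i - f i))\<^sup>2)"
      by (intro tendsto_intros f)
    show "\<exists>N. \<forall>n\<ge>N. (\<Sum>i\<in>F. (norm (l2_nth (X m) i - l2_nth (X n) i))\<^sup>2) \<le> \<epsilon>\<^sup>2"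
    proof (intro exI allI impI)
      fix n assume "n \<ge> N"
      have "(\<Sum>i\<in>F. (norm (l2_nth (X m - X n) i))\<^sup>2) \<le> (norm (X m - X n))\<^sup>2"
        using \<open>finite F\<close> by (rule sum_norm_l2_nth_le)
      also have "\<dots> \<le> \<epsilon>\<^sup>2" using N[OF \<open>m \<ge> N\<close> \<open>n \<ge> N\<close>] by (intro power_mono) auto
      finally show "(\<Sum>i\<in>F. (norm (l2_nth (X m) i - l2_nth (X n) i))\<^sup>2) \<le> \<epsilon>\<^sup>2"
        by (simp add: minus_l2.rep_eq)
    qed
  qed
  have ex: "\<exists>N. \<forall>m\<ge>N. \<forall>n\<ge>N. norm (X m - X n) < \<epsilon>" if "\<epsilon> > 0" for \<epsilon>
    using X that by (simp add: Cauchy_iff)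
  have diff: "(\<lambda>i. (norm (l2_nth (X m) i - f i))\<^sup>2) summable_on UNIV"
    if "\<And>m n. m \<ge> N \<Longrightarrow> n \<ge> N \<Longrightarrow> norm (X m - X n) < \<epsilon>" "m \<ge> N" for N m \<epsilon>
    using fin[OF that] by (intro nonneg_bounded_partial_sums_imp_summable_on[where C = "\<epsilon>\<^sup>2"])
      (auto intro!: eventually_finite_subsets_at_top_weakI)
  obtain N1 where N1: "\<And>m n. m \<ge> N1 \<Longrightarrow> n \<ge> N1 \<Longrightarrow> norm (X m - X n) < 1"
    using ex[of 1] by auto
  have "(\<lambda>i. (norm (l2_nth (X N1) i + - (l2_nth (X N1) i - f i)))\<^sup>2) summable_on UNIV"
    by (rule sq_summable_add) (use diff[OF N1 order_refl] l2_nth[of "X N1"] in \<open>auto simp: norm_minus_commute\<close>)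
  then have "(\<lambda>i. (norm (f i))\<^sup>2) summable_on UNIV" by simp
  then have L: "l2_nth (Abs_l2 f) = f" by (simp add: Abs_l2_inverse)
  have "X \<longlonglongrightarrow> Abs_l2 f"
  proof (rule metric_LIMSEQ_I)
    fix \<epsilon> :: real assume "\<epsilon> > 0"
    then obtain N where N: "\<And>m n. m \<ge> N \<Longrightarrow> n \<ge> N \<Longrightarrow> norm (X m - X n) < \<epsilon> / 2"
      using ex[of "\<epsilon> / 2"] by auto
    show "\<exists>N. \<forall>n\<ge>N. dist (X n) (Abs_l2 f) < \<epsilon>"
    proof (intro exI allI impI)
      fix m assume m: "m \<ge> N"
      have "(norm (X m - Abs_l2 f))\<^sup>2 \<le> (\<epsilon> / 2)\<^sup>2"
        unfolding norm_l2_sq minus_l2.rep_eq L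
        using fin[OF N m] diff[OF N m] by (intro infsum_le_finite_sums) auto
      then have "norm (X m - Abs_l2 f) \<le> \<epsilon> / 2"
        using \<open>\<epsilon> > 0\<close> by (simp add: power2_le_iff_abs_le)
      then show "dist (X m) (Abs_l2 f) < \<epsilon>" using \<open>\<epsilon> > 0\<close> by (simp add: dist_norm)
    qed
  qed
  then show "convergent X" by (auto simp: convergent_def)
qed

section \<open>The Hilbert tensor product\<close>

text \<open>We realise \<open>H \<otimes> K\<close> as the space of square-summable families of vectors of \<open>K\<close> indexed by an
  orthonormal basis \<open>onb\<close> of \<open>H\<close>, with \<open>x \<otimes> y\<close> the family \<open>e \<mapsto> \<langle>x, e\<rangle> y\<close>.
  The lemmas \<open>cinner_tensor_vec\<close> and \<open>span_tensor_vec\<close> show that this is a Hilbert tensor product,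
  which determines it up to a unitary operator respecting elementary tensors.\<close>

typedef (overloaded) ('a, 'b) tensor =
  "{f :: ('a::complex_hilbert, 'b::complex_hilbert) l2. \<forall>e. e \<notin> onb \<longrightarrow> l2_nth f e = 0}"
  morphisms tensor_l2 Abs_tensor
  by (rule exI[of _ 0]) (simp add: zero_l2.rep_eq)

setup_lifting type_definition_tensor

instantiation tensor :: (complex_hilbert, complex_hilbert) complex_inner
begin

lift_definition zero_tensor :: "('a, 'b) tensor" is 0 by (simp add: zero_l2.rep_eq)
lift_definition plus_tensor :: "('a, 'b) tensor \<Rightarrow> ('a, 'b) tensor \<Rightarrow> ('a, 'b) tensor" is "(+)"
  by (simp add: plus_l2.rep_eq)
lift_definition uminus_tensor :: "('a, 'b) tensor \<Rightarrow> ('a, 'b) tensor" is uminus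
  by (simp add: uminus_l2.rep_eq)
lift_definition minus_tensor :: "('a, 'b) tensor \<Rightarrow> ('a, 'b) tensor \<Rightarrow> ('a, 'b) tensor" is "(-)"
  by (simp add: minus_l2.rep_eq)
lift_definition scaleC_tensor :: "complex \<Rightarrow> ('a, 'b) tensor \<Rightarrow> ('a, 'b) tensor" is "(*\<^sub>C)"
  by (simp add: scaleC_l2.rep_eq)
lift_definition scaleR_tensor :: "real \<Rightarrow> ('a, 'b) tensor \<Rightarrow> ('a, 'b) tensor" is "(*\<^sub>R)"
  by (simp add: scaleR_l2.rep_eq)
lift_definition cinner_tensor :: "('a, 'b) tensor \<Rightarrow> ('a, 'b) tensor \<Rightarrow> complex" is cinner .
lift_definition inner_tensor :: "('a, 'b) tensor \<Rightarrow> ('a, 'b) tensor \<Rightarrow> real" is inner .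
lift_definition norm_tensor :: "('a, 'b) tensor \<Rightarrow> real" is norm .
definition dist_tensor :: "('a, 'b) tensor \<Rightarrow> ('a, 'b) tensor \<Rightarrow> real" where
  "dist_tensor x y = norm (x - y)"
definition sgn_tensor :: "('a, 'b) tensor \<Rightarrow> ('a, 'b) tensor" where
  "sgn_tensor x = inverse (norm x) *\<^sub>R x"
definition uniformity_tensor :: "(('a, 'b) tensor \<times> ('a, 'b) tensor) filter" where
  "uniformity_tensor = (INF e\<in>{0 <..}. principal {(x, y). dist x y < e})"
definition open_tensor :: "('a, 'b) tensor set \<Rightarrow> bool" where
  "open_tensor S \<longleftrightarrow> (\<forall>x\<in>S. \<forall>\<^sub>F (x', y) in uniformity. x' = x \<longrightarrow> y \<in> S)"

instance
proof
  fix x y z :: "('a, 'b) tensor" and c d :: complex and r s :: real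
  show "x + y + z = x + (y + z)" by transfer (simp add: add.assoc)
  show "x + y = y + x" by transfer (simp add: add.commute)
  show "0 + x = x" by transfer simp
  show "- x + x = 0" by transfer simp
  show "x - y = x + - y" by transfer simp
  show "r *\<^sub>R (x + y) = r *\<^sub>R x + r *\<^sub>R y" by transfer (simp add: scaleR_add_right)
  show "(r + s) *\<^sub>R x = r *\<^sub>R x + s *\<^sub>R x" by transfer (simp add: scaleR_add_left)
  show "r *\<^sub>R s *\<^sub>R x = (r * s) *\<^sub>R x" by transfer simp
  show "1 *\<^sub>R x = x" by transfer simp
  show "c *\<^sub>C (x + y) = c *\<^sub>C x + c *\<^sub>C y" by transfer (rule scaleC_add_right)
  show "(c + d) *\<^sub>C x = c *\<^sub>C x + d *\<^sub>C x" by transfer (rule scaleC_add_left)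
  show "c *\<^sub>C d *\<^sub>C x = (c * d) *\<^sub>C x" by transfer (rule scaleC_scaleC)
  show "r *\<^sub>R x = complex_of_real r *\<^sub>C x" by transfer (rule scaleR_scaleC)
  show "cinner x y = cnj (cinner y x)" by transfer (rule cinner_commute)
  show "cinner (x + y) z = cinner x z + cinner y z" by transfer (rule cinner_add_left)
  show "cinner (c *\<^sub>C x) y = c * cinner x y" by transfer (rule cinner_scaleC_left)
  show "inner x y = Re (cinner x y)" by transfer (rule inner_eq_Re_cinner)
  show "inner x y = inner y x" by transfer (rule inner_commute)
  show "inner (x + y) z = inner x z + inner y z" by transfer (rule inner_add_left)
  show "inner (r *\<^sub>R x) y = r * inner x y" by transfer simp
  show "0 \<le> inner x x" by transfer simp
  show "inner x x = 0 \<longleftrightarrow> x = 0" by transfer simp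
  show "norm x = sqrt (inner x x)" by transfer (rule norm_eq_sqrt_inner)
qed (simp_all add: dist_tensor_def sgn_tensor_def uniformity_tensor_def open_tensor_def)

end

instance tensor :: (complex_hilbert, complex_hilbert) complex_hilbert
proof
  fix X :: "nat \<Rightarrow> ('a, 'b) tensor" assume "Cauchy X"
  then have "Cauchy (\<lambda>n. tensor_l2 (X n))"
    by (simp add: Cauchy_def dist_norm norm_tensor.rep_eq minus_tensor.rep_eq)
  then obtain f where f: "(\<lambda>n. tensor_l2 (X n)) \<longlonglongrightarrow> f"
    using Cauchy_convergent convergent_def by blast
  have "l2_nth f e = 0" if "e \<notin> onb" for e
  proof -
    have "(\<lambda>n. l2_nth (tensor_l2 (X n)) e) \<longlonglongrightarrow> l2_nth f e"
      by (rule bounded_linear.tendsto[OF bounded_linear_l2_nth f])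
    moreover have "l2_nth (tensor_l2 (X n)) e = 0" for n using tensor_l2[of "X n"] that by simp
    ultimately show ?thesis by (simp add: LIMSEQ_const_iff)
  qed
  then have L: "tensor_l2 (Abs_tensor f) = f" by (simp add: Abs_tensor_inverse)
  have "X \<longlonglongrightarrow> Abs_tensor f"
    using f by (simp add: lim_sequentially dist_norm norm_tensor.rep_eq minus_tensor.rep_eq L)
  then show "convergent X" by (auto simp: convergent_def)
qed

lemma bessel_summable:
  fixes x :: "'a::complex_inner"
  assumes "orthonormal_basis E"
  shows "(\<lambda>e. (cmod (cinner x e))\<^sup>2) summable_on E"
  using bessel[OF assms, of _ x]
  by (intro nonneg_bounded_partial_sums_imp_summable_on[where C = "(norm x)\<^sup>2"])
    (auto intro!: eventually_finite_subsets_at_top_weakI)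

definition tensor_vec ::
  "'a::complex_hilbert \<Rightarrow> 'b::complex_hilbert \<Rightarrow> ('a, 'b) tensor" (infixr "\<otimes>\<^sub>v" 70) where
  "x \<otimes>\<^sub>v y = Abs_tensor (Abs_l2 (\<lambda>e. if e \<in> onb then cinner x e *\<^sub>C y else 0))"

lemma tensor_vec_nth:
  "l2_nth (tensor_l2 (x \<otimes>\<^sub>v y)) e = (if e \<in> onb then cinner x e *\<^sub>C y else 0)"
proof -
  define f where "f = (\<lambda>e. if e \<in> onb then cinner x e *\<^sub>C y else 0)"
  have "(\<lambda>e. (norm (f e))\<^sup>2) summable_on UNIV \<longleftrightarrow>
      (\<lambda>e. (cmod (cinner x e))\<^sup>2 * (norm y)\<^sup>2) summable_on onb"
    by (rule summable_on_cong_neutral) (auto simp: f_def norm_scaleC power_mult_distrib)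
  then have 1: "l2_nth (Abs_l2 f) = f"
    using summable_on_cmult_left[OF bessel_summable[OF onb], of x "(norm y)\<^sup>2"]
    by (simp add: Abs_l2_inverse)
  have "\<forall>e. e \<notin> onb \<longrightarrow> l2_nth (Abs_l2 f) e = 0"
    unfolding 1 by (simp add: f_def)
  then have "tensor_l2 (Abs_tensor (Abs_l2 f)) = Abs_l2 f"
    by (simp add: Abs_tensor_inverse)
  then show ?thesis using 1 by (simp add: tensor_vec_def f_def)
qed

lemma tensor_eqI:
  assumes "\<And>e. e \<in> onb \<Longrightarrow> l2_nth (tensor_l2 u) e = l2_nth (tensor_l2 v) e"
  shows "u = v"
proof -
  have "l2_nth (tensor_l2 u) e = l2_nth (tensor_l2 v) e" for e
    using assms[of e] tensor_l2[of u] tensor_l2[of v] by (cases "e \<in> onb") auto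
  then have "l2_nth (tensor_l2 u) = l2_nth (tensor_l2 v)" by (rule ext)
  then show ?thesis by (simp add: l2_nth_inject tensor_l2_inject)
qed

lemma tensor_vec_linear:
  "(x + x') \<otimes>\<^sub>v y = x \<otimes>\<^sub>v y + x' \<otimes>\<^sub>v y" "x \<otimes>\<^sub>v (y + y') = x \<otimes>\<^sub>v y + x \<otimes>\<^sub>v y'"
  "(c *\<^sub>C x) \<otimes>\<^sub>v y = c *\<^sub>C (x \<otimes>\<^sub>v y)" "x \<otimes>\<^sub>v (c *\<^sub>C y) = c *\<^sub>C (x \<otimes>\<^sub>v y)"
  by (rule tensor_eqI; simp add: tensor_vec_nth plus_tensor.rep_eq plus_l2.rep_eq scaleC_tensor.rep_eq
      scaleC_l2.rep_eq cinner_add_left cinner_scaleC_left scaleC_add_left scaleC_add_right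
      scaleC_scaleC mult.commute)+

lemma cinner_tensor_vec_right:
  "cinner u (x \<otimes>\<^sub>v y) = (\<Sum>\<^sub>\<infinity>e\<in>onb. cnj (cinner x e) * cinner (l2_nth (tensor_l2 u) e) y)"
  unfolding cinner_tensor.rep_eq cinner_l2.rep_eq
  by (rule infsum_cong_neutral) (auto simp: tensor_vec_nth cinner_scaleC_right)

lemma cinner_tensor_vec: "cinner (x \<otimes>\<^sub>v y) (x' \<otimes>\<^sub>v y') = cinner x x' * cinner y y'"
proof -
  have "((\<lambda>e. cinner x e * cinner e x' * cinner y y') has_sum (cinner x x' * cinner y y')) onb"
    by (rule has_sum_cmult_left[OF parseval[OF onb]])
  then have "(\<Sum>\<^sub>\<infinity>e\<in>onb. cinner x e * cinner e x' * cinner y y') = cinner x x' * cinner y y'"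
    by (rule infsumI)
  moreover have "cinner (x \<otimes>\<^sub>v y) (x' \<otimes>\<^sub>v y') = (\<Sum>\<^sub>\<infinity>e\<in>onb. cinner x e * cinner e x' * cinner y y')"
    unfolding cinner_tensor_vec_right
    by (rule infsum_cong) (simp add: tensor_vec_nth cinner_scaleC_left mult_ac cinner_commute[of _ x'])
  ultimately show ?thesis by simp
qed

lemma norm_tensor_vec: "norm (x \<otimes>\<^sub>v y) = norm x * norm y"
proof -
  have "complex_of_real ((norm (x \<otimes>\<^sub>v y))\<^sup>2) = complex_of_real ((norm x * norm y)\<^sup>2)"
    unfolding cinner_self[symmetric] cinner_tensor_vec by (simp add: cinner_self power_mult_distrib)
  then have "(norm (x \<otimes>\<^sub>v y))\<^sup>2 = (norm x * norm y)\<^sup>2" using of_real_eq_iff by blast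
  then show ?thesis by (simp add: power2_eq_iff_nonneg)
qed

lemma cinner_onb_tensor_vec:
  assumes "e \<in> onb"
  shows "cinner u (e \<otimes>\<^sub>v y) = cinner (l2_nth (tensor_l2 u) e) y"
proof -
  have "cinner u (e \<otimes>\<^sub>v y) = (\<Sum>\<^sub>\<infinity>e'\<in>{e}. cinner (l2_nth (tensor_l2 u) e') y)"
    unfolding cinner_tensor_vec_right using onb assms
    by (intro infsum_cong_neutral) (auto simp: orthonormal_basis_def cinner_self)
  then show ?thesis by simp
qed

lemma tensor_zeroI: "(\<And>x y. cinner u (x \<otimes>\<^sub>v y) = 0) \<Longrightarrow> u = 0"
proof (rule tensor_eqI)
  fix e :: 'a assume "\<And>x y. cinner u (x \<otimes>\<^sub>v y) = 0" "e \<in> onb"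
  then have "cinner (l2_nth (tensor_l2 u) e) (l2_nth (tensor_l2 u) e) = 0"
    using cinner_onb_tensor_vec by metis
  then show "l2_nth (tensor_l2 u) e = l2_nth (tensor_l2 0) e"
    by (simp add: cinner_self zero_tensor.rep_eq zero_l2.rep_eq)
qed

lemma subspace_closure:
  fixes S :: "'a::real_normed_vector set"
  assumes "subspace S"
  shows "subspace (closure S)"
proof (rule subspaceI)
  show "0 \<in> closure S" using subspace_0[OF assms] closure_subset by blast
next
  fix x y assume "x \<in> closure S" "y \<in> closure S"
  then obtain s t where "\<And>n. s n \<in> S" "s \<longlonglongrightarrow> x" "\<And>n. t n \<in> S" "t \<longlonglongrightarrow> y"
    by (auto simp: closure_sequential)
  then have "(\<lambda>n. s n + t n) \<longlonglongrightarrow> x + y" "\<And>n. s n + t n \<in> S"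
    using subspace_add[OF assms] by (auto intro: tendsto_add)
  then show "x + y \<in> closure S" unfolding closure_sequential by (intro exI[of _ "\<lambda>n. s n + t n"]) auto
next
  fix r x assume "x \<in> closure S"
  then obtain s where "\<And>n. s n \<in> S" "s \<longlonglongrightarrow> x"
    by (auto simp: closure_sequential)
  then have "(\<lambda>n. r *\<^sub>R s n) \<longlonglongrightarrow> r *\<^sub>R x" "\<And>n. r *\<^sub>R s n \<in> S"
    using subspace_scale[OF assms] by (auto intro: tendsto_intros)
  then show "r *\<^sub>R x \<in> closure S" unfolding closure_sequential by (intro exI[of _ "\<lambda>n. r *\<^sub>R s n"]) auto
qed

lemma span_tensor_vec: "closure (span {x \<otimes>\<^sub>v y |x y. True}) = UNIV"
proof -
  have "u \<in> closure (span {x \<otimes>\<^sub>v y |x y. True})" for u :: "('a, 'b) tensor"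
  proof -
    have "\<exists>m\<in>closure (span {x \<otimes>\<^sub>v y |(x::'a) (y::'b). True}).
        \<forall>v\<in>closure (span {x \<otimes>\<^sub>v y |x y. True}). inner (u - m) v = 0"
      by (rule orthogonal_decomposition) (simp_all add: subspace_closure)
    then obtain m where m: "m \<in> closure (span {x \<otimes>\<^sub>v y |(x::'a) (y::'b). True})"
      and o: "\<forall>v\<in>closure (span {x \<otimes>\<^sub>v y |x y. True}). inner (u - m) v = 0" by (rule bexE)
    have "u - m = 0"
    proof (rule tensor_zeroI, rule cinner_zero_if_inner_zero)
      fix x :: 'a and y :: 'b and c
      have "c *\<^sub>C (x \<otimes>\<^sub>v y) \<in> {x \<otimes>\<^sub>v y |x y. True}" unfolding tensor_vec_linear(3)[symmetric] by blast
      then show "inner (u - m) (c *\<^sub>C (x \<otimes>\<^sub>v y)) = 0"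
        by (intro bspec[OF o] subsetD[OF closure_subset] span_base)
    qed
    with m show ?thesis by simp
  qed
  then show ?thesis by blast
qed

definition tensor_op :: "('a::complex_hilbert \<Rightarrow>\<^sub>L 'c::complex_hilbert) \<Rightarrow>
    ('b::complex_hilbert \<Rightarrow>\<^sub>L 'd::complex_hilbert) \<Rightarrow> ('a, 'b) tensor \<Rightarrow>\<^sub>L ('c, 'd) tensor"
    (infixr "\<otimes>\<^sub>o" 70) where
  "A \<otimes>\<^sub>o B = (THE T. T \<in> bounded_ops \<and>
     (\<forall>x y. blinfun_apply T (x \<otimes>\<^sub>v y) = blinfun_apply A x \<otimes>\<^sub>v blinfun_apply B y))"

lemma dominated_summable_on:
  fixes f :: "'i \<Rightarrow> 'a::{real_normed_vector,complete_space}"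
  assumes g: "g summable_on A" and C: "C \<ge> 0"
    and le: "\<And>F. finite F \<Longrightarrow> F \<subseteq> A \<Longrightarrow> (norm (sum f F))\<^sup>2 \<le> C * (\<Sum>i\<in>F. g i)"
    and g0: "\<And>i. i \<in> A \<Longrightarrow> 0 \<le> (g i :: real)"
  shows "f summable_on A"
proof -
  have "\<exists>P. eventually P (finite_subsets_at_top A) \<and>
      (\<forall>F F'. P F \<and> P F' \<longrightarrow> dist (sum f F) (sum f F') < \<epsilon>)" if "\<epsilon> > 0" for \<epsilon>
  proof -
    define K where "K = C + 1"
    define \<delta> where "\<delta> = (\<epsilon> / 2)\<^sup>2 / K / 2"
    have K: "K > 0" using C by (simp add: K_def)
    have d: "\<delta> > 0" using that K by (simp add: \<delta>_def)
    obtain F0 where F0: "finite F0" "F0 \<subseteq> A" "dist (sum g F0) (infsum g A) \<le> \<delta>"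
      using infsum_finite_approximation[OF g d] by auto
    define P where "P F \<longleftrightarrow> finite F \<and> F0 \<subseteq> F \<and> F \<subseteq> A" for F
    have ev: "eventually P (finite_subsets_at_top A)"
      unfolding eventually_finite_subsets_at_top P_def using F0 by blast
    have near: "dist (sum f F) (sum f F0) < \<epsilon> / 2" if "P F" for F
    proof -
      have F: "finite F" "F0 \<subseteq> F" "F \<subseteq> A" using that by (auto simp: P_def)
      have "sum g F \<le> infsum g A" using F g0 by (intro finite_sum_le_infsum g) auto
      moreover have "sum g (F - F0) = sum g F - sum g F0" using F by (intro sum_diff) auto
      ultimately have small: "sum g (F - F0) \<le> \<delta>" using F0(3) by (simp add: dist_norm abs_le_iff)
      have "(norm (sum f (F - F0)))\<^sup>2 \<le> C * \<delta>"
        using le[of "F - F0"] F mult_left_mono[OF small C] by (auto intro: order_trans)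
      also have "\<dots> < (\<epsilon> / 2)\<^sup>2"
      proof -
        have "C * \<delta> \<le> K * \<delta>" using d by (intro mult_right_mono) (auto simp: K_def)
        also have "\<dots> = (\<epsilon> / 2)\<^sup>2 / 2" using K by (simp add: \<delta>_def)
        also have "\<dots> < (\<epsilon> / 2)\<^sup>2" using \<open>\<epsilon> > 0\<close> by simp
        finally show ?thesis .
      qed
      finally have "norm (sum f (F - F0)) < \<epsilon> / 2"
        by (rule power_less_imp_less_base) (use \<open>\<epsilon> > 0\<close> in simp)
      moreover have "sum f (F - F0) = sum f F - sum f F0" using F by (intro sum_diff) auto
      ultimately show ?thesis by (simp add: dist_norm)
    qed
    have "dist (sum f F) (sum f F') < \<epsilon>" if "P F" "P F'" for F F'
      using near[OF that(1)] near[OF that(2)] dist_triangle2[of "sum f F" "sum f F'" "sum f F0"] by linarith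
    then show ?thesis using ev by blast
  qed
  then have "cauchy_filter (filtermap (sum f) (finite_subsets_at_top A))"
    by (simp add: cauchy_filter_metric_filtermap)
  moreover have "complete (UNIV::'a set)"
    by (simp add: complete_UNIV)
  ultimately obtain L where "(sum f \<longlongrightarrow> L) (finite_subsets_at_top A)"
    using complete_uniform[where S=UNIV] by (force simp add: filterlim_def)
  then show ?thesis
    unfolding summable_on_def has_sum_def by blast
qed

lemma has_sum_sum:
  fixes f :: "'j \<Rightarrow> 'i \<Rightarrow> 'a::topological_comm_monoid_add"
  assumes "\<And>j. j \<in> F \<Longrightarrow> (f j has_sum s j) A"
  shows "((\<lambda>i. \<Sum>j\<in>F. f j i) has_sum (\<Sum>j\<in>F. s j)) A"
  using assms by (induction F rule: infinite_finite_induct) (auto intro: has_sum_add)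

lemma norm_sum_tensor_vec:
  "((\<lambda>g. (norm (\<Sum>j\<in>F. cinner (y j) g *\<^sub>C x j))\<^sup>2) has_sum (norm (\<Sum>j\<in>F. x j \<otimes>\<^sub>v y j))\<^sup>2) onb"
proof -
  have "((\<lambda>g. \<Sum>j\<in>F. \<Sum>k\<in>F. cinner (x j) (x k) * (cinner (y j) g * cinner g (y k))) has_sum
      (\<Sum>j\<in>F. \<Sum>k\<in>F. cinner (x j) (x k) * cinner (y j) (y k))) onb"
    by (intro has_sum_sum has_sum_cmult_right parseval onb)
  moreover have "(\<Sum>j\<in>F. \<Sum>k\<in>F. cinner (x j) (x k) * cinner (y j) (y k)) =
      complex_of_real ((norm (\<Sum>j\<in>F. x j \<otimes>\<^sub>v y j))\<^sup>2)"
    unfolding cinner_self[symmetric] cinner_sum_left by (simp add: cinner_sum_right cinner_tensor_vec)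
  moreover have "(\<Sum>j\<in>F. \<Sum>k\<in>F. cinner (x j) (x k) * (cinner (y j) g * cinner g (y k))) =
      complex_of_real ((norm (\<Sum>j\<in>F. cinner (y j) g *\<^sub>C x j))\<^sup>2)" for g
    unfolding cinner_self[symmetric] cinner_sum_left
    by (simp add: cinner_sum_right cinner_scaleC_left cinner_scaleC_right mult_ac
        cinner_commute[of g])
  ultimately have "((\<lambda>g. complex_of_real ((norm (\<Sum>j\<in>F. cinner (y j) g *\<^sub>C x j))\<^sup>2)) has_sum
      complex_of_real ((norm (\<Sum>j\<in>F. x j \<otimes>\<^sub>v y j))\<^sup>2)) onb" by simp
  then show ?thesis using has_sum_of_real_iff by blast
qed

lemma norm_sum_tensor_vec_onb:
  assumes F: "finite F" "F \<subseteq> onb"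
  shows "(norm (\<Sum>e\<in>F. e \<otimes>\<^sub>v y e))\<^sup>2 = (\<Sum>e\<in>F. (norm (y e))\<^sup>2)"
proof -
  have "complex_of_real ((norm (\<Sum>e\<in>F. e \<otimes>\<^sub>v y e))\<^sup>2) = (\<Sum>e\<in>F. \<Sum>e'\<in>F. cinner e e' * cinner (y e) (y e'))"
    unfolding cinner_self[symmetric] cinner_sum_left by (simp add: cinner_sum_right cinner_tensor_vec)
  also have "\<dots> = (\<Sum>e\<in>F. \<Sum>e'\<in>F. if e' = e then cinner (y e) (y e) else 0)"
  proof (intro sum.cong refl)
    fix e e' assume "e \<in> F" "e' \<in> F"
    then have "e \<in> onb" "e' \<in> onb" using F by auto
    then show "cinner e e' * cinner (y e) (y e') = (if e' = e then cinner (y e) (y e) else 0)"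
      using onb[where 'a='a] by (auto simp: orthonormal_basis_def cinner_self)
  qed
  also have "\<dots> = complex_of_real (\<Sum>e\<in>F. (norm (y e))\<^sup>2)"
    using F by (simp add: cinner_self)
  finally show ?thesis using of_real_eq_iff by blast
qed

lemma bounded_ops_sum_scaleC:
  assumes "A \<in> bounded_ops"
  shows "blinfun_apply A (\<Sum>j\<in>F. c j *\<^sub>C x j) = (\<Sum>j\<in>F. c j *\<^sub>C blinfun_apply A (x j))"
  using assms by (simp add: blinfun.sum_right bounded_ops_def)

lemma norm_sum_amplification:
  assumes "A \<in> bounded_ops"
  shows "(norm (\<Sum>j\<in>F. blinfun_apply A (x j) \<otimes>\<^sub>v y j))\<^sup>2 \<le> (norm A)\<^sup>2 * (norm (\<Sum>j\<in>F. x j \<otimes>\<^sub>v y j))\<^sup>2"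
proof (rule has_sum_mono)
  show "((\<lambda>g. (norm A)\<^sup>2 * (norm (\<Sum>j\<in>F. cinner (y j) g *\<^sub>C x j))\<^sup>2) has_sum
      (norm A)\<^sup>2 * (norm (\<Sum>j\<in>F. x j \<otimes>\<^sub>v y j))\<^sup>2) onb"
    by (intro has_sum_cmult_right norm_sum_tensor_vec)
  show "((\<lambda>g. (norm (\<Sum>j\<in>F. cinner (y j) g *\<^sub>C blinfun_apply A (x j)))\<^sup>2) has_sum
      (norm (\<Sum>j\<in>F. blinfun_apply A (x j) \<otimes>\<^sub>v y j))\<^sup>2) onb"
    by (rule norm_sum_tensor_vec)
  fix g
  show "(norm (\<Sum>j\<in>F. cinner (y j) g *\<^sub>C blinfun_apply A (x j)))\<^sup>2
      \<le> (norm A)\<^sup>2 * (norm (\<Sum>j\<in>F. cinner (y j) g *\<^sub>C x j))\<^sup>2"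
    unfolding bounded_ops_sum_scaleC[OF assms, symmetric] power_mult_distrib[symmetric]
    by (intro power_mono norm_blinfun) simp
qed

lemma norm_tensor_sq: "(norm u)\<^sup>2 = (\<Sum>\<^sub>\<infinity>e\<in>onb. (norm (l2_nth (tensor_l2 u) e))\<^sup>2)"
  unfolding norm_tensor.rep_eq norm_l2_sq using tensor_l2[of u]
  by (intro infsum_cong_neutral) auto

lemma tensor_sq_summable: "(\<lambda>e. (norm (l2_nth (tensor_l2 u) e))\<^sup>2) summable_on onb"
  using l2_nth[of "tensor_l2 u"] by (auto intro: summable_on_subset_banach)

lemma tensor_op_exists:
  assumes A: "A \<in> bounded_ops" and B: "B \<in> bounded_ops"
  shows "\<exists>T\<in>bounded_ops. norm T \<le> norm A * norm B \<and>
    (\<forall>x y. blinfun_apply T (x \<otimes>\<^sub>v y) = blinfun_apply A x \<otimes>\<^sub>v blinfun_apply B y)"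
proof -
  define h where "h u e = blinfun_apply A e \<otimes>\<^sub>v blinfun_apply B (l2_nth (tensor_l2 u) e)" for u e
  define T where "T u = (\<Sum>\<^sub>\<infinity>e\<in>onb. h u e)" for u
  have fin: "(norm (sum (h u) F))\<^sup>2 \<le> (norm A * norm B)\<^sup>2 * (\<Sum>e\<in>F. (norm (l2_nth (tensor_l2 u) e))\<^sup>2)"
    if F: "finite F" "F \<subseteq> onb" for u F
  proof -
    have "(norm (sum (h u) F))\<^sup>2 \<le> (norm A)\<^sup>2 * (norm (\<Sum>e\<in>F. e \<otimes>\<^sub>v blinfun_apply B (l2_nth (tensor_l2 u) e)))\<^sup>2"
      unfolding h_def by (rule norm_sum_amplification[OF A])
    also have "\<dots> = (norm A)\<^sup>2 * (\<Sum>e\<in>F. (norm (blinfun_apply B (l2_nth (tensor_l2 u) e)))\<^sup>2)"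
      by (simp add: norm_sum_tensor_vec_onb[OF F])
    also have "\<dots> \<le> (norm A)\<^sup>2 * (\<Sum>e\<in>F. (norm B * norm (l2_nth (tensor_l2 u) e))\<^sup>2)"
      by (intro mult_left_mono sum_mono power_mono norm_blinfun) auto
    also have "\<dots> = (norm A * norm B)\<^sup>2 * (\<Sum>e\<in>F. (norm (l2_nth (tensor_l2 u) e))\<^sup>2)"
      by (simp add: power_mult_distrib sum_distrib_left mult_ac)
    finally show ?thesis .
  qed
  have summ: "h u summable_on onb" for u
    by (rule dominated_summable_on[OF tensor_sq_summable[of u] _ fin]) auto
  have hs: "(h u has_sum T u) onb" for u unfolding T_def using summ by simp
  have bound: "norm (T u) \<le> norm u * (norm A * norm B)" for u
  proof -
    have "((\<lambda>F. (norm (sum (h u) F))\<^sup>2) \<longlongrightarrow> (norm (T u))\<^sup>2) (finite_subsets_at_top onb)"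
      using hs[of u] unfolding has_sum_def by (intro tendsto_intros)
    moreover have "\<forall>\<^sub>F F in finite_subsets_at_top onb. (norm (sum (h u) F))\<^sup>2 \<le> (norm A * norm B)\<^sup>2 * (norm u)\<^sup>2"
    proof (rule eventually_finite_subsets_at_top_weakI)
      fix F :: "'a set" assume F: "finite F" "F \<subseteq> onb"
      have "(\<Sum>e\<in>F. (norm (l2_nth (tensor_l2 u) e))\<^sup>2) \<le> (norm u)\<^sup>2"
        unfolding norm_tensor.rep_eq by (rule sum_norm_l2_nth_le[OF F(1)])
      then show "(norm (sum (h u) F))\<^sup>2 \<le> (norm A * norm B)\<^sup>2 * (norm u)\<^sup>2"
        using fin[OF F, of u] by (meson mult_left_mono order_trans zero_le_power2)
    qed
    ultimately have "(norm (T u))\<^sup>2 \<le> (norm A * norm B)\<^sup>2 * (norm u)\<^sup>2"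
      by (rule tendsto_upperbound) simp
    then have "(norm (T u))\<^sup>2 \<le> (norm u * (norm A * norm B))\<^sup>2"
      by (simp add: power_mult_distrib mult_ac)
    then show ?thesis by (rule power2_le_imp_le) simp
  qed
  have add: "T (u + v) = T u + T v" for u v
  proof -
    have "h (u + v) = (\<lambda>e. h u e + h v e)"
      by (rule ext) (simp add: h_def plus_tensor.rep_eq plus_l2.rep_eq blinfun.add_right tensor_vec_linear)
    then show ?thesis using has_sum_unique[OF hs[of "u + v"]] has_sum_add[OF hs[of u] hs[of v]] by simp
  qed
  have scale: "T (c *\<^sub>C u) = c *\<^sub>C T u" for c u
  proof -
    have "h (c *\<^sub>C u) = (\<lambda>e. c *\<^sub>C h u e)"
      using B by (intro ext) (simp add: h_def scaleC_tensor.rep_eq scaleC_l2.rep_eq bounded_ops_def tensor_vec_linear)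
    then show ?thesis using has_sum_unique[OF hs[of "c *\<^sub>C u"]]
        has_sum_bounded_linear[OF bounded_linear_scaleC[of c] hs[of u]] by (simp add: o_def)
  qed
  have lin: "bounded_linear T"
    by (rule bounded_linear_intro[where K = "norm A * norm B"]) (simp_all add: add scale scaleR_scaleC bound)
  have elem: "T (x \<otimes>\<^sub>v y) = blinfun_apply A x \<otimes>\<^sub>v blinfun_apply B y" for x y
  proof -
    have lin1: "bounded_linear (\<lambda>z. blinfun_apply A z \<otimes>\<^sub>v blinfun_apply B y)"
    proof (rule bounded_linear_intro[where K = "norm A * norm (blinfun_apply B y)"])
      show "norm (blinfun_apply A z \<otimes>\<^sub>v blinfun_apply B y) \<le> norm z * (norm A * norm (blinfun_apply B y))" for z
        using mult_right_mono[OF norm_blinfun[of A z], of "norm (blinfun_apply B y)"]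
        by (simp add: norm_tensor_vec mult_ac)
    qed (use A in \<open>simp_all add: blinfun.add_right tensor_vec_linear scaleR_scaleC bounded_ops_def\<close>)
    have "((\<lambda>e. blinfun_apply A (cinner x e *\<^sub>C e) \<otimes>\<^sub>v blinfun_apply B y) has_sum
        blinfun_apply A x \<otimes>\<^sub>v blinfun_apply B y) onb"
      using has_sum_bounded_linear[OF lin1 onb_expansion[OF onb, of x]] by (simp add: o_def)
    moreover have "blinfun_apply A (cinner x e *\<^sub>C e) \<otimes>\<^sub>v blinfun_apply B y = h (x \<otimes>\<^sub>v y) e" if "e \<in> onb" for e
      using A B that by (simp add: h_def tensor_vec_nth bounded_ops_def tensor_vec_linear)
    ultimately have "(h (x \<otimes>\<^sub>v y) has_sum blinfun_apply A x \<otimes>\<^sub>v blinfun_apply B y) onb"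
      by (simp cong: has_sum_cong)
    then show ?thesis using hs has_sum_unique by blast
  qed
  have app: "blinfun_apply (Blinfun T) = T" using lin by (rule bounded_linear_Blinfun_apply)
  show ?thesis
  proof (intro bexI conjI allI)
    show "Blinfun T \<in> bounded_ops" by (simp add: bounded_ops_def app scale)
    show "norm (Blinfun T) \<le> norm A * norm B"
      using bound by (intro norm_blinfun_bound) (simp_all add: app mult.commute)
  qed (simp add: app elem)
qed

lemma blinfun_tensor_eqI:
  assumes "\<And>x y. blinfun_apply S (x \<otimes>\<^sub>v y) = blinfun_apply T (x \<otimes>\<^sub>v y)"
  shows "S = T"
proof -
  let ?E = "{u. blinfun_apply S u = blinfun_apply T u}"
  have "span {x \<otimes>\<^sub>v y |x y. True} \<subseteq> ?E"
  proof (rule span_minimal)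
    show "{x \<otimes>\<^sub>v y |x y. True} \<subseteq> ?E" using assms by blast
    show "subspace ?E" by (rule subspaceI) (simp_all add: blinfun.add_right blinfun.scaleR_right)
  qed
  moreover have "closed ?E"
    by (intro closed_Collect_eq linear_continuous_on blinfun.bounded_linear_right)
  ultimately have "closure (span {x \<otimes>\<^sub>v y |x y. True}) \<subseteq> ?E" by (rule closure_minimal)
  then show ?thesis unfolding span_tensor_vec by (intro blinfun_eqI) auto
qed

lemma tensor_op:
  assumes "A \<in> bounded_ops" "B \<in> bounded_ops"
  shows "A \<otimes>\<^sub>o B \<in> bounded_ops" "norm (A \<otimes>\<^sub>o B) \<le> norm A * norm B"
    and "blinfun_apply (A \<otimes>\<^sub>o B) (x \<otimes>\<^sub>v y) = blinfun_apply A x \<otimes>\<^sub>v blinfun_apply B y"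
proof -
  obtain T where T: "T \<in> bounded_ops" "norm T \<le> norm A * norm B"
    "\<And>x y. blinfun_apply T (x \<otimes>\<^sub>v y) = blinfun_apply A x \<otimes>\<^sub>v blinfun_apply B y"
    using tensor_op_exists[OF assms] by blast
  have "A \<otimes>\<^sub>o B = T"
    unfolding tensor_op_def by (rule the_equality) (use T in \<open>auto intro: blinfun_tensor_eqI\<close>)
  with T show "A \<otimes>\<^sub>o B \<in> bounded_ops" "norm (A \<otimes>\<^sub>o B) \<le> norm A * norm B"
    "blinfun_apply (A \<otimes>\<^sub>o B) (x \<otimes>\<^sub>v y) = blinfun_apply A x \<otimes>\<^sub>v blinfun_apply B y" by simp_all
qed

section \<open>Fock spaces\<close>

text \<open>The index type \<open>'n\<close> plays the role of \<open>{1, \<dots>, n}\<close>, and a word over \<open>'n\<close> is an element of the free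
  semigroup. In the orthonormal basis \<open>e\<^sub>\<alpha> = e\<^bsub>i1\<^esub> \<otimes> \<dots> \<otimes> e\<^bsub>ik\<^esub>\<close>, a \<open>k\<close>-tensor over
  \<open>H\<^sub>n\<close> is a function on the words of length \<open>k\<close>, so the full Fock space consists of
  the square-summable functions on all words.\<close>

type_synonym 'n fock = "('n list, complex) l2"

lift_definition creation_map :: "'n \<Rightarrow> 'n fock \<Rightarrow> 'n fock" is
  "\<lambda>i \<phi> w. case w of [] \<Rightarrow> 0 | j # v \<Rightarrow> if j = i then \<phi> v else 0"
proof -
  fix i :: 'n and \<phi> :: "'n list \<Rightarrow> complex"
  assume "(\<lambda>w. (norm (\<phi> w))\<^sup>2) summable_on UNIV"
  moreover have "(\<lambda>w. (norm (case w of [] \<Rightarrow> 0 | j # v \<Rightarrow> if j = i then \<phi> v else 0))\<^sup>2) summable_on UNIV \<longleftrightarrow>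
      (\<lambda>w. (norm (case w of [] \<Rightarrow> 0 | j # v \<Rightarrow> if j = i then \<phi> v else 0))\<^sup>2) summable_on range (Cons i)"
    by (rule summable_on_cong_neutral) (auto split: list.splits)
  ultimately show "(\<lambda>w. (norm (case w of [] \<Rightarrow> 0 | j # v \<Rightarrow> if j = i then \<phi> v else 0))\<^sup>2) summable_on UNIV"
    by (simp add: summable_on_reindex o_def)
qed

lemma norm_creation_map: "norm (creation_map i \<phi>) = norm \<phi>"
proof -
  have "(norm (creation_map i \<phi>))\<^sup>2 = (\<Sum>\<^sub>\<infinity>w\<in>range (Cons i). (norm (l2_nth (creation_map i \<phi>) w))\<^sup>2)"
    unfolding norm_l2_sq
    by (rule infsum_cong_neutral) (auto simp: creation_map.rep_eq split: list.splits)
  also have "\<dots> = (norm \<phi>)\<^sup>2"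
    unfolding norm_l2_sq by (simp add: infsum_reindex o_def creation_map.rep_eq)
  finally show ?thesis by (simp add: power2_eq_iff_nonneg)
qed

lemma bounded_linear_creation_map: "bounded_linear (creation_map i)"
proof (rule bounded_linear_intro[where K = 1])
  show "creation_map i (x + y) = creation_map i x + creation_map i y" for x y
    by transfer (auto split: list.splits)
  show "creation_map i (r *\<^sub>R x) = r *\<^sub>R creation_map i x" for r x
    by transfer (auto split: list.splits)
qed (simp add: norm_creation_map)

definition creation :: "'n \<Rightarrow> 'n fock \<Rightarrow>\<^sub>L 'n fock" where
  "creation i = Blinfun (creation_map i)"

lemma creation_apply: "l2_nth (blinfun_apply (creation i) \<phi>) w =
    (case w of [] \<Rightarrow> 0 | j # v \<Rightarrow> if j = i then l2_nth \<phi> v else 0)"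
  by (simp add: creation_def bounded_linear_Blinfun_apply bounded_linear_creation_map creation_map.rep_eq)

text \<open>Two words have the same multiset of letters iff they differ by a permutation of the positions,
  so the following are the tensors invariant under permutations of the tensor factors.\<close>

typedef 'n sym_fock = "{\<phi> :: 'n fock. \<forall>v w. mset v = mset w \<longrightarrow> l2_nth \<phi> v = l2_nth \<phi> w}"
  morphisms sym_fock_vec Abs_sym_fock
  by (rule exI[of _ 0]) (simp add: zero_l2.rep_eq)

setup_lifting type_definition_sym_fock

instantiation sym_fock :: (type) complex_inner
begin

lift_definition zero_sym_fock :: "'a sym_fock" is 0 by (simp add: zero_l2.rep_eq)
lift_definition plus_sym_fock :: "'a sym_fock \<Rightarrow> 'a sym_fock \<Rightarrow> 'a sym_fock" is "(+)"
  unfolding plus_l2.rep_eq by metis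
lift_definition uminus_sym_fock :: "'a sym_fock \<Rightarrow> 'a sym_fock" is uminus
  unfolding uminus_l2.rep_eq by metis
lift_definition minus_sym_fock :: "'a sym_fock \<Rightarrow> 'a sym_fock \<Rightarrow> 'a sym_fock" is "(-)"
  unfolding minus_l2.rep_eq by metis
lift_definition scaleC_sym_fock :: "complex \<Rightarrow> 'a sym_fock \<Rightarrow> 'a sym_fock" is "(*\<^sub>C)"
  unfolding scaleC_l2.rep_eq by metis
lift_definition scaleR_sym_fock :: "real \<Rightarrow> 'a sym_fock \<Rightarrow> 'a sym_fock" is "(*\<^sub>R)"
  unfolding scaleR_l2.rep_eq by metis
lift_definition cinner_sym_fock :: "'a sym_fock \<Rightarrow> 'a sym_fock \<Rightarrow> complex" is cinner .
lift_definition inner_sym_fock :: "'a sym_fock \<Rightarrow> 'a sym_fock \<Rightarrow> real" is inner .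
lift_definition norm_sym_fock :: "'a sym_fock \<Rightarrow> real" is norm .
definition dist_sym_fock :: "'a sym_fock \<Rightarrow> 'a sym_fock \<Rightarrow> real" where
  "dist_sym_fock x y = norm (x - y)"
definition sgn_sym_fock :: "'a sym_fock \<Rightarrow> 'a sym_fock" where
  "sgn_sym_fock x = inverse (norm x) *\<^sub>R x"
definition uniformity_sym_fock :: "('a sym_fock \<times> 'a sym_fock) filter" where
  "uniformity_sym_fock = (INF e\<in>{0 <..}. principal {(x, y). dist x y < e})"
definition open_sym_fock :: "'a sym_fock set \<Rightarrow> bool" where
  "open_sym_fock S \<longleftrightarrow> (\<forall>x\<in>S. \<forall>\<^sub>F (x', y) in uniformity. x' = x \<longrightarrow> y \<in> S)"

instance
proof
  fix x y z :: "'a sym_fock" and c d :: complex and r s :: real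
  show "x + y + z = x + (y + z)" by transfer (simp add: add.assoc)
  show "x + y = y + x" by transfer (simp add: add.commute)
  show "0 + x = x" by transfer simp
  show "- x + x = 0" by transfer simp
  show "x - y = x + - y" by transfer simp
  show "r *\<^sub>R (x + y) = r *\<^sub>R x + r *\<^sub>R y" by transfer (simp add: scaleR_add_right)
  show "(r + s) *\<^sub>R x = r *\<^sub>R x + s *\<^sub>R x" by transfer (simp add: scaleR_add_left)
  show "r *\<^sub>R s *\<^sub>R x = (r * s) *\<^sub>R x" by transfer simp
  show "1 *\<^sub>R x = x" by transfer simp
  show "c *\<^sub>C (x + y) = c *\<^sub>C x + c *\<^sub>C y" by transfer (rule scaleC_add_right)
  show "(c + d) *\<^sub>C x = c *\<^sub>C x + d *\<^sub>C x" by transfer (rule scaleC_add_left)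
  show "c *\<^sub>C d *\<^sub>C x = (c * d) *\<^sub>C x" by transfer (rule scaleC_scaleC)
  show "r *\<^sub>R x = complex_of_real r *\<^sub>C x" by transfer (rule scaleR_scaleC)
  show "cinner x y = cnj (cinner y x)" by transfer (rule cinner_commute)
  show "cinner (x + y) z = cinner x z + cinner y z" by transfer (rule cinner_add_left)
  show "cinner (c *\<^sub>C x) y = c * cinner x y" by transfer (rule cinner_scaleC_left)
  show "inner x y = Re (cinner x y)" by transfer (rule inner_eq_Re_cinner)
  show "inner x y = inner y x" by transfer (rule inner_commute)
  show "inner (x + y) z = inner x z + inner y z" by transfer (rule inner_add_left)
  show "inner (r *\<^sub>R x) y = r * inner x y" by transfer simp
  show "0 \<le> inner x x" by transfer simp
  show "inner x x = 0 \<longleftrightarrow> x = 0" by transfer simp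
  show "norm x = sqrt (inner x x)" by transfer (rule norm_eq_sqrt_inner)
qed (simp_all add: dist_sym_fock_def sgn_sym_fock_def uniformity_sym_fock_def open_sym_fock_def)

end

instance sym_fock :: (type) complex_hilbert
proof
  fix X :: "nat \<Rightarrow> 'a sym_fock" assume "Cauchy X"
  then have "Cauchy (\<lambda>n. sym_fock_vec (X n))"
    by (simp add: Cauchy_def dist_norm norm_sym_fock.rep_eq minus_sym_fock.rep_eq)
  then obtain f where f: "(\<lambda>n. sym_fock_vec (X n)) \<longlonglongrightarrow> f"
    using Cauchy_convergent convergent_def by blast
  have "l2_nth f v = l2_nth f w" if "mset v = mset w" for v w
  proof -
    have lim: "(\<lambda>n. l2_nth (sym_fock_vec (X n)) u) \<longlonglongrightarrow> l2_nth f u" for u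
      by (rule bounded_linear.tendsto[OF bounded_linear_l2_nth f])
    have "l2_nth (sym_fock_vec (X n)) v = l2_nth (sym_fock_vec (X n)) w" for n
      using sym_fock_vec[of "X n"] that by blast
    with lim[of v] have "(\<lambda>n. l2_nth (sym_fock_vec (X n)) w) \<longlonglongrightarrow> l2_nth f v" by simp
    then show ?thesis using lim[of w] by (rule LIMSEQ_unique)
  qed
  then have L: "sym_fock_vec (Abs_sym_fock f) = f" by (intro Abs_sym_fock_inverse CollectI allI impI)
  have "X \<longlonglongrightarrow> Abs_sym_fock f"
    using f by (simp add: lim_sequentially dist_norm norm_sym_fock.rep_eq minus_sym_fock.rep_eq L)
  then show "convergent X" by (auto simp: convergent_def)
qed

lift_definition sym_incl :: "'n sym_fock \<Rightarrow>\<^sub>L 'n fock" is sym_fock_vec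
  by (rule bounded_linear_intro[where K = 1])
    (simp_all add: plus_sym_fock.rep_eq scaleR_sym_fock.rep_eq norm_sym_fock.rep_eq)

definition sym_proj :: "'n fock \<Rightarrow>\<^sub>L 'n sym_fock" where
  "sym_proj = (THE P. \<forall>\<phi> \<psi>. cinner (\<phi> - sym_fock_vec (blinfun_apply P \<phi>)) (sym_fock_vec \<psi>) = 0)"

lemma sym_proj:
  "cinner (\<phi> - sym_fock_vec (blinfun_apply sym_proj \<phi>)) (sym_fock_vec \<psi>) = 0"
proof -
  let ?Q = "\<lambda>P. \<forall>\<phi> \<psi>. cinner (\<phi> - sym_fock_vec (blinfun_apply P \<phi>)) (sym_fock_vec \<psi> :: 'a fock) = 0"
  have incl: "sym_incl \<in> bounded_ops"
    by (simp add: bounded_ops_def sym_incl.rep_eq scaleC_sym_fock.rep_eq)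
  have eq: "?Q P \<longleftrightarrow> (\<forall>\<phi> \<psi>. cinner \<phi> (sym_fock_vec \<psi>) = cinner (blinfun_apply P \<phi>) \<psi>)" for P
    by (simp add: cinner_diff_left cinner_sym_fock.rep_eq)
  have "cinner \<phi> (sym_fock_vec \<psi>) = cinner (blinfun_apply (adj sym_incl) \<phi>) \<psi>" for \<phi> :: "'a fock" and \<psi>
    using adj[OF incl, of \<psi> \<phi>] cinner_commute by (metis sym_incl.rep_eq)
  then have Q: "?Q (adj sym_incl)" unfolding eq by blast
  have "sym_proj = (adj sym_incl :: 'a fock \<Rightarrow>\<^sub>L _)"
    unfolding sym_proj_def
  proof (rule the_equality)
    show "?Q (adj sym_incl)" by (rule Q)
    fix P assume "?Q P"
    then have "cinner (blinfun_apply P \<phi>) \<psi> = cinner (blinfun_apply (adj sym_incl) \<phi>) \<psi>" for \<phi> \<psi>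
      using Q unfolding eq by metis
    then show "P = adj sym_incl"
      by - (rule blinfun_eqI, rule cinner_ext, metis cinner_commute)
  qed
  then show ?thesis using Q by simp
qed

definition sym_creation :: "'n \<Rightarrow> 'n sym_fock \<Rightarrow>\<^sub>L 'n sym_fock" where
  "sym_creation i = sym_proj o\<^sub>L creation i o\<^sub>L sym_incl"

section \<open>Multi-indices and words\<close>

definition multi_indices :: "nat \<Rightarrow> ('n::finite \<Rightarrow> nat) set" where
  "multi_indices k = {p. (\<Sum>i\<in>UNIV. p i) = k}"

definition multinomial :: "('n::finite \<Rightarrow> nat) \<Rightarrow> real" where
  "multinomial p = fact (\<Sum>i\<in>UNIV. p i) / (\<Prod>i\<in>UNIV. fact (p i))"

definition monomial :: "complex ^ 'n \<Rightarrow> ('n::finite \<Rightarrow> nat) \<Rightarrow> complex" where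
  "monomial z p = (\<Prod>i\<in>UNIV. (z $ i) ^ p i)"

definition word_monomial :: "complex ^ 'n \<Rightarrow> 'n list \<Rightarrow> complex" where
  "word_monomial z \<alpha> = prod_list (map (\<lambda>i. z $ i) \<alpha>)"

definition op_word :: "('n \<Rightarrow> 'k::complex_hilbert \<Rightarrow>\<^sub>L 'k) \<Rightarrow> 'n list \<Rightarrow> 'k \<Rightarrow>\<^sub>L 'k" where
  "op_word T \<alpha> = foldr (\<lambda>i X. T i o\<^sub>L X) \<alpha> id_blinfun"

text \<open>\<open>T\<^sup>p\<close>, with the factors in the order of the index type; only used for commuting \<open>T i\<close>.\<close>

definition op_monomial ::
  "('n::{finite,linorder} \<Rightarrow> 'k::complex_hilbert \<Rightarrow>\<^sub>L 'k) \<Rightarrow> ('n \<Rightarrow> nat) \<Rightarrow> 'k \<Rightarrow>\<^sub>L 'k" where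
  "op_monomial T p = op_word T (concat (map (\<lambda>i. replicate (p i) i) (sorted_list_of_set UNIV)))"

definition words_of :: "('n::finite \<Rightarrow> nat) \<Rightarrow> 'n list set" where
  "words_of p = {\<alpha>. \<forall>z\<in>ball 0 1. word_monomial z \<alpha> = monomial z p}"

lemma word_monomial_eq: "word_monomial z \<alpha> = monomial z (count_list \<alpha>)"
proof (induction \<alpha>)
  case (Cons i \<alpha>)
  have "monomial z (count_list (i # \<alpha>)) =
      (\<Prod>j\<in>UNIV. (if j = i then z $ i else 1) * (z $ j) ^ count_list \<alpha> j)"
    unfolding monomial_def by (rule prod.cong) auto
  then show ?case using Cons by (simp add: prod.distrib word_monomial_def monomial_def)
qed (simp add: word_monomial_def monomial_def)

lemma monomial_inj:
  assumes "\<And>z. z \<in> ball 0 1 \<Longrightarrow> monomial z p = monomial z q"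
  shows "p = q"
proof
  fix i
  define s where "s = 1 / (2 * real CARD('a))"
  have s: "0 < s" by (simp add: s_def)
  define Z :: "real \<Rightarrow> complex ^ 'a" where
    "Z c = (\<chi> j. complex_of_real (s * (if j = i then c else 1)))" for c
  have ball: "Z c \<in> ball 0 1" if c: "0 < c" "c \<le> 1" for c
  proof -
    have "norm (Z c) \<le> (\<Sum>j\<in>UNIV. norm (Z c $ j))" unfolding norm_vec_def by (rule L2_set_le_sum) simp
    also have "\<dots> \<le> (\<Sum>j\<in>(UNIV::'a set). s)"
      using s c by (intro sum_mono) (auto simp: Z_def norm_mult)
    also have "\<dots> < 1" by (simp add: s_def)
    finally show ?thesis by simp
  qed
  have mono: "monomial (Z c) r = complex_of_real (s ^ (\<Sum>j\<in>UNIV. r j) * c ^ r i)" for c r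
  proof -
    have "monomial (Z c) r = (\<Prod>j\<in>UNIV. complex_of_real s ^ r j * (if j = i then complex_of_real c ^ r i else 1))"
      unfolding monomial_def by (rule prod.cong) (auto simp: Z_def power_mult_distrib)
    then show ?thesis by (simp add: prod.distrib power_sum)
  qed
  have eq: "s ^ (\<Sum>j\<in>UNIV. p j) * c ^ p i = s ^ (\<Sum>j\<in>UNIV. q j) * c ^ q i" if c: "0 < c" "c \<le> 1" for c
    using assms[OF ball[OF c]] unfolding mono of_real_eq_iff .
  have "(1 / 2 :: real) ^ p i = (1 / 2) ^ q i"
    using eq[of 1] eq[of "1/2"] s by simp
  then show "p i = q i" by (simp add: power_inject_exp')
qed

lemma words_of_eq: "words_of p = {\<alpha>. count_list \<alpha> = p}"
  unfolding words_of_def word_monomial_eq by (auto intro: monomial_inj)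

definition sym_monomial :: "('n::finite \<Rightarrow> nat) \<Rightarrow> 'n fock \<Rightarrow>\<^sub>L 'n fock" where
  "sym_monomial p = (1 / multinomial p) *\<^sub>R (\<Sum>\<alpha>\<in>words_of p. op_word creation \<alpha>)"

definition f_sym :: "(('n::finite \<Rightarrow> nat) \<Rightarrow> 'h::complex_hilbert \<Rightarrow>\<^sub>L 'h) \<Rightarrow> real \<Rightarrow>
    ('n fock, 'h) tensor \<Rightarrow>\<^sub>L ('n fock, 'h) tensor" where
  "f_sym A r = (\<Sum>k. \<Sum>p\<in>multi_indices k. r ^ k *\<^sub>R (sym_monomial p \<otimes>\<^sub>o A p))"

end

(*
  Put D = I - A_0. Testing Re f_sym(rS) <= I on a vector x = 1 (x) h + sum_{|alpha| = k} e_alpha (x) g_p(alpha)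
  of the full Fock space leaves only the terms of degree 0 and k of f_sym; letting r tend to 1 this gives
    Re sum_{|p| = k} <A_p h, g_p>  <=  <D h, h> + sum_{|p| = k} (|p|!/p!) <D g_p, g_p>     for k >= 1.
  With g_p proportional to (p!/|p|!) A_p h this is (i), and (ii) follows by summing a geometric series. Since the
  monomials T^p form a row contraction with weights |p|!/p!, (v) is bounded termwise by (ii) at r = 1/3.

  The operators A_0 and D need not have norms adding up to 1, so (iii) and (iv) do not follow from (i).
  Instead, with g supported at one index the inequality factors A_p = R Z_p R, where R^2 = D + delta and
  ||Z_p|| <= 2 (|p|!/p!)^(1/2). Then the tail of the series is a form bounded by ||R x|| ||R y||,
  its constant term by ||R' x|| ||R' y|| with R'^2 = A_0 + delta, and R^2 + R'^2 = (1 + 2 delta) I.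
*)

theory Submission
  imports Defs "HOL-Combinatorics.Multiset_Permutations"
begin

text \<open>The obstacle is that D and A_0 need not be invertible, so a factorisation through the
  root of D itself may not exist. The shift by \<delta> makes the root invertible, at the price of
  an error that vanishes with \<delta>; it also gives the strict norm bound under which inverses and
  square roots are fixed points of contractions on closed sets of complex-linear operators. The
  factor 2 in the bound for Z_p is the optimum of a quadratic inequality. It is compensated by the
  bound 1/2 in (iii), and 1/3 + 1/9 + ... = 1/2 is where the radius 1/3 comes from. As |p|!/p!
  counts the words with letter counts p, row and column bounds are proved without weights by
  induction on the length of words, and grouping the words by their counts produces the weights. A
  row bound carries p!/|p|!, which cancels the |p|!/p! in ||Z_p||^2. The coefficients occupy
  different factors of the tensor products in (iii) and (iv), so the main estimate is made for
  abstract representations of the two coefficient algebras.\<close>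

instance complex_hilbert \<subseteq> banach ..

section \<open>Complex-linear bounded operators, adjoints and norms of columns\<close>

lemma bounded_opsI: "(\<And>c x. blinfun_apply T (c *\<^sub>C x) = c *\<^sub>C blinfun_apply T x) \<Longrightarrow> T \<in> bounded_ops"
  by (simp add: bounded_ops_def)

lemma bounded_opsD: "T \<in> bounded_ops \<Longrightarrow> blinfun_apply T (c *\<^sub>C x) = c *\<^sub>C blinfun_apply T x"
  by (simp add: bounded_ops_def)

lemma scaleC_scaleR_commute: "c *\<^sub>C (r *\<^sub>R (x::'a::complex_vector)) = r *\<^sub>R (c *\<^sub>C x)"
  unfolding scaleR_scaleC scaleC_scaleC by (simp only: mult.commute)

lemma bounded_ops_0 [simp]: "0 \<in> bounded_ops"
  by (rule bounded_opsI) simp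

lemma bounded_ops_id [simp]: "id_blinfun \<in> bounded_ops"
  by (rule bounded_opsI) simp

lemma bounded_ops_add: "S \<in> bounded_ops \<Longrightarrow> T \<in> bounded_ops \<Longrightarrow> S + T \<in> bounded_ops"
  by (rule bounded_opsI) (simp add: bounded_opsD blinfun.add_left scaleC_add_right)

lemma bounded_ops_diff: "S \<in> bounded_ops \<Longrightarrow> T \<in> bounded_ops \<Longrightarrow> S - T \<in> bounded_ops"
  by (rule bounded_opsI) (simp add: bounded_opsD blinfun.diff_left scaleC_diff_right)

lemma bounded_ops_scaleR: "S \<in> bounded_ops \<Longrightarrow> r *\<^sub>R S \<in> bounded_ops"
  by (rule bounded_opsI) (simp add: bounded_opsD blinfun.scaleR_left scaleC_scaleR_commute)

lemma bounded_ops_compose: "U \<in> bounded_ops \<Longrightarrow> S \<in> bounded_ops \<Longrightarrow> U o\<^sub>L S \<in> bounded_ops"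
  by (rule bounded_opsI) (simp add: bounded_opsD)

lemma bounded_ops_sum: "(\<And>i. i \<in> F \<Longrightarrow> T i \<in> bounded_ops) \<Longrightarrow> (\<Sum>i\<in>F. T i) \<in> bounded_ops"
  by (induction F rule: infinite_finite_induct) (auto intro: bounded_ops_add)

text \<open>The defining property of \<open>adj\<close> is available on \<open>bounded_ops\<close>
  only. Operators that arise as sums of series or as fixed points below belong to this set because
  it is closed.\<close>

lemma bounded_ops_limit:
  assumes T: "\<And>n::nat. T n \<in> bounded_ops" and lim: "T \<longlonglongrightarrow> L"
  shows "L \<in> bounded_ops"
proof (rule bounded_opsI)
  fix c x
  have ap: "(\<lambda>n. blinfun_apply (T n) y) \<longlonglongrightarrow> blinfun_apply L y" for y
    by (rule bounded_linear.tendsto[OF blinfun.bounded_linear_left lim])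
  have "(\<lambda>n. blinfun_apply (T n) (c *\<^sub>C x)) \<longlonglongrightarrow> c *\<^sub>C blinfun_apply L x"
    using bounded_linear.tendsto[OF bounded_linear_scaleC[of c] ap[of x]] by (simp add: bounded_opsD[OF T])
  with ap show "blinfun_apply L (c *\<^sub>C x) = c *\<^sub>C blinfun_apply L x"
    using LIMSEQ_unique by blast
qed

lemma bounded_ops_adj [simp]:
  assumes "T \<in> bounded_ops"
  shows "adj T \<in> bounded_ops"
  by (rule bounded_opsI, rule cinner_ext) (simp add: adj[OF assms, symmetric] cinner_scaleC_right)

lemma inner_adj: "T \<in> bounded_ops \<Longrightarrow> inner (blinfun_apply T x) y = inner x (blinfun_apply (adj T) y)"
  by (simp add: inner_eq_Re_cinner adj)

lemma inner_adj': "T \<in> bounded_ops \<Longrightarrow> inner (blinfun_apply (adj T) x) y = inner x (blinfun_apply T y)"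
  by (metis inner_adj inner_commute)

lemma adj_eqI:
  assumes "T \<in> bounded_ops" "\<And>x y. cinner (blinfun_apply T x) y = cinner x (blinfun_apply S y)"
  shows "adj T = S"
  by (rule blinfun_eqI, rule cinner_ext) (simp add: adj[OF assms(1), symmetric] assms(2))

lemma cinner_adj_left:
  assumes "T \<in> bounded_ops"
  shows "cinner (blinfun_apply (adj T) x) y = cinner x (blinfun_apply T y)"
  by (metis adj[OF assms] cinner_commute)

lemma adj_adj: "T \<in> bounded_ops \<Longrightarrow> adj (adj T) = T"
  by (rule adj_eqI) (simp_all add: cinner_adj_left)

lemma adj_compose: "S \<in> bounded_ops \<Longrightarrow> T \<in> bounded_ops \<Longrightarrow> adj (S o\<^sub>L T) = adj T o\<^sub>L adj S"
  by (rule adj_eqI) (simp_all add: adj bounded_ops_compose)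

lemma adj_id [simp]: "adj id_blinfun = id_blinfun"
  by (rule adj_eqI) simp_all

text \<open>Testing against \<open>y = T x\<close> turns a bound for the form into one for the operator.\<close>

lemma norm_le_of_inner:
  assumes "\<And>x y. inner (blinfun_apply T x) y \<le> C * norm x * norm (y::'b::real_inner)" "0 \<le> C"
  shows "norm (T :: 'a::real_normed_vector \<Rightarrow>\<^sub>L 'b) \<le> C"
proof (rule norm_blinfun_bound[OF assms(2)])
  fix x
  have "norm (blinfun_apply T x) * norm (blinfun_apply T x) \<le> C * norm x * norm (blinfun_apply T x)"
    using assms(1)[of x "blinfun_apply T x"] by (simp add: norm_eq_sqrt_inner)
  then show "norm (blinfun_apply T x) \<le> C * norm x"
    using assms(2) by (cases "blinfun_apply T x = 0") auto
qed

lemma inner_sum_adj: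
  assumes "\<And>i. i \<in> F \<Longrightarrow> T i \<in> bounded_ops"
  shows "inner (blinfun_apply (\<Sum>i\<in>F. w i *\<^sub>R (adj (T i) o\<^sub>L T i)) x) y =
    (\<Sum>i\<in>F. w i * inner (blinfun_apply (T i) x) (blinfun_apply (T i) y))"
  using assms by (simp add: blinfun.sum_left blinfun.scaleR_left inner_sum_left inner_adj')

lemma sum_norm_sq_le_norm_sum_adj:
  assumes "\<And>i. i \<in> F \<Longrightarrow> T i \<in> bounded_ops"
  shows "(\<Sum>i\<in>F. w i * (norm (blinfun_apply (T i) x))\<^sup>2)
    \<le> norm (\<Sum>i\<in>F. w i *\<^sub>R (adj (T i) o\<^sub>L T i)) * (norm x)\<^sup>2"
proof -
  let ?Q = "\<Sum>i\<in>F. w i *\<^sub>R (adj (T i) o\<^sub>L T i)"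
  have "(\<Sum>i\<in>F. w i * (norm (blinfun_apply (T i) x))\<^sup>2) = inner (blinfun_apply ?Q x) x"
    by (subst inner_sum_adj) (use assms in \<open>auto simp: power2_norm_eq_inner\<close>)
  also have "\<dots> \<le> norm (blinfun_apply ?Q x) * norm x" by (rule norm_cauchy_schwarz)
  also have "\<dots> \<le> norm ?Q * norm x * norm x" by (intro mult_right_mono norm_blinfun) simp
  finally show ?thesis by (simp add: power2_eq_square mult.assoc)
qed

text \<open>The hypothesis controls the form on the diagonal only. The bound for two different
  vectors comes from Cauchy-Schwarz in the direct sum over \<open>F\<close>, each weight being split
  evenly as \<open>sqrt (w i)\<close> times \<open>sqrt (w i)\<close>. With the preceding lemma,
  norms of such sums and vector inequalities can be exchanged freely.\<close>

lemma norm_sum_adj_le: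
  assumes T: "\<And>i. i \<in> F \<Longrightarrow> T i \<in> bounded_ops" and w: "\<And>i. i \<in> F \<Longrightarrow> 0 \<le> w i" and C: "0 \<le> C"
    and le: "\<And>x. (\<Sum>i\<in>F. w i * (norm (blinfun_apply (T i) x))\<^sup>2) \<le> C * (norm x)\<^sup>2"
  shows "norm (\<Sum>i\<in>F. w i *\<^sub>R (adj (T i) o\<^sub>L T i)) \<le> C"
proof (rule norm_le_of_inner[OF _ C])
  fix x y
  let ?s = "\<lambda>x i. sqrt (w i) * norm (blinfun_apply (T i) x)"
  have L2: "L2_set (?s x) F \<le> sqrt C * norm x" for x
  proof -
    have "L2_set (?s x) F = sqrt (\<Sum>i\<in>F. w i * (norm (blinfun_apply (T i) x))\<^sup>2)"
      using w by (simp add: L2_set_def power_mult_distrib)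
    also have "\<dots> \<le> sqrt (C * (norm x)\<^sup>2)" using le by simp
    finally show ?thesis by (simp add: real_sqrt_mult)
  qed
  have "inner (blinfun_apply (\<Sum>i\<in>F. w i *\<^sub>R (adj (T i) o\<^sub>L T i)) x) y
      = (\<Sum>i\<in>F. w i * inner (blinfun_apply (T i) x) (blinfun_apply (T i) y))"
    by (rule inner_sum_adj[OF T])
  also have "\<dots> \<le> (\<Sum>i\<in>F. \<bar>?s x i\<bar> * \<bar>?s y i\<bar>)"
  proof (rule sum_mono)
    fix i assume i: "i \<in> F"
    have "w i * inner (blinfun_apply (T i) x) (blinfun_apply (T i) y)
        \<le> w i * (norm (blinfun_apply (T i) x) * norm (blinfun_apply (T i) y))"
      using w[OF i] by (intro mult_left_mono norm_cauchy_schwarz)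
    also have "\<dots> = (sqrt (w i) * sqrt (w i)) * (norm (blinfun_apply (T i) x) * norm (blinfun_apply (T i) y))"
      using w[OF i] by simp
    finally show "w i * inner (blinfun_apply (T i) x) (blinfun_apply (T i) y) \<le> \<bar>?s x i\<bar> * \<bar>?s y i\<bar>"
      using w[OF i] by (simp only: abs_mult abs_norm_cancel real_sqrt_abs abs_of_nonneg real_sqrt_ge_zero mult_ac)
  qed
  also have "\<dots> \<le> L2_set (?s x) F * L2_set (?s y) F" by (rule L2_set_mult_ineq)
  also have "\<dots> \<le> (sqrt C * norm x) * (sqrt C * norm y)"
    using C by (intro mult_mono L2) auto
  also have "\<dots> = (sqrt C * sqrt C) * norm x * norm y" by (simp only: mult_ac)
  finally show "inner (blinfun_apply (\<Sum>i\<in>F. w i *\<^sub>R (adj (T i) o\<^sub>L T i)) x) y \<le> C * norm x * norm y"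
    using C by simp
qed

section \<open>Tensor products of operators\<close>

lemma tensor_op_eqI:
  assumes "A \<in> bounded_ops" "B \<in> bounded_ops"
    and "\<And>x y. blinfun_apply T (x \<otimes>\<^sub>v y) = blinfun_apply A x \<otimes>\<^sub>v blinfun_apply B y"
  shows "A \<otimes>\<^sub>o B = T"
  by (rule blinfun_tensor_eqI) (simp add: tensor_op assms)

lemma tensor_vec_zero_left [simp]: "0 \<otimes>\<^sub>v x = 0"
  using tensor_vec_linear(3)[of 0 0 x] by simp

lemma tensor_vec_scaleR: "(r *\<^sub>R x) \<otimes>\<^sub>v y = r *\<^sub>R (x \<otimes>\<^sub>v y)" "x \<otimes>\<^sub>v (r *\<^sub>R y) = r *\<^sub>R (x \<otimes>\<^sub>v y)"
  by (simp_all add: scaleR_scaleC tensor_vec_linear)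

lemma tensor_op_id: "id_blinfun \<otimes>\<^sub>o id_blinfun = id_blinfun"
  by (rule tensor_op_eqI) simp_all

lemma tensor_op_add_left:
  "A \<in> bounded_ops \<Longrightarrow> A' \<in> bounded_ops \<Longrightarrow> B \<in> bounded_ops \<Longrightarrow> (A + A') \<otimes>\<^sub>o B = A \<otimes>\<^sub>o B + A' \<otimes>\<^sub>o B"
  by (rule tensor_op_eqI) (simp_all add: bounded_ops_add blinfun.add_left tensor_op tensor_vec_linear)

lemma tensor_op_add_right:
  "A \<in> bounded_ops \<Longrightarrow> B' \<in> bounded_ops \<Longrightarrow> B \<in> bounded_ops \<Longrightarrow> A \<otimes>\<^sub>o (B + B') = A \<otimes>\<^sub>o B + A \<otimes>\<^sub>o B'"
  by (rule tensor_op_eqI) (simp_all add: bounded_ops_add blinfun.add_left tensor_op tensor_vec_linear)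

lemma tensor_op_scaleR:
  "A \<in> bounded_ops \<Longrightarrow> B \<in> bounded_ops \<Longrightarrow> (r *\<^sub>R A) \<otimes>\<^sub>o B = r *\<^sub>R (A \<otimes>\<^sub>o B)"
  "A \<in> bounded_ops \<Longrightarrow> B \<in> bounded_ops \<Longrightarrow> A \<otimes>\<^sub>o (r *\<^sub>R B) = r *\<^sub>R (A \<otimes>\<^sub>o B)"
  by (rule tensor_op_eqI; simp add: bounded_ops_scaleR blinfun.scaleR_left tensor_op tensor_vec_scaleR)+

lemma tensor_op_compose:
  assumes "A \<in> bounded_ops" "A' \<in> bounded_ops" "B \<in> bounded_ops" "B' \<in> bounded_ops"
  shows "(A \<otimes>\<^sub>o B) o\<^sub>L (A' \<otimes>\<^sub>o B') = (A o\<^sub>L A') \<otimes>\<^sub>o (B o\<^sub>L B')"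
  using assms by (intro tensor_op_eqI[symmetric]) (simp_all add: bounded_ops_compose tensor_op)

lemma cinner_tensor_eqI:
  fixes S T :: "('a::complex_hilbert, 'b::complex_hilbert) tensor"
  assumes "\<And>x y. cinner (x \<otimes>\<^sub>v y) S = cinner (x \<otimes>\<^sub>v y) T"
  shows "S = T"
proof -
  have "S - T = 0"
    by (rule tensor_zeroI) (metis assms cinner_commute cinner_diff_left eq_iff_diff_eq_0)
  then show ?thesis by simp
qed

lemma adj_tensor_op:
  assumes AB: "A \<in> bounded_ops" "B \<in> bounded_ops"
  shows "adj (A \<otimes>\<^sub>o B) = adj A \<otimes>\<^sub>o adj B"
  by (rule tensor_op_eqI[symmetric])
    (auto intro!: cinner_tensor_eqI simp: AB adj[symmetric] tensor_op cinner_tensor_vec)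

section \<open>Representations by ampliation\<close>

text \<open>This collects what is common to the maps X to X \<otimes> I and X to I \<otimes> X and
  is stable under composition, so that one argument serves an operator placed in any factor of an
  iterated tensor product.\<close>

locale star_rep =
  fixes \<phi> :: "('a::complex_hilbert \<Rightarrow>\<^sub>L 'a) \<Rightarrow> ('b::complex_hilbert \<Rightarrow>\<^sub>L 'b)"
  assumes bounded: "A \<in> bounded_ops \<Longrightarrow> \<phi> A \<in> bounded_ops"
    and add: "A \<in> bounded_ops \<Longrightarrow> B \<in> bounded_ops \<Longrightarrow> \<phi> (A + B) = \<phi> A + \<phi> B"
    and scaleR: "A \<in> bounded_ops \<Longrightarrow> \<phi> (r *\<^sub>R A) = r *\<^sub>R \<phi> A"
    and mult: "A \<in> bounded_ops \<Longrightarrow> B \<in> bounded_ops \<Longrightarrow> \<phi> (A o\<^sub>L B) = \<phi> A o\<^sub>L \<phi> B"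
    and id: "\<phi> id_blinfun = id_blinfun"
    and adjoint: "A \<in> bounded_ops \<Longrightarrow> \<phi> (adj A) = adj (\<phi> A)"
    and norm_le: "A \<in> bounded_ops \<Longrightarrow> norm (\<phi> A) \<le> norm A"
begin

lemma zero: "\<phi> 0 = 0"
  using scaleR[of 0 0] by simp

lemma sum: "(\<And>i. i \<in> F \<Longrightarrow> T i \<in> bounded_ops) \<Longrightarrow> \<phi> (\<Sum>i\<in>F. T i) = (\<Sum>i\<in>F. \<phi> (T i))"
  by (induction F rule: infinite_finite_induct) (auto simp: zero add bounded_ops_sum)

text \<open>\<open>\<phi>\<close> maps the sum of the products
  \<open>adj (T i) o\<^sub>L T i\<close> to the corresponding sum for the
  \<open>\<phi> (T i)\<close>, and it does not increase norms. Hence a column bound survives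
  ampliation with the same constant.\<close>

lemma sum_norm_sq_le:
  assumes "\<And>i. i \<in> F \<Longrightarrow> T i \<in> bounded_ops"
  shows "(\<Sum>i\<in>F. w i * (norm (blinfun_apply (\<phi> (T i)) x))\<^sup>2)
    \<le> norm (\<Sum>i\<in>F. w i *\<^sub>R (adj (T i) o\<^sub>L T i)) * (norm x)\<^sup>2"
proof -
  have "(\<Sum>i\<in>F. w i *\<^sub>R (adj (\<phi> (T i)) o\<^sub>L \<phi> (T i))) = \<phi> (\<Sum>i\<in>F. w i *\<^sub>R (adj (T i) o\<^sub>L T i))"
    using assms by (subst sum) (auto intro!: sum.cong bounded_ops_scaleR bounded_ops_compose
        simp: scaleR mult adjoint bounded_ops_compose)
  moreover have "norm (\<phi> (\<Sum>i\<in>F. w i *\<^sub>R (adj (T i) o\<^sub>L T i))) \<le> norm (\<Sum>i\<in>F. w i *\<^sub>R (adj (T i) o\<^sub>L T i))"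
    using assms by (intro norm_le bounded_ops_sum bounded_ops_scaleR bounded_ops_compose) auto
  ultimately show ?thesis
    using sum_norm_sq_le_norm_sum_adj[of F "\<lambda>i. \<phi> (T i)" w x] assms bounded
      mult_right_mono[of _ _ "(norm x)\<^sup>2"] by (metis (no_types, lifting) order_trans zero_le_power2)
qed

text \<open>The row bound is the adjoint of the column bound above.\<close>

lemma norm_sum_row_le:
  assumes T: "\<And>i. i \<in> F \<Longrightarrow> T i \<in> bounded_ops"
  shows "(norm (\<Sum>i\<in>F. blinfun_apply (\<phi> (T i)) (x i)))\<^sup>2
    \<le> norm (\<Sum>i\<in>F. T i o\<^sub>L adj (T i)) * (\<Sum>i\<in>F. (norm (x i))\<^sup>2)"
proof -
  define y where "y = (\<Sum>i\<in>F. blinfun_apply (\<phi> (T i)) (x i))"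
  define Q where "Q = norm (\<Sum>i\<in>F. T i o\<^sub>L adj (T i))"
  have col: "(\<Sum>i\<in>F. (norm (blinfun_apply (\<phi> (adj (T i))) y))\<^sup>2) \<le> Q * (norm y)\<^sup>2"
    using sum_norm_sq_le[of F "\<lambda>i. adj (T i)" "\<lambda>_. 1" y] T by (simp add: adj_adj Q_def)
  have "(norm y)\<^sup>2 = (\<Sum>i\<in>F. inner (x i) (blinfun_apply (\<phi> (adj (T i))) y))"
    unfolding power2_norm_eq_inner by (subst y_def) (simp add: inner_sum_left inner_adj bounded T adjoint)
  also have "\<dots> \<le> (\<Sum>i\<in>F. \<bar>norm (x i)\<bar> * \<bar>norm (blinfun_apply (\<phi> (adj (T i))) y)\<bar>)"
    by (intro sum_mono) (simp add: norm_cauchy_schwarz)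
  also have "\<dots> \<le> L2_set (\<lambda>i. norm (x i)) F * L2_set (\<lambda>i. norm (blinfun_apply (\<phi> (adj (T i))) y)) F"
    by (rule L2_set_mult_ineq)
  also have "\<dots> \<le> sqrt (\<Sum>i\<in>F. (norm (x i))\<^sup>2) * sqrt (Q * (norm y)\<^sup>2)"
    unfolding L2_set_def using col by (intro mult_left_mono) (auto intro: sum_nonneg)
  finally have "norm y * norm y \<le> (sqrt (\<Sum>i\<in>F. (norm (x i))\<^sup>2) * sqrt Q) * norm y"
    by (simp add: real_sqrt_mult power2_eq_square mult_ac)
  then have "norm y \<le> sqrt (\<Sum>i\<in>F. (norm (x i))\<^sup>2) * sqrt Q"
    by (cases "y = 0") (auto simp: sum_nonneg Q_def)
  then have "(norm y)\<^sup>2 \<le> (sqrt (\<Sum>i\<in>F. (norm (x i))\<^sup>2) * sqrt Q)\<^sup>2"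
    by (rule power_mono) simp
  then show ?thesis
    unfolding y_def[symmetric] Q_def[symmetric]
    by (simp add: power_mult_distrib sum_nonneg Q_def mult.commute)
qed

end

text \<open>Equality fails on the zero space, which the type class admits.\<close>

lemma norm_id_le: "norm (id_blinfun :: 'a::real_normed_vector \<Rightarrow>\<^sub>L 'a) \<le> 1"
  by (rule norm_blinfun_bound) simp_all

lemma blinfun_compose_id [simp]: "T o\<^sub>L id_blinfun = T" "id_blinfun o\<^sub>L T = T"
  by (rule blinfun_eqI; simp)+

lemma star_rep_left: "star_rep (\<lambda>A. A \<otimes>\<^sub>o id_blinfun)"
proof
  fix A :: "'a \<Rightarrow>\<^sub>L 'a" assume A: "A \<in> bounded_ops"
  have "norm (A \<otimes>\<^sub>o (id_blinfun :: 'b \<Rightarrow>\<^sub>L 'b)) \<le> norm A * norm (id_blinfun :: 'b \<Rightarrow>\<^sub>L 'b)"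
    using A by (simp add: tensor_op)
  then show "norm (A \<otimes>\<^sub>o (id_blinfun :: 'b \<Rightarrow>\<^sub>L 'b)) \<le> norm A"
    using norm_id_le[where 'a='b] mult_left_mono[OF norm_id_le[where 'a='b], of "norm A"] by simp
qed (simp_all add: tensor_op tensor_op_add_left tensor_op_scaleR tensor_op_compose tensor_op_id adj_tensor_op)

lemma star_rep_right: "star_rep (\<lambda>A. id_blinfun \<otimes>\<^sub>o A)"
proof
  fix A :: "'a \<Rightarrow>\<^sub>L 'a" assume A: "A \<in> bounded_ops"
  have "norm ((id_blinfun :: 'b \<Rightarrow>\<^sub>L 'b) \<otimes>\<^sub>o A) \<le> norm (id_blinfun :: 'b \<Rightarrow>\<^sub>L 'b) * norm A"
    using A by (simp add: tensor_op)
  then show "norm ((id_blinfun :: 'b \<Rightarrow>\<^sub>L 'b) \<otimes>\<^sub>o A) \<le> norm A"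
    using mult_right_mono[OF norm_id_le[where 'a='b], of "norm A"] by simp
qed (simp_all add: tensor_op tensor_op_add_right tensor_op_scaleR tensor_op_compose tensor_op_id adj_tensor_op)

lemma star_rep_comp:
  assumes "star_rep \<phi>" "star_rep \<psi>"
  shows "star_rep (\<lambda>A. \<psi> (\<phi> A))"
proof -
  interpret f: star_rep \<phi> by fact
  interpret g: star_rep \<psi> by fact
  show ?thesis
    by standard (auto simp: f.bounded f.add f.scaleR f.mult f.id f.adjoint g.bounded g.add g.scaleR g.mult g.id
        g.adjoint intro: order_trans[OF g.norm_le f.norm_le])
qed

section \<open>Words and multi-indices\<close>

definition words :: "nat \<Rightarrow> 'n list set" where
  "words k = {\<alpha>. length \<alpha> = k}"

lemma finite_words [simp]: "finite (words k :: 'n::finite list set)"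
  using finite_lists_length_eq[of "UNIV :: 'n set" k] by (simp add: words_def)

lemma words_0 [simp]: "words 0 = {[]}"
  by (auto simp: words_def)

lemma sum_words_Suc:
  "(\<Sum>\<alpha>\<in>words (Suc k). G \<alpha>) = (\<Sum>i\<in>(UNIV::'n::finite set). \<Sum>\<alpha>\<in>words k. G (i # \<alpha>))"
proof -
  have "words (Suc k) = (\<lambda>(i::'n, \<alpha>). i # \<alpha>) ` (UNIV \<times> words k)"
    by (auto simp: words_def length_Suc_conv image_iff)
  then have "sum G (words (Suc k)) = (\<Sum>(i, \<alpha>)\<in>UNIV \<times> words k. G (i # \<alpha>))"
    by (simp add: sum.reindex inj_on_def case_prod_unfold o_def)
  then show ?thesis by (simp add: sum.cartesian_product)
qed

definition canonical_word :: "('n::{finite,linorder} \<Rightarrow> nat) \<Rightarrow> 'n list" where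
  "canonical_word p = concat (map (\<lambda>i. replicate (p i) i) (sorted_list_of_set UNIV))"

lemma count_list_replicate: "count_list (replicate m i) j = (if i = j then m else 0)"
  by (induction m) auto

lemma count_list_canonical_word: "count_list (canonical_word p) = p"
proof
  fix j
  have "count_list (concat (map (\<lambda>i. replicate (p i) i) xs)) j = (if j \<in> set xs then p j else 0)"
    if "distinct xs" for xs
    using that by (induction xs) (auto simp: count_list_replicate)
  then show "count_list (canonical_word p) j = p j" by (simp add: canonical_word_def)
qed

lemma sum_count_list: "(\<Sum>i\<in>UNIV. count_list \<alpha> i) = length (\<alpha> :: 'n::finite list)"
  by (rule sum_count_set) auto

lemma multi_indices_eq: "multi_indices k = count_list ` (words k :: 'n::{finite,linorder} list set)"
proof (intro equalityI subsetI)
  fix p :: "'n \<Rightarrow> nat" assume "p \<in> multi_indices k"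
  then have "canonical_word p \<in> words k"
    using sum_count_list[of "canonical_word p"]
    by (simp add: words_def multi_indices_def count_list_canonical_word)
  then show "p \<in> count_list ` words k"
    using count_list_canonical_word[of p] by (metis image_eqI)
qed (auto simp: words_def multi_indices_def sum_count_list)

lemma finite_multi_indices [simp]: "finite (multi_indices k :: ('n::{finite,linorder} \<Rightarrow> nat) set)"
  by (simp add: multi_indices_eq)

lemma sum_words:
  "(\<Sum>\<alpha>\<in>words k. G \<alpha>) = (\<Sum>p\<in>multi_indices k. \<Sum>\<alpha>\<in>words_of p. G (\<alpha> :: 'n::{finite,linorder} list))"
proof -
  have "(\<Sum>\<alpha>\<in>words k. G \<alpha>) = (\<Sum>p\<in>multi_indices k. \<Sum>\<alpha>\<in>{\<alpha> \<in> words k. count_list \<alpha> = p}. G \<alpha>)"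
    unfolding multi_indices_eq by (rule sum.image_gen) simp
  also have "\<dots> = (\<Sum>p\<in>multi_indices k. \<Sum>\<alpha>\<in>words_of p. G \<alpha>)"
  proof (rule sum.cong[OF refl])
    fix p :: "'n \<Rightarrow> nat" assume "p \<in> multi_indices k"
    then have "{\<alpha> \<in> words k. count_list \<alpha> = p} = words_of p"
      by (auto simp: words_of_eq words_def multi_indices_def sum_count_list)
    then show "(\<Sum>\<alpha>\<in>{\<alpha> \<in> words k. count_list \<alpha> = p}. G \<alpha>) = (\<Sum>\<alpha>\<in>words_of p. G \<alpha>)"
      by (rule arg_cong)
  qed
  finally show ?thesis .
qed

text \<open>The words with letter counts p are the permutations of one multiset with multiplicities
  p, so the multinomial coefficient counts them.\<close>

lemma card_words_of: "real (card (words_of p)) = multinomial (p :: 'n::{finite,linorder} \<Rightarrow> nat)"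
proof -
  define M where "M = mset (canonical_word p)"
  have M: "count M = p" by (rule ext) (simp add: M_def count_mset count_list_canonical_word)
  have "words_of p = permutations_of_multiset M"
    unfolding words_of_eq permutations_of_multiset_def
    by (auto simp: multiset_eq_iff M count_mset fun_eq_iff)
  moreover have "(\<Prod>i\<in>set_mset M. fact (count M i)) = (\<Prod>i\<in>UNIV. fact (p i) :: nat)"
    unfolding M[symmetric] by (rule prod.mono_neutral_left) (auto simp: not_in_iff)
  moreover have "size M = (\<Sum>i\<in>UNIV. p i)"
    using sum_count_list[of "canonical_word p"] by (simp add: M_def count_list_canonical_word)
  ultimately have "card (words_of p) * (\<Prod>i\<in>UNIV. fact (p i)) = fact (\<Sum>i\<in>UNIV. p i)"
    using card_permutations_of_multiset_aux[of M] by simp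
  then have "real (card (words_of p) * (\<Prod>i\<in>UNIV. fact (p i))) = real (fact (\<Sum>i\<in>UNIV. p i))"
    by (rule arg_cong)
  then have "real (card (words_of p)) * (\<Prod>i\<in>UNIV. fact (p i)) = fact (\<Sum>i\<in>UNIV. p i)"
    by (simp only: of_nat_mult of_nat_prod of_nat_fact)
  then show ?thesis by (simp add: multinomial_def field_simps)
qed

text \<open>This is the origin of all weights |p|!/p!: a weighted sum over multi-indices is an
  unweighted sum over words.\<close>

lemma sum_words_count:
  fixes G :: "('n::{finite,linorder} \<Rightarrow> nat) \<Rightarrow> 'a::real_vector"
  shows "(\<Sum>\<alpha>\<in>words k. G (count_list \<alpha>)) = (\<Sum>p\<in>multi_indices k. multinomial p *\<^sub>R G p)"
proof -
  have "(\<Sum>\<alpha>\<in>words_of p. G (count_list \<alpha>)) = multinomial p *\<^sub>R G p" for p :: "'n \<Rightarrow> nat"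
  proof -
    have "(\<Sum>\<alpha>\<in>words_of p. G (count_list \<alpha>)) = (\<Sum>\<alpha>\<in>words_of p. G p)"
      by (rule sum.cong) (simp_all add: words_of_eq)
    then show ?thesis by (simp add: sum_constant_scaleR card_words_of)
  qed
  then show ?thesis unfolding sum_words by simp
qed

lemma multinomial_ge_1: "1 \<le> multinomial (p :: 'n::{finite,linorder} \<Rightarrow> nat)"
proof -
  have "finite (words_of p)"
    by (rule finite_subset[OF _ finite_words[of "\<Sum>i\<in>UNIV. p i"]])
      (auto simp: words_of_eq words_def sum_count_list)
  moreover have "canonical_word p \<in> words_of p" by (simp add: words_of_eq count_list_canonical_word)
  ultimately have "1 \<le> card (words_of p)" by (metis card_gt_0_iff empty_iff less_eq_Suc_le One_nat_def)
  then show ?thesis unfolding card_words_of[symmetric] by simp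
qed

lemma multinomial_pos [simp]: "0 < multinomial (p :: 'n::{finite,linorder} \<Rightarrow> nat)"
  using multinomial_ge_1[of p] by linarith

lemma multinomial_nz [simp]: "multinomial (p :: 'n::{finite,linorder} \<Rightarrow> nat) \<noteq> 0"
  using multinomial_pos[of p] by linarith

lemma multi_indices_0 [simp]: "multi_indices 0 = {\<lambda>_. 0}"
  by (auto simp: multi_indices_def)

lemma multinomial_0 [simp]: "multinomial (\<lambda>_. 0) = 1"
  by (simp add: multinomial_def)

section \<open>Row and column bounds for monomials\<close>

lemma op_word_Nil [simp]: "op_word T [] = id_blinfun"
  and op_word_Cons [simp]: "op_word T (i # \<alpha>) = T i o\<^sub>L op_word T \<alpha>"
  by (simp_all add: op_word_def)

lemma op_monomial_eq: "op_monomial T p = op_word T (canonical_word p)"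
  by (simp add: op_monomial_def canonical_word_def)

lemma op_word_bounded_ops: "(\<And>i. T i \<in> bounded_ops) \<Longrightarrow> op_word T \<alpha> \<in> bounded_ops"
  by (induction \<alpha>) (auto intro: bounded_ops_compose)

lemma op_monomial_bounded_ops: "(\<And>i. T i \<in> bounded_ops) \<Longrightarrow> op_monomial T p \<in> bounded_ops"
  by (simp add: op_monomial_eq op_word_bounded_ops)

lemma blinfun_compose_assoc: "(R o\<^sub>L S) o\<^sub>L T = R o\<^sub>L (S o\<^sub>L T)"
  by (rule blinfun_eqI) simp

lemma op_word_commute:
  fixes T :: "'n \<Rightarrow> 'k::complex_hilbert \<Rightarrow>\<^sub>L 'k"
  assumes "\<And>i j. T i o\<^sub>L T j = T j o\<^sub>L T i" "mset \<alpha> = mset \<beta>"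
  shows "op_word T \<alpha> = op_word T \<beta>"
proof -
  \<comment> \<open>\<open>foldr\<close> is \<open>fold\<close> over the reversed list, and reversal
    leaves the multiset of letters unchanged; left multiplications by the \<open>T i\<close> commute
    with each other.\<close>
  have "fold (\<lambda>i (X :: 'k \<Rightarrow>\<^sub>L 'k). T i o\<^sub>L X) (rev \<alpha>) = fold (\<lambda>i X. T i o\<^sub>L X) (rev \<beta>)"
    by (rule fold_multiset_equiv) (auto simp: assms fun_eq_iff blinfun_compose_assoc[symmetric])
  then show ?thesis by (simp add: op_word_def foldr_conv_fold)
qed

lemma op_monomial_words_of:
  assumes "\<And>i j. T i o\<^sub>L T j = T j o\<^sub>L T i" "\<alpha> \<in> words_of p"
  shows "op_word T \<alpha> = op_monomial T p"
  unfolding op_monomial_eq using assms(2)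
  by (intro op_word_commute assms(1))
    (simp add: words_of_eq multiset_eq_iff count_mset count_list_canonical_word)

lemma (in star_rep) op_word: "(\<And>i. T i \<in> bounded_ops) \<Longrightarrow> op_word (\<lambda>i. \<phi> (T i)) \<alpha> = \<phi> (op_word T \<alpha>)"
  by (induction \<alpha>) (auto simp: id mult op_word_bounded_ops)

lemma (in star_rep) op_monomial:
  "(\<And>i. T i \<in> bounded_ops) \<Longrightarrow> op_monomial (\<lambda>i. \<phi> (T i)) p = \<phi> (op_monomial T p)"
  by (simp add: op_monomial_eq op_word)

text \<open>Splitting off the first letter i leaves an inner sum over the shorter words, which
  serves as the i-th entry in the row inequality. Each letter costs one factor
  \<open>C\<close>.\<close>

lemma row_bound_words:
  fixes T :: "'n::finite \<Rightarrow> 'k::complex_hilbert \<Rightarrow>\<^sub>L 'k"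
  assumes row: "\<And>x. (norm (\<Sum>i\<in>UNIV. blinfun_apply (T i) (x i)))\<^sup>2 \<le> C * (\<Sum>i\<in>UNIV. (norm (x i))\<^sup>2)"
    and C: "0 \<le> C"
  shows "(norm (\<Sum>\<alpha>\<in>words k. blinfun_apply (op_word T \<alpha>) (x \<alpha>)))\<^sup>2 \<le> C ^ k * (\<Sum>\<alpha>\<in>words k. (norm (x \<alpha>))\<^sup>2)"
proof (induction k arbitrary: x)
  case (Suc k)
  have "(norm (\<Sum>\<alpha>\<in>words (Suc k). blinfun_apply (op_word T \<alpha>) (x \<alpha>)))\<^sup>2
      = (norm (\<Sum>i\<in>UNIV. blinfun_apply (T i) (\<Sum>\<alpha>\<in>words k. blinfun_apply (op_word T \<alpha>) (x (i # \<alpha>)))))\<^sup>2"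
    by (simp add: sum_words_Suc blinfun.sum_right)
  also have "\<dots> \<le> C * (\<Sum>i\<in>UNIV. (norm (\<Sum>\<alpha>\<in>words k. blinfun_apply (op_word T \<alpha>) (x (i # \<alpha>))))\<^sup>2)"
    by (rule row)
  also have "\<dots> \<le> C * (\<Sum>i\<in>UNIV. C ^ k * (\<Sum>\<alpha>\<in>words k. (norm (x (i # \<alpha>)))\<^sup>2))"
    by (intro mult_left_mono sum_mono Suc C)
  also have "\<dots> = C ^ Suc k * (\<Sum>\<alpha>\<in>words (Suc k). (norm (x \<alpha>))\<^sup>2)"
    by (simp add: sum_words_Suc sum_distrib_left mult.assoc)
  finally show ?case .
qed simp

text \<open>Every word with counts p receives the same vector x_p / \<open>multinomial p\<close>.
  There are \<open>multinomial p\<close> such words, so the squared norms add up to |x_p|^2 /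
  \<open>multinomial p\<close>. Commutation does not enter, so the bound applies to the creation
  operators on the full Fock space.\<close>

lemma row_bound_count:
  fixes T :: "'n::{finite,linorder} \<Rightarrow> 'k::complex_hilbert \<Rightarrow>\<^sub>L 'k"
  assumes row: "\<And>x. (norm (\<Sum>i\<in>UNIV. blinfun_apply (T i) (x i)))\<^sup>2 \<le> C * (\<Sum>i\<in>UNIV. (norm (x i))\<^sup>2)"
    and C: "0 \<le> C"
  shows "(norm (\<Sum>p\<in>multi_indices k. (1 / multinomial p) *\<^sub>R (\<Sum>\<alpha>\<in>words_of p. blinfun_apply (op_word T \<alpha>) (x p))))\<^sup>2
    \<le> C ^ k * (\<Sum>p\<in>multi_indices k. (1 / multinomial p) * (norm (x p))\<^sup>2)"
proof -
  let ?x = "\<lambda>\<alpha>. (1 / multinomial (count_list \<alpha>)) *\<^sub>R x (count_list \<alpha>)"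
  have "(\<Sum>\<alpha>\<in>words k. blinfun_apply (op_word T \<alpha>) (?x \<alpha>)) =
      (\<Sum>p\<in>multi_indices k. (1 / multinomial p) *\<^sub>R (\<Sum>\<alpha>\<in>words_of p. blinfun_apply (op_word T \<alpha>) (x p)))"
    unfolding sum_words scaleR_sum_right
    by (intro sum.cong refl) (simp add: words_of_eq blinfun.scaleR_right)
  moreover have "(\<Sum>\<alpha>\<in>words k. (norm (?x \<alpha>))\<^sup>2) = (\<Sum>p\<in>multi_indices k. (1 / multinomial p) * (norm (x p))\<^sup>2)"
    unfolding sum_words_count[where G = "\<lambda>p. (norm ((1 / multinomial p) *\<^sub>R x p))\<^sup>2"]
    by (intro sum.cong refl) (simp add: power_mult_distrib power_divide power2_eq_square less_imp_le)
  ultimately show ?thesis using row_bound_words[OF row C, where x = ?x and k = k] by simp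
qed

lemma row_bound_monomial:
  fixes T :: "'n::{finite,linorder} \<Rightarrow> 'k::complex_hilbert \<Rightarrow>\<^sub>L 'k"
  assumes row: "\<And>x. (norm (\<Sum>i\<in>UNIV. blinfun_apply (T i) (x i)))\<^sup>2 \<le> C * (\<Sum>i\<in>UNIV. (norm (x i))\<^sup>2)"
    and C: "0 \<le> C" and comm: "\<And>i j. T i o\<^sub>L T j = T j o\<^sub>L T i"
  shows "(norm (\<Sum>p\<in>multi_indices k. blinfun_apply (op_monomial T p) (x p)))\<^sup>2
    \<le> C ^ k * (\<Sum>p\<in>multi_indices k. (1 / multinomial p) * (norm (x p))\<^sup>2)"
proof -
  have "(1 / multinomial p) *\<^sub>R (\<Sum>\<alpha>\<in>words_of p. blinfun_apply (op_word T \<alpha>) (x p))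
      = blinfun_apply (op_monomial T p) (x p)" for p
  proof -
    have "(\<Sum>\<alpha>\<in>words_of p. blinfun_apply (op_word T \<alpha>) (x p))
        = (\<Sum>\<alpha>\<in>words_of p. blinfun_apply (op_monomial T p) (x p))"
      by (intro sum.cong refl) (simp add: op_monomial_words_of[OF comm])
    then show ?thesis by (simp add: sum_constant_scaleR card_words_of)
  qed
  then show ?thesis using row_bound_count[OF row C, where x = x and k = k] by simp
qed

text \<open>The first letter acts last, so for each fixed shorter word \<alpha> the column
  inequality is applied to the vector T_\<alpha> x; this is the reason for exchanging the two
  sums.\<close>

lemma column_bound_words:
  fixes T :: "'n::finite \<Rightarrow> 'k::complex_hilbert \<Rightarrow>\<^sub>L 'k"
  assumes col: "\<And>x. (\<Sum>i\<in>UNIV. (norm (blinfun_apply (T i) x))\<^sup>2) \<le> C * (norm x)\<^sup>2" and C: "0 \<le> C"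
  shows "(\<Sum>\<alpha>\<in>words k. (norm (blinfun_apply (op_word T \<alpha>) x))\<^sup>2) \<le> C ^ k * (norm x)\<^sup>2"
proof (induction k)
  case (Suc k)
  have "(\<Sum>\<alpha>\<in>words (Suc k). (norm (blinfun_apply (op_word T \<alpha>) x))\<^sup>2)
      = (\<Sum>\<alpha>\<in>words k. \<Sum>i\<in>UNIV. (norm (blinfun_apply (T i) (blinfun_apply (op_word T \<alpha>) x)))\<^sup>2)"
    by (subst sum.swap) (simp add: sum_words_Suc)
  also have "\<dots> \<le> (\<Sum>\<alpha>\<in>words k. C * (norm (blinfun_apply (op_word T \<alpha>) x))\<^sup>2)"
    by (intro sum_mono col)
  also have "\<dots> \<le> C ^ Suc k * (norm x)\<^sup>2"
    using mult_left_mono[OF Suc C] by (simp add: sum_distrib_left mult.assoc)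
  finally show ?case .
qed simp

lemma column_bound_monomial:
  fixes T :: "'n::{finite,linorder} \<Rightarrow> 'k::complex_hilbert \<Rightarrow>\<^sub>L 'k"
  assumes col: "\<And>x. (\<Sum>i\<in>UNIV. (norm (blinfun_apply (T i) x))\<^sup>2) \<le> C * (norm x)\<^sup>2" and C: "0 \<le> C"
    and comm: "\<And>i j. T i o\<^sub>L T j = T j o\<^sub>L T i"
  shows "(\<Sum>p\<in>multi_indices k. multinomial p * (norm (blinfun_apply (op_monomial T p) x))\<^sup>2)
    \<le> C ^ k * (norm x)\<^sup>2"
proof -
  have "(\<Sum>p\<in>multi_indices k. multinomial p * (norm (blinfun_apply (op_monomial T p) x))\<^sup>2)
      = (\<Sum>\<alpha>\<in>words k. (norm (blinfun_apply (op_monomial T (count_list \<alpha>)) x))\<^sup>2)"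
    unfolding sum_words_count[where G = "\<lambda>p. (norm (blinfun_apply (op_monomial T p) x))\<^sup>2"] by simp
  also have "\<dots> = (\<Sum>\<alpha>\<in>words k. (norm (blinfun_apply (op_word T \<alpha>) x))\<^sup>2)"
    by (intro sum.cong refl) (simp add: op_monomial_words_of[OF comm] words_of_eq)
  finally show ?thesis using column_bound_words[OF col C] by simp
qed

section \<open>Square roots\<close>

lemma cinner_scaleR_left: "cinner (r *\<^sub>R (x::'a::complex_inner)) y = complex_of_real r * cinner x y"
  and cinner_scaleR_right: "cinner x (r *\<^sub>R (y::'a::complex_inner)) = complex_of_real r * cinner x y"
  by (simp_all only: scaleR_scaleC cinner_scaleC_left cinner_scaleC_right complex_cnj_complex_of_real)

lemma closed_bounded_ops: "closed bounded_ops"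
  unfolding closed_sequential_limits using bounded_ops_limit by blast

text \<open>The right inverse is the fixed point of S = I + T S, a contraction with constant
  \<open>norm T\<close> on the complete set \<open>bounded_ops\<close>. It is also a left inverse
  because I - T is injective: T z = z forces |z| <= ||T|| |z|.\<close>

lemma neumann:
  fixes T :: "'a::complex_hilbert \<Rightarrow>\<^sub>L 'a"
  assumes T: "T \<in> bounded_ops" "norm T < 1"
  shows "\<exists>S\<in>bounded_ops. (id_blinfun - T) o\<^sub>L S = id_blinfun \<and> S o\<^sub>L (id_blinfun - T) = id_blinfun"
proof -
  have "\<exists>!S. S \<in> bounded_ops \<and> id_blinfun + (T o\<^sub>L S) = S"
  proof (rule Banach_fix[OF _ _ norm_ge_zero T(2)])
    show "complete (bounded_ops :: ('a \<Rightarrow>\<^sub>L 'a) set)" by (simp add: complete_eq_closed closed_bounded_ops)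
    show "bounded_ops \<noteq> ({} :: ('a \<Rightarrow>\<^sub>L 'a) set)" using bounded_ops_0 by blast
    show "(\<lambda>S. id_blinfun + (T o\<^sub>L S)) ` bounded_ops \<subseteq> bounded_ops"
      using T by (auto intro: bounded_ops_add bounded_ops_compose)
    fix S S' :: "'a \<Rightarrow>\<^sub>L 'a"
    have "(id_blinfun + (T o\<^sub>L S)) - (id_blinfun + (T o\<^sub>L S')) = T o\<^sub>L (S - S')"
      by (rule blinfun_eqI) (simp add: blinfun.bilinear_simps)
    then show "dist (id_blinfun + (T o\<^sub>L S)) (id_blinfun + (T o\<^sub>L S')) \<le> norm T * dist S S'"
      using norm_blinfun_compose[of T "S - S'"] by (simp add: dist_norm)
  qed
  then obtain S where S: "S \<in> bounded_ops" "id_blinfun + (T o\<^sub>L S) = S" by blast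
  have right: "(id_blinfun - T) o\<^sub>L S = id_blinfun"
    using arg_cong[OF S(2), of "\<lambda>U. blinfun_apply U _"]
    by (intro blinfun_eqI) (simp add: blinfun.bilinear_simps algebra_simps)
  have "blinfun_apply S (blinfun_apply (id_blinfun - T) x) = x" for x
  proof -
    define z where "z = blinfun_apply S (blinfun_apply (id_blinfun - T) x) - x"
    have "blinfun_apply (id_blinfun - T) z = 0"
      unfolding z_def blinfun.diff_right
      using arg_cong[OF right, of "\<lambda>U. blinfun_apply U (blinfun_apply (id_blinfun - T) x)"] by simp
    then have "norm z = norm (blinfun_apply T z)" by (simp add: blinfun.diff_left)
    also have "\<dots> \<le> norm T * norm z" by (rule norm_blinfun)
    finally have "norm z * (1 - norm T) \<le> 0" by (simp add: algebra_simps)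
    then show ?thesis using T(2) by (simp add: z_def mult_le_0_iff)
  qed
  then have "S o\<^sub>L (id_blinfun - T) = id_blinfun" by (intro blinfun_eqI) simp
  with S(1) right show ?thesis by blast
qed

text \<open>If \<open>Y\<close> solves \<open>2 Y = T + Y\<^sup>2\<close>, then \<open>(1 - Y)\<^sup>2 = 1 - T\<close>.\<close>

lemma sqrt_one_minus:
  fixes T :: "'a::complex_hilbert \<Rightarrow>\<^sub>L 'a"
  assumes T: "T \<in> bounded_ops" "norm T < 1" "adj T = T"
  shows "\<exists>R S. R \<in> bounded_ops \<and> S \<in> bounded_ops \<and> adj R = R \<and> R o\<^sub>L R = id_blinfun - T
    \<and> R o\<^sub>L S = id_blinfun \<and> S o\<^sub>L R = id_blinfun"
proof -
  \<comment> \<open>On the ball of radius \<open>norm T\<close> < 1 one has ||Y||^2 <= ||T||, so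
    \<open>?g\<close> maps it into itself and contracts with constant \<open>norm T\<close>.
    Self-adjointness is imposed as an identity between forms because that is a closed condition on
    Y.\<close>
  define M :: "('a \<Rightarrow>\<^sub>L 'a) set" where "M = {Y \<in> bounded_ops. norm Y \<le> norm T \<and>
    (\<forall>x y. cinner (blinfun_apply Y x) y = cinner x (blinfun_apply Y y))}"
  let ?g = "\<lambda>Y. (1/2) *\<^sub>R (T + (Y o\<^sub>L Y))"
  have Tsym: "cinner (blinfun_apply T x) y = cinner x (blinfun_apply T y)" for x y
    using adj[OF T(1)] T(3) by simp
  have "\<exists>!Y. Y \<in> M \<and> ?g Y = Y"
  proof (rule Banach_fix[OF _ _ norm_ge_zero T(2)])
    have lin: "closed {Y. cinner (blinfun_apply Y x) y = cinner x (blinfun_apply Y y)}" for x y :: 'a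
      by (intro closed_Collect_eq linear_continuous_on
          bounded_linear_compose[OF bounded_linear_cinner_left blinfun.bounded_linear_left]
          bounded_linear_compose[OF bounded_linear_cinner_right blinfun.bounded_linear_left])
    have "M = bounded_ops \<inter> {Y. norm Y \<le> norm T} \<inter>
        (\<Inter>x y. {Y. cinner (blinfun_apply Y x) y = cinner x (blinfun_apply Y y)})"
      by (auto simp: M_def)
    moreover have "closed \<dots>"
      by (intro closed_Int closed_INT closed_bounded_ops ballI lin closed_Collect_le continuous_intros)
    ultimately show "complete M" by (simp add: complete_eq_closed)
    show "M \<noteq> {}" by (auto simp: M_def intro!: exI[of _ 0])
    show "?g ` M \<subseteq> M"
    proof (intro image_subsetI)
      fix Y assume Y: "Y \<in> M"
      have "norm (T + (Y o\<^sub>L Y)) \<le> norm T + norm Y * norm Y"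
        by (intro order_trans[OF norm_triangle_ineq] add_left_mono norm_blinfun_compose)
      also have "norm Y * norm Y \<le> norm T * 1"
        using Y T(2) by (intro mult_mono) (auto simp: M_def)
      finally have "norm (?g Y) \<le> norm T" by simp
      then show "?g Y \<in> M"
        using Y T(1) Tsym by (auto simp: M_def bounded_ops_scaleR bounded_ops_add bounded_ops_compose
            blinfun.bilinear_simps cinner_scaleR_left cinner_scaleR_right
            cinner_add_left cinner_add_right)
    qed
    fix Y Y' assume Y: "Y \<in> M" "Y' \<in> M"
    have "?g Y - ?g Y' = (1/2) *\<^sub>R ((Y o\<^sub>L (Y - Y')) + ((Y - Y') o\<^sub>L Y'))"
      by (rule blinfun_eqI) (simp add: blinfun.bilinear_simps algebra_simps)
    then have "dist (?g Y) (?g Y') = norm ((Y o\<^sub>L (Y - Y')) + ((Y - Y') o\<^sub>L Y')) / 2"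
      by (simp add: dist_norm)
    also have "\<dots> \<le> (norm Y * norm (Y - Y') + norm (Y - Y') * norm Y') / 2"
      by (intro divide_right_mono order_trans[OF norm_triangle_ineq] add_mono norm_blinfun_compose) simp
    also have "\<dots> \<le> (norm T * norm (Y - Y') + norm (Y - Y') * norm T) / 2"
      using Y by (intro divide_right_mono add_mono mult_right_mono mult_left_mono) (auto simp: M_def)
    finally show "dist (?g Y) (?g Y') \<le> norm T * dist Y Y'" by (simp add: dist_norm)
  qed
  then obtain Y where Y: "Y \<in> M" "?g Y = Y" by blast
  obtain S where S: "S \<in> bounded_ops" "(id_blinfun - Y) o\<^sub>L S = id_blinfun" "S o\<^sub>L (id_blinfun - Y) = id_blinfun"
    using neumann[of Y] Y(1) T(2) by (auto simp: M_def)
  have "T + (Y o\<^sub>L Y) = 2 *\<^sub>R Y" by (subst (3) Y(2)[symmetric]) simp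
  from arg_cong[OF this, of "\<lambda>U. blinfun_apply U _"]
  have "blinfun_apply T x = 2 *\<^sub>R blinfun_apply Y x - blinfun_apply Y (blinfun_apply Y x)" for x
    by (simp add: blinfun.bilinear_simps eq_diff_eq)
  then have "(id_blinfun - Y) o\<^sub>L (id_blinfun - Y) = id_blinfun - T"
    by (intro blinfun_eqI) (simp add: blinfun.bilinear_simps algebra_simps scaleR_2)
  moreover have "adj (id_blinfun - Y) = id_blinfun - Y"
    using Y(1) by (intro adj_eqI) (auto simp: M_def bounded_ops_diff blinfun.diff_left cinner_diff_left cinner_diff_right)
  ultimately show ?thesis
    using S Y(1) by (intro exI[of _ "id_blinfun - Y"] exI[of _ S]) (auto simp: M_def bounded_ops_diff)
qed

text \<open>Division by 1 + \<delta> turns ||Q|| <= 1 into the strict inequality required for the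
  root of I - T; the factor \<open>s\<close> scales the result back. With Q = A_0 this gives a root
  of D + \<delta>, and with Q = D one of A_0 + \<delta>.\<close>

lemma sqrt_shifted:
  assumes Q: "Q \<in> bounded_ops" "norm Q \<le> 1" "adj Q = Q" and \<delta>: "0 < \<delta>"
  shows "\<exists>R S. R \<in> bounded_ops \<and> S \<in> bounded_ops \<and> adj R = R \<and> R o\<^sub>L R = (1 + \<delta>) *\<^sub>R id_blinfun - Q
    \<and> R o\<^sub>L S = id_blinfun \<and> S o\<^sub>L R = id_blinfun"
proof -
  define s where "s = sqrt (1 + \<delta>)"
  have s: "0 < s" "s * s = 1 + \<delta>" using \<delta> by (simp_all add: s_def)
  define T where "T = (1 / (1 + \<delta>)) *\<^sub>R Q"
  have T: "T \<in> bounded_ops" "norm T < 1"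
    using Q \<delta> by (simp_all add: T_def bounded_ops_scaleR)
  have "cinner (blinfun_apply Q x) y = cinner x (blinfun_apply Q y)" for x y
    using adj[OF Q(1)] Q(3) by simp
  then have "adj T = T"
    by (intro adj_eqI T)
      (simp add: T_def blinfun.scaleR_left cinner_scaleR_left cinner_scaleR_right)
  from sqrt_one_minus[OF T this] obtain R S where
    R: "R \<in> bounded_ops" "S \<in> bounded_ops" "adj R = R" "R o\<^sub>L R = id_blinfun - T"
    "R o\<^sub>L S = id_blinfun" "S o\<^sub>L R = id_blinfun" by blast
  have app: "blinfun_apply R (blinfun_apply R x) = x - blinfun_apply T x"
    "blinfun_apply R (blinfun_apply S x) = x" "blinfun_apply S (blinfun_apply R x) = x" for x
    using arg_cong[OF R(4), of "\<lambda>U. blinfun_apply U x"] arg_cong[OF R(5), of "\<lambda>U. blinfun_apply U x"]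
      arg_cong[OF R(6), of "\<lambda>U. blinfun_apply U x"] by (simp_all add: blinfun.diff_left)
  have "adj (s *\<^sub>R R) = s *\<^sub>R R"
    using adj[OF R(1)] R(3) by (intro adj_eqI bounded_ops_scaleR R)
      (simp add: blinfun.scaleR_left cinner_scaleR_left cinner_scaleR_right)
  moreover have "(s *\<^sub>R R) o\<^sub>L (s *\<^sub>R R) = (1 + \<delta>) *\<^sub>R id_blinfun - Q"
    using \<delta> by (intro blinfun_eqI)
      (simp add: blinfun.bilinear_simps app s(2) scaleR_diff_right T_def)
  moreover have "(s *\<^sub>R R) o\<^sub>L ((1/s) *\<^sub>R S) = id_blinfun" "((1/s) *\<^sub>R S) o\<^sub>L (s *\<^sub>R R) = id_blinfun"
    using s by (intro blinfun_eqI; simp add: blinfun.bilinear_simps app)+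
  ultimately show ?thesis using R by (meson bounded_ops_scaleR)
qed

text \<open>Among the multiples of Z x, the vector y = Z x / (2 m) is the best choice: |Z x|^2 / (2
  m) on the left exceeds the |Z x|^2 / (4 m) on the right, which leaves |Z x|^2 <= 4 m
  |x|^2.\<close>

lemma norm_le_of_form_bound:
  fixes Z :: "'a::real_inner \<Rightarrow>\<^sub>L 'b::real_inner"
  assumes le: "\<And>x y. inner (blinfun_apply Z x) y \<le> (norm x)\<^sup>2 + m * (norm y)\<^sup>2" and m: "0 < m"
  shows "norm Z \<le> 2 * sqrt m"
proof (rule norm_blinfun_bound)
  fix x
  let ?z = "blinfun_apply Z x"
  have "(norm ?z)\<^sup>2 / (2 * m) \<le> (norm x)\<^sup>2 + m * (norm ((1 / (2 * m)) *\<^sub>R ?z))\<^sup>2"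
    using le[of x "(1 / (2 * m)) *\<^sub>R ?z"] by (simp add: power2_norm_eq_inner[symmetric])
  also have "m * (norm ((1 / (2 * m)) *\<^sub>R ?z))\<^sup>2 = (norm ?z)\<^sup>2 / (4 * m)"
    using m by (simp add: power_mult_distrib power_divide power2_eq_square)
  finally have "(norm ?z)\<^sup>2 \<le> 4 * m * (norm x)\<^sup>2"
    using m by (simp add: field_simps)
  also have "\<dots> = (2 * sqrt m * norm x)\<^sup>2" using m by (simp add: power_mult_distrib)
  finally show "norm ?z \<le> 2 * sqrt m * norm x"
    by (rule power2_le_imp_le) (use m in simp)
qed (use m in simp)

text \<open>Polarisation with y = Q x: by symmetry 4 |y|^2 is the difference of the forms at x + y
  and x - y. Positivity discards the second, and the first is at most |x + y|^2 <= 2 |x|^2 + 2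
  |y|^2.\<close>

lemma norm_le_1_of_between:
  assumes Q: "Q \<in> bounded_ops" "adj Q = Q"
    and pos: "\<And>x. 0 \<le> inner (blinfun_apply Q x) x" and le: "\<And>x. inner (blinfun_apply Q x) x \<le> (norm x)\<^sup>2"
  shows "norm Q \<le> 1"
proof (rule norm_blinfun_bound)
  fix x
  let ?y = "blinfun_apply Q x"
  have "inner (blinfun_apply Q ?y) x = inner ?y ?y"
    using inner_adj[OF Q(1), of ?y x] Q(2) by simp
  then have "4 * inner ?y ?y = inner (blinfun_apply Q (x + ?y)) (x + ?y) - inner (blinfun_apply Q (x - ?y)) (x - ?y)"
    by (simp add: blinfun.bilinear_simps inner_add_left inner_add_right inner_diff_left inner_diff_right)
  also have "\<dots> \<le> (norm (x + ?y))\<^sup>2" using pos[of "x - ?y"] le[of "x + ?y"] by linarith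
  also have "\<dots> \<le> 2 * (norm x)\<^sup>2 + 2 * (norm ?y)\<^sup>2"
  proof -
    have "(norm (x + ?y))\<^sup>2 + (norm (x - ?y))\<^sup>2 = 2 * (norm x)\<^sup>2 + 2 * (norm ?y)\<^sup>2"
      unfolding power2_norm_eq_inner
      by (simp add: inner_add_left inner_add_right inner_diff_left inner_diff_right)
    then show ?thesis using zero_le_power2[of "norm (x - ?y)"] by linarith
  qed
  finally have "(norm ?y)\<^sup>2 \<le> (norm x)\<^sup>2" by (simp add: power2_norm_eq_inner)
  from power2_le_imp_le[OF this norm_ge_zero] show "norm ?y \<le> 1 * norm x" by simp
qed simp

section \<open>The abstract Bohr estimate\<close>

text \<open>Writing \<open>D + \<delta> = R\<^sup>2\<close>, this is the factorisation \<open>B = R Z R\<close>.\<close>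

lemma factor_through_sqrt:
  assumes B: "B \<in> bounded_ops" and R: "R \<in> bounded_ops" "S \<in> bounded_ops" "adj R = R"
      "R o\<^sub>L S = id_blinfun" "S o\<^sub>L R = id_blinfun"
    and D: "\<And>a. inner (blinfun_apply D a) a \<le> (norm (blinfun_apply R a))\<^sup>2" and m: "0 < m"
    and le: "\<And>a b. inner (blinfun_apply B a) b \<le> inner (blinfun_apply D a) a + m * inner (blinfun_apply D b) b"
  shows "\<exists>Z\<in>bounded_ops. B = R o\<^sub>L Z o\<^sub>L R \<and> norm Z \<le> 2 * sqrt m"
proof (intro bexI conjI)
  \<comment> \<open>With \<open>adj S\<close> on the left, the form of \<open>?Z\<close> at (x, y)
    is the form of \<open>B\<close> at (S x, S y). Taking the adjoint of S R = I shows that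
    \<open>adj S\<close> is cancelled by \<open>R\<close> on its left.\<close>
  let ?Z = "adj S o\<^sub>L B o\<^sub>L S"
  have "R o\<^sub>L adj S = id_blinfun" using adj_compose[OF R(2,1)] R by simp
  then have "R o\<^sub>L ?Z o\<^sub>L R = B o\<^sub>L (S o\<^sub>L R)" by (metis blinfun_compose_assoc blinfun_compose_id(2))
  then show "B = R o\<^sub>L ?Z o\<^sub>L R" using R by simp
  have RS: "blinfun_apply R (blinfun_apply S x) = x" for x
    using arg_cong[OF R(4), of "\<lambda>U. blinfun_apply U x"] by simp
  show "norm ?Z \<le> 2 * sqrt m"
  proof (rule norm_le_of_form_bound[OF _ m])
    fix x y
    have "inner (blinfun_apply ?Z x) y = inner (blinfun_apply B (blinfun_apply S x)) (blinfun_apply S y)"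
      by (simp add: inner_adj' R)
    also have "\<dots> \<le> (norm x)\<^sup>2 + m * (norm y)\<^sup>2"
      using le[of "blinfun_apply S x" "blinfun_apply S y"] D[of "blinfun_apply S x"]
        mult_left_mono[OF D[of "blinfun_apply S y"] less_imp_le[OF m]] unfolding RS by linarith
    finally show "inner (blinfun_apply ?Z x) y \<le> (norm x)\<^sup>2 + m * (norm y)\<^sup>2" .
  qed
qed (intro bounded_ops_compose bounded_ops_adj B R(2))

text \<open>Lagrange's identity. It adds the bound for the constant term to the bound for the tail
  without a loss of constants.\<close>

lemma two_dim_cauchy_schwarz:
  fixes a b c d :: real
  assumes "a\<^sup>2 + c\<^sup>2 \<le> u\<^sup>2" "b\<^sup>2 + d\<^sup>2 \<le> v\<^sup>2" "0 \<le> u" "0 \<le> v"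
  shows "a * b + c * d \<le> u * v"
proof (rule power2_le_imp_le)
  have "(a * b + c * d)\<^sup>2 + (a * d - c * b)\<^sup>2 = (a\<^sup>2 + c\<^sup>2) * (b\<^sup>2 + d\<^sup>2)"
    by (simp add: power2_eq_square algebra_simps)
  also have "\<dots> \<le> u\<^sup>2 * v\<^sup>2" by (intro mult_mono assms) auto
  finally show "(a * b + c * d)\<^sup>2 \<le> (u * v)\<^sup>2"
    using zero_le_power2[of "a * d - c * b"] unfolding power_mult_distrib by linarith
qed (use assms in simp)

text \<open>\<open>V\<close> stands for the monomials \<open>B\<^sup>p\<close> (or \<open>\<lambda>\<^sup>p\<close>), \<open>\<phi>\<close> and \<open>\<psi>\<close> for the embeddings of the
  two coefficient algebras into the operators on the full tensor product.\<close>

lemma bohr_estimate: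
  fixes A :: "('n::{finite,linorder} \<Rightarrow> nat) \<Rightarrow> 'h::complex_hilbert \<Rightarrow>\<^sub>L 'h"
    and Y :: "('n \<Rightarrow> nat) \<Rightarrow> 'k::complex_hilbert \<Rightarrow>\<^sub>L 'k"
    and V :: "('n \<Rightarrow> nat) \<Rightarrow> 't::complex_hilbert \<Rightarrow>\<^sub>L 't"
  assumes reps: "star_rep \<phi>" "star_rep \<psi>"
    and comm: "\<And>X Z. X \<in> bounded_ops \<Longrightarrow> Z \<in> bounded_ops \<Longrightarrow> \<phi> X o\<^sub>L \<psi> Z = \<psi> Z o\<^sub>L \<phi> X"
    and V_comm: "\<And>p X. X \<in> bounded_ops \<Longrightarrow> V p o\<^sub>L \<phi> X = \<phi> X o\<^sub>L V p"
    and V_0: "V (\<lambda>_. 0) = id_blinfun"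
    and V_row: "\<And>k x. (norm (\<Sum>p\<in>multi_indices k. blinfun_apply (V p) (x p)))\<^sup>2
        \<le> (\<Sum>p\<in>multi_indices k. (1 / multinomial p) * (norm (x p))\<^sup>2)"
    and A: "\<And>p. A p \<in> bounded_ops" "adj (A (\<lambda>_. 0)) = A (\<lambda>_. 0)"
    and A_pos: "\<And>h. 0 \<le> inner (blinfun_apply (A (\<lambda>_. 0)) h) h"
    and A_le: "\<And>h. inner (blinfun_apply (A (\<lambda>_. 0)) h) h \<le> (norm h)\<^sup>2"
    and A_p: "\<forall>k. \<forall>p\<in>multi_indices (Suc k). \<forall>a b. inner (blinfun_apply (A p) a) b
        \<le> inner (blinfun_apply (id_blinfun - A (\<lambda>_. 0)) a) a
          + multinomial p * inner (blinfun_apply (id_blinfun - A (\<lambda>_. 0)) b) b"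
    and Y: "\<And>p. Y p \<in> bounded_ops" "norm (Y (\<lambda>_. 0)) \<le> 1"
    and Y_col: "\<And>k x. (\<Sum>p\<in>multi_indices (Suc k). multinomial p * (norm (blinfun_apply (\<psi> (Y p)) x))\<^sup>2)
        \<le> (c k)\<^sup>2 * (norm x)\<^sup>2"
    and c: "\<And>k. 0 \<le> c k" "summable c" "suminf c \<le> 1/2"
  shows "summable (\<lambda>k. \<Sum>p\<in>multi_indices k. V p o\<^sub>L \<phi> (A p) o\<^sub>L \<psi> (Y p)) \<and>
    norm (\<Sum>k. \<Sum>p\<in>multi_indices k. V p o\<^sub>L \<phi> (A p) o\<^sub>L \<psi> (Y p)) \<le> 1"
proof -
  interpret f: star_rep \<phi> by fact
  interpret g: star_rep \<psi> by fact
  let ?A0 = "A (\<lambda>_. 0)"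
  define D where "D = id_blinfun - ?A0"
  define W where "W k = (\<Sum>p\<in>multi_indices k. V p o\<^sub>L \<phi> (A p) o\<^sub>L \<psi> (Y p))" for k
  have D: "D \<in> bounded_ops" by (simp add: D_def bounded_ops_diff A)
  have A0_sym: "cinner (blinfun_apply ?A0 x) y = cinner x (blinfun_apply ?A0 y)" for x y
    using adj[OF A(1)] A(2) by metis
  have adj_D: "adj D = D"
    by (rule adj_eqI[OF D]) (simp add: D_def blinfun.diff_left cinner_diff_left cinner_diff_right A0_sym)
  have D_form: "inner (blinfun_apply D x) x = (norm x)\<^sup>2 - inner (blinfun_apply ?A0 x) x" for x
    by (simp add: D_def blinfun.diff_left inner_diff_left power2_norm_eq_inner)
  have A0_norm: "norm ?A0 \<le> 1" by (rule norm_le_1_of_between[OF A A_pos A_le])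
  have D_norm: "norm D \<le> 1"
    using A_pos A_le by (intro norm_le_1_of_between D adj_D) (simp_all add: D_form)
  \<comment> \<open>It matters that \<open>R\<close> depends on \<delta> alone and not on k: the
    whole tail is then controlled by the same two vectors R x and R y.\<close>
  have W_factor: "\<exists>R. R \<in> bounded_ops \<and> adj R = R \<and> R o\<^sub>L R = (1 + \<delta>) *\<^sub>R id_blinfun - ?A0 \<and>
      (\<forall>k. \<exists>G. norm G \<le> 2 * c k \<and> W (Suc k) = \<phi> R o\<^sub>L G o\<^sub>L \<phi> R)" if \<delta>: "0 < \<delta>" for \<delta> :: real
  proof -
    obtain R S where R: "R \<in> bounded_ops" "S \<in> bounded_ops" "adj R = R"
      "R o\<^sub>L R = (1 + \<delta>) *\<^sub>R id_blinfun - ?A0" "R o\<^sub>L S = id_blinfun" "S o\<^sub>L R = id_blinfun"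
      using sqrt_shifted[OF A(1) A0_norm A(2) \<delta>] by blast
    have DR: "inner (blinfun_apply D a) a \<le> (norm (blinfun_apply R a))\<^sup>2" for a
    proof -
      have "(norm (blinfun_apply R a))\<^sup>2 = inner (blinfun_apply (R o\<^sub>L R) a) a"
        using inner_adj[OF R(1), of "blinfun_apply R a" a] R(3) by (simp add: power2_norm_eq_inner)
      also have "\<dots> = inner (blinfun_apply D a) a + \<delta> * (norm a)\<^sup>2"
        unfolding R(4) D_form
        by (simp add: blinfun.bilinear_simps inner_diff_left algebra_simps power2_norm_eq_inner)
      finally show ?thesis using \<delta> by simp
    qed
    have "\<exists>Z. \<forall>p\<in>multi_indices (Suc k). Z p \<in> bounded_ops \<and> A p = R o\<^sub>L Z p o\<^sub>L R \<and> norm (Z p) \<le> 2 * sqrt (multinomial p)" for k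
    proof (intro bchoice ballI)
      fix p :: "'n \<Rightarrow> nat" assume p: "p \<in> multi_indices (Suc k)"
      show "\<exists>Z. Z \<in> bounded_ops \<and> A p = R o\<^sub>L Z o\<^sub>L R \<and> norm Z \<le> 2 * sqrt (multinomial p)"
        using factor_through_sqrt[OF A(1) R(1,2,3,5,6) DR multinomial_pos A_p[rule_format, OF p, folded D_def]] by blast
    qed
    then have "\<exists>Z. \<forall>k. \<forall>p\<in>multi_indices (Suc k). Z k p \<in> bounded_ops \<and> A p = R o\<^sub>L Z k p o\<^sub>L R \<and>
        norm (Z k p) \<le> 2 * sqrt (multinomial p)"
      by (intro choice allI)
    then obtain Z where Z: "\<And>k p. p \<in> multi_indices (Suc k) \<Longrightarrow> Z k p \<in> bounded_ops"
      "\<And>k p. p \<in> multi_indices (Suc k) \<Longrightarrow> A p = R o\<^sub>L Z k p o\<^sub>L R"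
      "\<And>k p. p \<in> multi_indices (Suc k) \<Longrightarrow> norm (Z k p) \<le> 2 * sqrt (multinomial p)" by blast
    have "\<exists>G. norm G \<le> 2 * c k \<and> W (Suc k) = \<phi> R o\<^sub>L G o\<^sub>L \<phi> R" for k
    proof (intro exI conjI)
      let ?G = "\<Sum>p\<in>multi_indices (Suc k). V p o\<^sub>L \<phi> (Z k p) o\<^sub>L \<psi> (Y p)"
      \<comment> \<open>The left \<open>R\<close> passes across \<open>V p\<close> and the right one
        across \<open>\<psi> (Y p)\<close>, so both come to stand outside the sum over p.\<close>
      have "V p o\<^sub>L \<phi> (A p) o\<^sub>L \<psi> (Y p) = \<phi> R o\<^sub>L (V p o\<^sub>L \<phi> (Z k p) o\<^sub>L \<psi> (Y p)) o\<^sub>L \<phi> R"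
        if p: "p \<in> multi_indices (Suc k)" for p
      proof -
        have "\<phi> (A p) = \<phi> R o\<^sub>L \<phi> (Z k p) o\<^sub>L \<phi> R"
          by (subst Z(2)[OF p]) (simp add: f.mult bounded_ops_compose R Z(1)[OF p])
        then show ?thesis
          using V_comm[OF R(1), of p] comm[OF R(1) Y(1), of p] by (metis blinfun_compose_assoc)
      qed
      then have "W (Suc k) = (\<Sum>p\<in>multi_indices (Suc k). \<phi> R o\<^sub>L (V p o\<^sub>L \<phi> (Z k p) o\<^sub>L \<psi> (Y p)) o\<^sub>L \<phi> R)"
        unfolding W_def by (rule sum.cong[OF refl])
      then show "W (Suc k) = \<phi> R o\<^sub>L ?G o\<^sub>L \<phi> R"
        by (intro blinfun_eqI) (simp add: blinfun.sum_left blinfun.sum_right)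
      show "norm ?G \<le> 2 * c k"
      proof (rule norm_blinfun_bound)
        fix x
        have "(norm (blinfun_apply ?G x))\<^sup>2 \<le> (\<Sum>p\<in>multi_indices (Suc k).
            (1 / multinomial p) * (norm (blinfun_apply (\<phi> (Z k p)) (blinfun_apply (\<psi> (Y p)) x)))\<^sup>2)"
          using V_row[where k = "Suc k" and x = "\<lambda>p. blinfun_apply (\<phi> (Z k p)) (blinfun_apply (\<psi> (Y p)) x)"]
          by (simp add: blinfun.sum_left)
        \<comment> \<open>The factor 4 |p|!/p! from ||Z_p||^2 cancels the weight of the row bound.
          The remaining unweighted sum is enlarged, by \<open>multinomial_ge_1\<close>, to the
          weighted one that the hypothesis on \<open>Y\<close> controls.\<close>
        also have "\<dots> \<le> (\<Sum>p\<in>multi_indices (Suc k). 4 * (multinomial p * (norm (blinfun_apply (\<psi> (Y p)) x))\<^sup>2))"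
        proof (rule sum_mono)
          fix p :: "'n \<Rightarrow> nat" assume p: "p \<in> multi_indices (Suc k)"
          let ?y = "blinfun_apply (\<psi> (Y p)) x"
          have "norm (blinfun_apply (\<phi> (Z k p)) ?y) \<le> norm (\<phi> (Z k p)) * norm ?y" by (rule norm_blinfun)
          also have "\<dots> \<le> 2 * sqrt (multinomial p) * norm ?y"
            using f.norm_le[OF Z(1)[OF p]] Z(3)[OF p] by (intro mult_right_mono) auto
          finally have "(norm (blinfun_apply (\<phi> (Z k p)) ?y))\<^sup>2 \<le> (2 * sqrt (multinomial p) * norm ?y)\<^sup>2"
            by (rule power_mono) simp
          also have "\<dots> = multinomial p * (4 * (norm ?y)\<^sup>2)"
            by (simp add: power_mult_distrib less_imp_le)
          finally have "(1 / multinomial p) * (norm (blinfun_apply (\<phi> (Z k p)) ?y))\<^sup>2 \<le> 4 * (norm ?y)\<^sup>2"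
            using multinomial_pos[of p] by (simp add: field_simps)
          also have "\<dots> \<le> 4 * (multinomial p * (norm ?y)\<^sup>2)"
            using mult_right_mono[OF multinomial_ge_1[of p], of "(norm ?y)\<^sup>2"] by simp
          finally show "(1 / multinomial p) * (norm (blinfun_apply (\<phi> (Z k p)) ?y))\<^sup>2 \<le> 4 * (multinomial p * (norm ?y)\<^sup>2)" .
        qed
        also have "\<dots> \<le> (2 * c k * norm x)\<^sup>2"
          using Y_col[where k = k and x = x] by (simp add: sum_distrib_left[symmetric] power_mult_distrib)
        finally show "norm (blinfun_apply ?G x) \<le> 2 * c k * norm x"
          by (rule power2_le_imp_le) (simp add: c)
      qed (simp add: c)
    qed
    with R show ?thesis by blast
  qed
  have summ: "summable W"
  proof -
    \<comment> \<open>Convergence needs the factorisation for one value of \<delta> only, since the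
      norm of \<open>R\<close> enters just as a constant.\<close>
    obtain R where R: "\<And>k. \<exists>G. norm G \<le> 2 * c k \<and> W (Suc k) = \<phi> R o\<^sub>L G o\<^sub>L \<phi> R"
      using W_factor[of 1] by auto
    have "norm (W (Suc k)) \<le> norm (\<phi> R) * norm (\<phi> R) * 2 * c k" for k
    proof -
      obtain G where G: "norm G \<le> 2 * c k" "W (Suc k) = \<phi> R o\<^sub>L G o\<^sub>L \<phi> R" using R by blast
      have "norm (W (Suc k)) \<le> norm (\<phi> R) * norm G * norm (\<phi> R)"
        unfolding G(2) by (intro order_trans[OF norm_blinfun_compose] mult_right_mono norm_blinfun_compose) simp
      also have "\<dots> \<le> norm (\<phi> R) * (2 * c k) * norm (\<phi> R)"
        using G(1) by (intro mult_right_mono mult_left_mono) auto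
      finally show ?thesis by (simp add: mult_ac)
    qed
    then have "summable (\<lambda>k. W (Suc k))"
      by (rule summable_comparison_test'[OF summable_mult[OF c(2)], rotated])
    then show ?thesis by (simp add: summable_Suc_iff)
  qed
  have "norm (suminf W) \<le> 1 + e" if e: "0 < e" for e
  proof -
    \<comment> \<open>The final bound is 1 + 3 \<delta>: the two squared roots add up to 1 + 2
      \<delta>, and replacing A_0 by A_0 + \<delta> in the constant term costs a further
      \<delta>.\<close>
    define \<delta> where "\<delta> = e / 3"
    have \<delta>: "0 < \<delta>" using e by (simp add: \<delta>_def)
    obtain R where R: "R \<in> bounded_ops" "adj R = R" "R o\<^sub>L R = (1 + \<delta>) *\<^sub>R id_blinfun - ?A0"
      and G: "\<And>k. \<exists>G. norm G \<le> 2 * c k \<and> W (Suc k) = \<phi> R o\<^sub>L G o\<^sub>L \<phi> R"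
      using W_factor[OF \<delta>] by blast
    obtain R' where R': "R' \<in> bounded_ops" "adj R' = R'" "R' o\<^sub>L R' = (1 + \<delta>) *\<^sub>R id_blinfun - D"
      using sqrt_shifted[OF D D_norm adj_D \<delta>] by blast
    have sq: "(norm (blinfun_apply (\<phi> U) x))\<^sup>2 = inner (blinfun_apply (\<phi> (U o\<^sub>L U)) x) x"
      if "U \<in> bounded_ops" "adj U = U" for U x
      using inner_adj[OF f.bounded[OF that(1)], of "blinfun_apply (\<phi> U) x" x] f.adjoint[OF that(1)] that
      by (simp add: f.mult power2_norm_eq_inner)
    have total: "(norm (blinfun_apply (\<phi> R') x))\<^sup>2 + (norm (blinfun_apply (\<phi> R) x))\<^sup>2 = (1 + 2 * \<delta>) * (norm x)\<^sup>2" for x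
    proof -
      have "(R' o\<^sub>L R') + (R o\<^sub>L R) = (1 + \<delta>) *\<^sub>R id_blinfun + \<delta> *\<^sub>R id_blinfun"
        unfolding R R' D_def by (rule blinfun_eqI) (simp add: blinfun.bilinear_simps scaleR_left_distrib)
      then have "\<phi> (R' o\<^sub>L R') + \<phi> (R o\<^sub>L R) = \<phi> ((1 + \<delta>) *\<^sub>R id_blinfun + \<delta> *\<^sub>R id_blinfun)"
        using f.add[OF bounded_ops_compose[OF R'(1) R'(1)] bounded_ops_compose[OF R(1) R(1)]] by (simp only:)
      also have "\<dots> = (1 + \<delta>) *\<^sub>R id_blinfun + \<delta> *\<^sub>R id_blinfun"
        by (simp only: f.add f.scaleR f.id bounded_ops_scaleR bounded_ops_id)
      finally have "\<phi> (R' o\<^sub>L R') + \<phi> (R o\<^sub>L R) = (1 + \<delta>) *\<^sub>R id_blinfun + \<delta> *\<^sub>R id_blinfun" .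
      from arg_cong[OF this, of "\<lambda>U. inner (blinfun_apply U x) x"] show ?thesis
        unfolding sq[OF R'(1,2)] sq[OF R(1,2)]
        by (simp add: blinfun.bilinear_simps inner_add_left power2_norm_eq_inner algebra_simps)
    qed
    have "norm (suminf W) \<le> 1 + 3 * \<delta>"
    proof (rule norm_le_of_inner)
      fix x y
      let ?n = "\<lambda>U x. norm (blinfun_apply (\<phi> U) x)"
      have sums: "(\<lambda>k. inner (blinfun_apply (W k) x) y) sums inner (blinfun_apply (suminf W) x) y"
        by (intro bounded_linear.sums[OF bounded_linear_inner_left] bounded_linear.sums[OF blinfun.bounded_linear_left]
            summable_sums summ)
      have tail: "inner (blinfun_apply (W (Suc k)) x) y \<le> c k * (2 * ?n R x * ?n R y)" for k
      proof -
        obtain G where G: "norm G \<le> 2 * c k" "W (Suc k) = \<phi> R o\<^sub>L G o\<^sub>L \<phi> R" using G by blast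
        have "inner (blinfun_apply (W (Suc k)) x) y = inner (blinfun_apply G (blinfun_apply (\<phi> R) x)) (blinfun_apply (\<phi> R) y)"
          using inner_adj[OF f.bounded[OF R(1)]] f.adjoint[OF R(1)] R(2) by (simp add: G(2))
        also have "\<dots> \<le> norm (blinfun_apply G (blinfun_apply (\<phi> R) x)) * ?n R y" by (rule norm_cauchy_schwarz)
        also have "\<dots> \<le> 2 * c k * ?n R x * ?n R y"
          using G(1) by (intro mult_right_mono order_trans[OF norm_blinfun]) auto
        finally show ?thesis by (simp add: mult_ac)
      qed
      have "inner (blinfun_apply (suminf W) x) y = inner (blinfun_apply (W 0) x) y + (\<Sum>k. inner (blinfun_apply (W (Suc k)) x) y)"
        using suminf_split_head[OF sums_summable[OF sums]] sums_unique[OF sums] by simp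
      also have "(\<Sum>k. inner (blinfun_apply (W (Suc k)) x) y) \<le> (\<Sum>k. c k * (2 * ?n R x * ?n R y))"
        using summable_ignore_initial_segment[OF sums_summable[OF sums], of 1] by (intro suminf_le tail summable_mult2 c) simp
      also have "\<dots> = suminf c * (2 * ?n R x * ?n R y)" by (rule suminf_mult2[OF c(2), symmetric])
      \<comment> \<open>The 1/2 bounding the sum of the \<open>c k\<close> absorbs the factor 2 from
        the norm of G.\<close>
      also have "\<dots> \<le> (1/2) * (2 * ?n R x * ?n R y)" by (intro mult_right_mono c) simp
      also have "inner (blinfun_apply (W 0) x) y \<le> ?n R' x * ?n R' y + \<delta> * norm x * norm y"
      proof -
        let ?Y0 = "\<psi> (Y (\<lambda>_. 0))"
        have Y0: "norm (blinfun_apply ?Y0 z) \<le> norm z" for z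
          using order_trans[OF norm_blinfun[of ?Y0 z] mult_right_mono[OF order_trans[OF g.norm_le[OF Y(1)] Y(2)], of "norm z"]]
          by simp
        \<comment> \<open>The constant term is treated symmetrically: in R'^2 Y_0 one root is moved
          across Y_0 towards x and the other is moved to y, so that only ||Y_0|| <= 1 is left in
          between.\<close>
        have "?A0 = (R' o\<^sub>L R') - \<delta> *\<^sub>R id_blinfun"
          unfolding R'(3) D_def by (rule blinfun_eqI) (simp add: blinfun.bilinear_simps algebra_simps)
        also have "\<dots> = (R' o\<^sub>L R') + (- \<delta>) *\<^sub>R id_blinfun" by simp
        finally have "\<phi> ?A0 = \<phi> ((R' o\<^sub>L R') + (- \<delta>) *\<^sub>R id_blinfun)" by (rule arg_cong)
        also have "\<dots> = (\<phi> R' o\<^sub>L \<phi> R') + (- \<delta>) *\<^sub>R id_blinfun"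
          by (simp only: f.add f.scaleR f.mult f.id bounded_ops_compose bounded_ops_scaleR bounded_ops_id R'(1))
        finally have phi: "\<phi> ?A0 = (\<phi> R' o\<^sub>L \<phi> R') + (- \<delta>) *\<^sub>R id_blinfun" .
        have "W 0 = \<phi> ?A0 o\<^sub>L ?Y0" by (simp add: W_def V_0)
        then have "W 0 = (\<phi> R' o\<^sub>L (\<phi> R' o\<^sub>L ?Y0)) - \<delta> *\<^sub>R ?Y0"
          unfolding phi by (intro blinfun_eqI) (simp add: blinfun.bilinear_simps)
        also have "\<phi> R' o\<^sub>L ?Y0 = ?Y0 o\<^sub>L \<phi> R'" by (rule comm[OF R'(1) Y(1)])
        finally have "inner (blinfun_apply (W 0) x) y
            = inner (blinfun_apply ?Y0 (blinfun_apply (\<phi> R') x)) (blinfun_apply (\<phi> R') y) - \<delta> * inner (blinfun_apply ?Y0 x) y"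
          using inner_adj[OF f.bounded[OF R'(1)]] f.adjoint[OF R'(1)] R'(2)
          by (simp add: blinfun.bilinear_simps inner_diff_left)
        moreover have "inner (blinfun_apply ?Y0 (blinfun_apply (\<phi> R') x)) (blinfun_apply (\<phi> R') y) \<le> ?n R' x * ?n R' y"
          by (rule order_trans[OF norm_cauchy_schwarz mult_right_mono[OF Y0]]) simp
        moreover have "- inner (blinfun_apply ?Y0 x) y \<le> norm x * norm y"
          using order_trans[OF norm_cauchy_schwarz[of "- blinfun_apply ?Y0 x" y] mult_right_mono[of _ _ "norm y"]] Y0[of x]
          by simp
        from mult_left_mono[OF this, of \<delta>] \<delta> have "- (\<delta> * inner (blinfun_apply ?Y0 x) y) \<le> \<delta> * norm x * norm y"
          by (simp add: mult.assoc)
        ultimately show ?thesis by linarith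
      qed
      also have "?n R' x * ?n R' y + \<delta> * norm x * norm y + 1/2 * (2 * ?n R x * ?n R y)
          = (?n R' x * ?n R' y + ?n R x * ?n R y) + \<delta> * norm x * norm y" by simp
      also have "?n R' x * ?n R' y + ?n R x * ?n R y \<le> (sqrt (1 + 2 * \<delta>) * norm x) * (sqrt (1 + 2 * \<delta>) * norm y)"
        using \<delta> by (intro two_dim_cauchy_schwarz) (simp_all add: total power_mult_distrib)
      also have "\<dots> = (1 + 2 * \<delta>) * norm x * norm y"
      proof -
        have "sqrt (1 + 2 * \<delta>) * sqrt (1 + 2 * \<delta>) = 1 + 2 * \<delta>" using \<delta> by simp
        then show ?thesis by (metis mult.assoc mult.left_commute)
      qed
      finally show "inner (blinfun_apply (suminf W) x) y \<le> (1 + 3 * \<delta>) * norm x * norm y"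
        by (simp add: algebra_simps)
    qed (use \<delta> in simp)
    then show ?thesis by (simp add: \<delta>_def)
  qed
  then have "norm (suminf W) \<le> 1" by (rule field_le_epsilon)
  with summ show ?thesis unfolding W_def by blast
qed

section \<open>Creation operators\<close>

lemma creation_bounded_ops [simp]: "creation i \<in> bounded_ops"
proof (rule bounded_opsI)
  fix c and \<phi> :: "'a fock"
  show "blinfun_apply (creation i) (c *\<^sub>C \<phi>) = c *\<^sub>C blinfun_apply (creation i) \<phi>"
    unfolding l2_nth_inject[symmetric]
    by (rule ext) (simp add: creation_apply scaleC_l2.rep_eq split: list.splits)
qed

definition fock_unit :: "'n list \<Rightarrow> 'n fock" where
  "fock_unit w = Abs_l2 (\<lambda>v. if v = w then 1 else 0)"

lemma fock_unit_nth: "l2_nth (fock_unit w) v = (if v = w then 1 else 0)"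
proof -
  have "(\<lambda>v. (cmod (if v = w then 1 else 0))\<^sup>2) summable_on UNIV \<longleftrightarrow>
      (\<lambda>v. (cmod (if v = w then 1 else 0))\<^sup>2) summable_on {w}"
    by (rule summable_on_cong_neutral) auto
  then have "l2_nth (fock_unit w) = (\<lambda>v. if v = w then 1 else 0)"
    unfolding fock_unit_def by (intro Abs_l2_inverse) simp
  then show ?thesis by simp
qed

lemma cinner_fock_unit: "cinner \<phi> (fock_unit w) = l2_nth \<phi> w"
proof -
  have "cinner \<phi> (fock_unit w) = (\<Sum>\<^sub>\<infinity>v\<in>{w}. cinner (l2_nth \<phi> v) (l2_nth (fock_unit w) v))"
    unfolding cinner_l2.rep_eq by (rule infsum_cong_neutral) (auto simp: fock_unit_nth)
  then show ?thesis by (simp add: fock_unit_nth cinner_complex_def)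
qed

lemma creation_fock_unit: "blinfun_apply (creation i) (fock_unit w) = fock_unit (i # w)"
  unfolding l2_nth_inject[symmetric]
  by (rule ext) (auto simp: creation_apply fock_unit_nth split: list.splits)

lemma op_word_creation_fock_unit: "blinfun_apply (op_word creation \<alpha>) (fock_unit \<beta>) = fock_unit (\<alpha> @ \<beta>)"
  by (induction \<alpha>) (simp_all add: creation_fock_unit)

lemma adj_creation_nth: "l2_nth (blinfun_apply (adj (creation i)) \<phi>) w = l2_nth \<phi> (i # w)"
  by (metis cinner_fock_unit creation_fock_unit cinner_adj_left creation_bounded_ops)

text \<open>The creation operators are isometries with mutually orthogonal ranges, which makes the
  row bound an equality with constant 1.\<close>

lemma inner_creation: "inner (blinfun_apply (creation i) \<phi>) (blinfun_apply (creation j) \<psi>) =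
  (if i = j then inner \<phi> \<psi> else 0)"
proof -
  have "blinfun_apply (adj (creation j)) (blinfun_apply (creation i) \<phi>) = (if i = j then \<phi> else 0)"
    unfolding l2_nth_inject[symmetric]
    by (rule ext) (simp add: adj_creation_nth creation_apply zero_l2.rep_eq)
  then show ?thesis using inner_adj'[of "creation j" "blinfun_apply (creation i) \<phi>" \<psi>] by (simp split: if_splits)
qed

lemma creation_row:
  "(norm (\<Sum>i\<in>UNIV. blinfun_apply (creation (i::'n::finite)) (x i)))\<^sup>2 = (\<Sum>i\<in>UNIV. (norm (x i))\<^sup>2)"
  by (simp add: power2_norm_eq_inner inner_sum_left inner_sum_right inner_creation if_distrib cong: if_cong)

text \<open>For x_i = adj (T_i) y the row sums to Q y, where Q is the operator in question, while
  the squared norms add up to the form of Q at y. So |Q y|^2 <= C |Q y| |y|.\<close>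

lemma norm_sum_op_adj_le:
  fixes T :: "'i \<Rightarrow> 'a::complex_hilbert \<Rightarrow>\<^sub>L 'a"
  assumes T: "\<And>i. i \<in> F \<Longrightarrow> T i \<in> bounded_ops" and C: "0 \<le> C"
    and row: "\<And>x. (norm (\<Sum>i\<in>F. blinfun_apply (T i) (x i)))\<^sup>2 \<le> C * (\<Sum>i\<in>F. (norm (x i))\<^sup>2)"
  shows "norm (\<Sum>i\<in>F. T i o\<^sub>L adj (T i)) \<le> C"
proof (rule norm_blinfun_bound[OF C])
  fix y
  define z where "z = blinfun_apply (\<Sum>i\<in>F. T i o\<^sub>L adj (T i)) y"
  have z: "z = (\<Sum>i\<in>F. blinfun_apply (T i) (blinfun_apply (adj (T i)) y))"
    by (simp add: z_def blinfun.sum_left)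
  have "(norm z)\<^sup>2 \<le> C * (\<Sum>i\<in>F. (norm (blinfun_apply (adj (T i)) y))\<^sup>2)"
    unfolding z by (rule row)
  also have "(\<Sum>i\<in>F. (norm (blinfun_apply (adj (T i)) y))\<^sup>2) = inner z y"
    unfolding z inner_sum_left power2_norm_eq_inner by (intro sum.cong refl) (simp add: inner_adj T)
  also have "C * inner z y \<le> C * (norm z * norm y)"
    by (intro mult_left_mono norm_cauchy_schwarz C)
  finally have "norm z * norm z \<le> (C * norm y) * norm z" by (simp add: power2_eq_square mult_ac)
  then have "norm z \<le> C * norm y" using C by (cases "z = 0") auto
  then show "norm (blinfun_apply (\<Sum>i\<in>F. T i o\<^sub>L adj (T i)) y) \<le> C * norm y" by (simp add: z_def)
qed

section \<open>Creation operators on the symmetric Fock space\<close>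

lemma cinner_sym_proj: "cinner (blinfun_apply sym_proj \<phi>) \<psi> = cinner \<phi> (sym_fock_vec \<psi>)"
  using sym_proj[of \<phi> \<psi>] by (simp add: cinner_diff_left cinner_sym_fock.rep_eq)

lemma cinner_ext_left: "(\<And>y. cinner x y = cinner x' y) \<Longrightarrow> x = (x'::'a::complex_inner)"
  by (rule cinner_ext) (metis cinner_commute)

lemma norm_sym_proj_le: "norm (blinfun_apply sym_proj \<phi>) \<le> norm \<phi>"
proof -
  let ?z = "blinfun_apply sym_proj \<phi>"
  have "norm ?z * norm ?z = inner \<phi> (sym_fock_vec ?z)"
    by (simp add: inner_eq_Re_cinner cinner_sym_proj[symmetric] cinner_self power2_eq_square)
  also have "\<dots> \<le> norm \<phi> * norm ?z"
    using norm_cauchy_schwarz[of \<phi> "sym_fock_vec ?z"] by (simp add: norm_sym_fock.rep_eq)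
  finally show ?thesis by (cases "?z = 0") auto
qed

lemma sym_proj_scaleC: "blinfun_apply sym_proj (c *\<^sub>C \<phi>) = c *\<^sub>C blinfun_apply sym_proj \<phi>"
  by (rule cinner_ext_left) (simp add: cinner_sym_proj cinner_scaleC_left)

lemma sym_creation_bounded_ops [simp]: "sym_creation i \<in> bounded_ops"
  by (rule bounded_opsI)
    (simp add: sym_creation_def sym_incl.rep_eq scaleC_sym_fock.rep_eq bounded_opsD[OF creation_bounded_ops] sym_proj_scaleC)

lemma sym_creation_row:
  "(norm (\<Sum>i\<in>UNIV. blinfun_apply (sym_creation (i::'n::finite)) (x i)))\<^sup>2 \<le> 1 * (\<Sum>i\<in>UNIV. (norm (x i))\<^sup>2)"
proof -
  have "(\<Sum>i\<in>UNIV. blinfun_apply (sym_creation i) (x i)) =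
      blinfun_apply sym_proj (\<Sum>i\<in>UNIV. blinfun_apply (creation i) (sym_fock_vec (x i)))"
    by (simp add: sym_creation_def sym_incl.rep_eq blinfun.sum_right)
  then have "(norm (\<Sum>i\<in>UNIV. blinfun_apply (sym_creation i) (x i)))\<^sup>2
      \<le> (norm (\<Sum>i\<in>UNIV. blinfun_apply (creation i) (sym_fock_vec (x i))))\<^sup>2"
    using norm_sym_proj_le by (intro power_mono) auto
  then show ?thesis unfolding creation_row by (simp add: norm_sym_fock.rep_eq)
qed

text \<open>The annihilation operators commute on symmetric tensors, since \<open>\<psi>\<close> takes the same value on
  \<open>i j w\<close> and \<open>j i w\<close>.\<close>

lemma sym_creation_commute: "sym_creation i o\<^sub>L sym_creation j = sym_creation j o\<^sub>L sym_creation i"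
proof (rule blinfun_eqI, rule cinner_ext_left)
  fix \<phi> \<psi> :: "'a sym_fock"
  have step: "cinner (blinfun_apply (sym_creation i) \<phi>) \<psi>
      = cinner (sym_fock_vec \<phi>) (blinfun_apply (adj (creation i)) (sym_fock_vec \<psi>))" for i and \<phi> \<psi> :: "'a sym_fock"
    by (simp add: sym_creation_def sym_incl.rep_eq cinner_sym_proj adj)
  have "cinner (blinfun_apply (sym_creation i) (blinfun_apply (sym_creation j) \<phi>)) \<psi>
      = cinner (sym_fock_vec \<phi>) (blinfun_apply (adj (creation j)) (blinfun_apply (adj (creation i)) (sym_fock_vec \<psi>)))" for i j
  proof -
    \<comment> \<open>Annihilation preserves symmetric tensors, so the annihilated vector lies in
      the symmetric Fock space again and \<open>step\<close> can be used a second time.\<close>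
    define \<psi>' where "\<psi>' = Abs_sym_fock (blinfun_apply (adj (creation i)) (sym_fock_vec \<psi>))"
    have "sym_fock_vec \<psi>' = blinfun_apply (adj (creation i)) (sym_fock_vec \<psi>)"
      unfolding \<psi>'_def
    proof (rule Abs_sym_fock_inverse, intro CollectI allI impI)
      fix v w :: "'a list" assume "mset v = mset w"
      then have "mset (i # v) = mset (i # w)" by simp
      then show "l2_nth (blinfun_apply (adj (creation i)) (sym_fock_vec \<psi>)) v =
          l2_nth (blinfun_apply (adj (creation i)) (sym_fock_vec \<psi>)) w"
        unfolding adj_creation_nth using sym_fock_vec[of \<psi>] by blast
    qed
    then show ?thesis using step[of i "blinfun_apply (sym_creation j) \<phi>" \<psi>] step[of j \<phi> \<psi>']
      by (simp add: cinner_sym_fock.rep_eq)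
  qed
  moreover have "blinfun_apply (adj (creation j)) (blinfun_apply (adj (creation i)) (sym_fock_vec \<psi>))
      = blinfun_apply (adj (creation i)) (blinfun_apply (adj (creation j)) (sym_fock_vec \<psi>))"
    unfolding l2_nth_inject[symmetric]
  proof (rule ext)
    fix w
    have "mset (i # j # w) = mset (j # i # w)" by simp
    then show "l2_nth (blinfun_apply (adj (creation j)) (blinfun_apply (adj (creation i)) (sym_fock_vec \<psi>))) w =
        l2_nth (blinfun_apply (adj (creation i)) (blinfun_apply (adj (creation j)) (sym_fock_vec \<psi>))) w"
      unfolding adj_creation_nth using sym_fock_vec[of \<psi>] by blast
  qed
  ultimately show "cinner (blinfun_apply (sym_creation i o\<^sub>L sym_creation j) \<phi>) \<psi>
      = cinner (blinfun_apply (sym_creation j o\<^sub>L sym_creation i) \<phi>) \<psi>" by simp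
qed

section \<open>The positivity inequality for the coefficients\<close>

text \<open>Complex polarisation. The defect \<open>s\<close> is sesquilinear and vanishes on the
  diagonal because the form of \<open>T\<close> is real. Testing x + y shows that \<open>s\<close>
  is antisymmetric, testing x + \<i> y that it is symmetric, hence it is 0.\<close>

lemma op_nonneg_adj:
  assumes T: "T \<in> bounded_ops" and pos: "op_nonneg T"
  shows "adj T = T"
proof (rule adj_eqI[OF T])
  fix x y
  define s where "s u v = cinner (blinfun_apply T u) v - cinner u (blinfun_apply T v)" for u v
  have add: "s (u + u') v = s u v + s u' v" "s u (v + v') = s u v + s u v'" for u u' v v'
    by (simp_all add: s_def blinfun.add_right cinner_add_left cinner_add_right)
  have scale: "s (\<i> *\<^sub>C u) v = \<i> * s u v" "s u (\<i> *\<^sub>C v) = - \<i> * s u v" for u v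
    by (simp_all add: s_def bounded_opsD[OF T] cinner_scaleC_left cinner_scaleC_right algebra_simps)
  have diag: "s u u = 0" for u
  proof -
    have "cinner (blinfun_apply T u) u \<in> \<real>" using pos by (simp add: op_nonneg_def)
    then have "cnj (cinner (blinfun_apply T u) u) = cinner (blinfun_apply T u) u"
      by (simp add: Reals_cnj_iff)
    then show ?thesis by (metis s_def cinner_commute diff_self)
  qed
  have "s (x + y) (x + y) = s x y + s y x" unfolding add by (simp add: diag)
  then have "s x y + s y x = 0" unfolding diag by simp
  moreover have "s (x + \<i> *\<^sub>C y) (x + \<i> *\<^sub>C y) = - \<i> * s x y + \<i> * s y x"
    unfolding add scale by (simp add: diag)
  then have "- \<i> * s x y + \<i> * s y x = 0" unfolding diag by simp
  then have "\<i> * (s y x - s x y) = 0" by (simp add: algebra_simps)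
  then have "s y x = s x y" by simp
  ultimately have "s x y = 0" by simp
  then show "cinner (blinfun_apply T x) y = cinner x (blinfun_apply T y)" by (simp add: s_def)
qed

section \<open>Homogeneous parts of \<open>f_sym\<close> and convergence of its series\<close>

definition f_sym_part :: "(('n::finite \<Rightarrow> nat) \<Rightarrow> 'h::complex_hilbert \<Rightarrow>\<^sub>L 'h) \<Rightarrow> nat \<Rightarrow>
    ('n fock, 'h) tensor \<Rightarrow>\<^sub>L ('n fock, 'h) tensor" where
  "f_sym_part A k = (\<Sum>p\<in>multi_indices k. sym_monomial p \<otimes>\<^sub>o A p)"

lemma f_sym_eq: "f_sym A r = (\<Sum>k. r ^ k *\<^sub>R f_sym_part A k)"
  by (simp add: f_sym_def f_sym_part_def scaleR_sum_right)

lemma sym_monomial_bounded_ops: "sym_monomial p \<in> bounded_ops"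
  unfolding sym_monomial_def by (intro bounded_ops_scaleR bounded_ops_sum op_word_bounded_ops) simp

lemma f_sym_part_bounded_ops: "(\<And>p. A p \<in> bounded_ops) \<Longrightarrow> f_sym_part A k \<in> bounded_ops"
  unfolding f_sym_part_def by (intro bounded_ops_sum tensor_op sym_monomial_bounded_ops)

lemma tensor_vec_sum_left: "(\<Sum>i\<in>F. x i) \<otimes>\<^sub>v y = (\<Sum>i\<in>F. x i \<otimes>\<^sub>v y)"
  by (induction F rule: infinite_finite_induct) (simp_all add: tensor_vec_linear)

lemma sym_monomial_tensor:
  assumes B: "B \<in> bounded_ops"
  shows "sym_monomial p \<otimes>\<^sub>o B = (1 / multinomial p) *\<^sub>R (\<Sum>\<alpha>\<in>words_of p. op_word creation \<alpha> \<otimes>\<^sub>o B)"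
  by (rule tensor_op_eqI[OF sym_monomial_bounded_ops B])
    (simp add: B op_word_bounded_ops tensor_op sym_monomial_def
      blinfun.sum_left blinfun.scaleR_left tensor_vec_scaleR tensor_vec_sum_left)

text \<open>This links the limsup hypothesis to the convergence of \<open>f_sym\<close>. The row
  bound for the S_\<alpha> yields the weights p!/|p|!; passing to the larger |p|!/p! matches the
  form of the hypothesis.\<close>

lemma norm_f_sym_part_le:
  fixes A :: "('n::{finite,linorder} \<Rightarrow> nat) \<Rightarrow> 'h::complex_hilbert \<Rightarrow>\<^sub>L 'h"
  assumes A: "\<And>p. A p \<in> bounded_ops"
  shows "norm (f_sym_part A k) \<le> sqrt (norm (\<Sum>p\<in>multi_indices k. multinomial p *\<^sub>R (adj (A p) o\<^sub>L A p)))"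
    (is "_ \<le> sqrt ?c")
proof (rule norm_blinfun_bound)
  fix x :: "('n fock, 'h) tensor"
  interpret l: star_rep "\<lambda>T. (T :: 'n fock \<Rightarrow>\<^sub>L 'n fock) \<otimes>\<^sub>o (id_blinfun :: 'h \<Rightarrow>\<^sub>L 'h)" by (rule star_rep_left)
  interpret r: star_rep "\<lambda>T. (id_blinfun :: 'n fock \<Rightarrow>\<^sub>L 'n fock) \<otimes>\<^sub>o (T :: 'h \<Rightarrow>\<^sub>L 'h)" by (rule star_rep_right)
  let ?T = "\<lambda>i::'n. creation i \<otimes>\<^sub>o (id_blinfun :: 'h \<Rightarrow>\<^sub>L 'h)"
  let ?x = "\<lambda>p. blinfun_apply (id_blinfun \<otimes>\<^sub>o A p) x"
  have "norm (\<Sum>i\<in>(UNIV::'n set). creation i o\<^sub>L adj (creation i)) \<le> 1"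
    by (rule norm_sum_op_adj_le) (simp_all add: creation_row)
  then have row: "(norm (\<Sum>i\<in>UNIV. blinfun_apply (?T i) (y i)))\<^sup>2 \<le> 1 * (\<Sum>i\<in>UNIV. (norm (y i))\<^sup>2)"
    for y :: "'n \<Rightarrow> ('n fock, 'h) tensor"
    by (intro order_trans[OF l.norm_sum_row_le mult_right_mono]) (auto intro: sum_nonneg)
  have "blinfun_apply (sym_monomial p \<otimes>\<^sub>o A p) x =
      (1 / multinomial p) *\<^sub>R (\<Sum>\<alpha>\<in>words_of p. blinfun_apply (op_word ?T \<alpha>) (?x p))" for p
  proof -
    have "op_word creation \<alpha> \<otimes>\<^sub>o A p = op_word ?T \<alpha> o\<^sub>L (id_blinfun \<otimes>\<^sub>o A p)" for \<alpha>
      by (simp add: l.op_word tensor_op_compose op_word_bounded_ops A)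
    then show ?thesis
      by (simp add: sym_monomial_tensor[OF A] blinfun.scaleR_left blinfun.sum_left)
  qed
  then have "(norm (blinfun_apply (f_sym_part A k) x))\<^sup>2
      = (norm (\<Sum>p\<in>multi_indices k. (1 / multinomial p) *\<^sub>R (\<Sum>\<alpha>\<in>words_of p. blinfun_apply (op_word ?T \<alpha>) (?x p))))\<^sup>2"
    by (simp add: f_sym_part_def blinfun.sum_left)
  also have "\<dots> \<le> 1 ^ k * (\<Sum>p\<in>multi_indices k. (1 / multinomial p) * (norm (?x p))\<^sup>2)"
    by (rule row_bound_count[OF row]) simp
  also have "\<dots> \<le> (\<Sum>p\<in>multi_indices k. multinomial p * (norm (?x p))\<^sup>2)"
    unfolding power_one mult_1
  proof (intro sum_mono mult_right_mono)
    fix p :: "'n \<Rightarrow> nat"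
    have "1 / multinomial p \<le> 1" using multinomial_ge_1[of p] by simp
    then show "1 / multinomial p \<le> multinomial p" using multinomial_ge_1[of p] by linarith
  qed simp
  also have "\<dots> \<le> ?c * (norm x)\<^sup>2" by (rule r.sum_norm_sq_le[OF A])
  also have "\<dots> = (sqrt ?c * norm x)\<^sup>2" by (simp add: power_mult_distrib)
  finally show "norm (blinfun_apply (f_sym_part A k) x) \<le> sqrt ?c * norm x"
    by (rule power2_le_imp_le) simp
qed simp

text \<open>Root test. For k > 0 the k-th power of \<open>a k powr (1 / (2 * real k))\<close> is
  \<open>sqrt (a k)\<close>, and any \<rho> strictly between r and 1 leaves the geometric majorant
  (r / \<rho>)^k for large k. At k = 0 the exponent involves a division by zero, so this index is
  excluded.\<close>

lemma summable_of_limsup_root: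
  fixes a :: "nat \<Rightarrow> real"
  assumes a: "\<And>k. 0 \<le> a k" and lim: "limsup (\<lambda>k. ereal (a k powr (1 / (2 * real k)))) \<le> 1"
    and r: "0 \<le> r" "r < 1"
  shows "summable (\<lambda>k. r ^ k * sqrt (a k))"
proof -
  obtain \<rho> where \<rho>: "r < \<rho>" "\<rho> < 1" using dense[OF r(2)] by blast
  have "limsup (\<lambda>k. ereal (a k powr (1 / (2 * real k)))) < ereal (1 / \<rho>)"
    using \<rho> r by (intro order.strict_trans1[OF lim]) simp
  then have "\<forall>\<^sub>F k in sequentially. ereal (a k powr (1 / (2 * real k))) < ereal (1 / \<rho>)"
    by (rule Limsup_lessD)
  then have ev: "\<forall>\<^sub>F k in sequentially. norm (r ^ k * sqrt (a k)) \<le> (r / \<rho>) ^ k"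
    using eventually_gt_at_top[of 0]
  proof eventually_elim
    case (elim k)
    have "sqrt (a k) = (a k powr (1 / (2 * real k))) ^ k"
    proof (cases "a k = 0")
      case False
      then have "(a k powr (1 / (2 * real k))) ^ k = a k powr (real k * (1 / (2 * real k)))"
        using a[of k] by (simp add: powr_power)
      also have "\<dots> = a k powr (1 / 2)" using elim(2) by simp
      finally show ?thesis using a[of k] by (simp add: powr_half_sqrt)
    qed (use elim(2) in simp)
    also have "\<dots> \<le> (1 / \<rho>) ^ k" using elim(1) by (intro power_mono) auto
    finally have "r ^ k * sqrt (a k) \<le> r ^ k * (1 / \<rho>) ^ k"
      using r by (intro mult_left_mono) auto
    then show ?case using r a[of k] by (simp add: power_divide)
  qed
  have "summable (\<lambda>k. (r / \<rho>) ^ k)" using r \<rho> by (intro summable_geometric) simp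
  then show ?thesis by (rule summable_comparison_test_ev[OF ev])
qed

lemma inner_unit_tensor:
  "inner (fock_unit v \<otimes>\<^sub>v a) (fock_unit w \<otimes>\<^sub>v b) = (if v = w then inner a b else 0)"
  by (simp add: inner_eq_Re_cinner cinner_tensor_vec cinner_fock_unit fock_unit_nth)

text \<open>S_\<alpha> sends e_\<beta> to e_{\<alpha>\<beta>}, so orthonormality keeps exactly the
  pairs (\<beta>, \<gamma>) with \<gamma> = \<alpha>\<beta>.\<close>

lemma inner_f_sym_part:
  fixes A :: "('n::{finite,linorder} \<Rightarrow> nat) \<Rightarrow> 'h::complex_hilbert \<Rightarrow>\<^sub>L 'h"
  assumes A: "\<And>p. A p \<in> bounded_ops"
  defines "u \<equiv> \<lambda>y W. \<Sum>\<beta>\<in>W. fock_unit \<beta> \<otimes>\<^sub>v y \<beta>"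
  shows "inner (blinfun_apply (f_sym_part A j) (u y W)) (u y W) = (\<Sum>\<alpha>\<in>words j. (1 / multinomial (count_list \<alpha>)) *
    (\<Sum>\<beta>\<in>W. \<Sum>\<gamma>\<in>W. if \<alpha> @ \<beta> = \<gamma> then inner (blinfun_apply (A (count_list \<alpha>)) (y \<beta>)) (y \<gamma>) else 0))"
proof -
  have "inner (blinfun_apply (sym_monomial p \<otimes>\<^sub>o A p) (u y W)) (u y W) =
      (\<Sum>\<alpha>\<in>words_of p. (1 / multinomial (count_list \<alpha>)) *
      (\<Sum>\<beta>\<in>W. \<Sum>\<gamma>\<in>W. if \<alpha> @ \<beta> = \<gamma> then inner (blinfun_apply (A (count_list \<alpha>)) (y \<beta>)) (y \<gamma>) else 0))" for p
  proof -
    have "blinfun_apply (op_word creation \<alpha> \<otimes>\<^sub>o A p) (u y W) =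
        (\<Sum>\<beta>\<in>W. fock_unit (\<alpha> @ \<beta>) \<otimes>\<^sub>v blinfun_apply (A p) (y \<beta>))" for \<alpha>
      by (simp add: u_def blinfun.sum_right tensor_op op_word_bounded_ops A op_word_creation_fock_unit)
    then have "inner (blinfun_apply (op_word creation \<alpha> \<otimes>\<^sub>o A p) (u y W)) (u y W) = (\<Sum>\<beta>\<in>W. \<Sum>\<gamma>\<in>W.
        inner (fock_unit (\<alpha> @ \<beta>) \<otimes>\<^sub>v blinfun_apply (A p) (y \<beta>)) (fock_unit \<gamma> \<otimes>\<^sub>v y \<gamma>))" for \<alpha>
      by (simp only: inner_sum_left) (simp add: u_def inner_sum_right)
    then have "inner (blinfun_apply (sym_monomial p \<otimes>\<^sub>o A p) (u y W)) (u y W) =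
      (\<Sum>\<alpha>\<in>words_of p. (1 / multinomial p) *
      (\<Sum>\<beta>\<in>W. \<Sum>\<gamma>\<in>W. inner (fock_unit (\<alpha> @ \<beta>) \<otimes>\<^sub>v blinfun_apply (A p) (y \<beta>)) (fock_unit \<gamma> \<otimes>\<^sub>v y \<gamma>)))"
      by (simp add: sym_monomial_tensor[OF A] blinfun.scaleR_left blinfun.sum_left inner_sum_left sum_divide_distrib)
    also have "\<dots> = (\<Sum>\<alpha>\<in>words_of p. (1 / multinomial (count_list \<alpha>)) *
      (\<Sum>\<beta>\<in>W. \<Sum>\<gamma>\<in>W. if \<alpha> @ \<beta> = \<gamma> then inner (blinfun_apply (A (count_list \<alpha>)) (y \<beta>)) (y \<gamma>) else 0))"
      unfolding inner_unit_tensor by (rule sum.cong[OF refl]) (auto simp: words_of_eq)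
    finally show ?thesis .
  qed
  then show ?thesis unfolding sum_words f_sym_part_def by (simp add: blinfun.sum_left inner_sum_left)
qed

lemma count_list_Nil_fun: "count_list [] = (\<lambda>_. 0)"
  by (rule ext) simp

lemma coefficient_positivity:
  fixes A :: "('n::{finite,linorder} \<Rightarrow> nat) \<Rightarrow> 'h::complex_hilbert \<Rightarrow>\<^sub>L 'h"
  assumes A: "\<And>p. A p \<in> bounded_ops"
    and limsup_A: "limsup (\<lambda>k. ereal (norm (\<Sum>p\<in>multi_indices k. multinomial p *\<^sub>R (adj (A p) o\<^sub>L A p))
      powr (1 / (2 * real k)))) \<le> 1"
    and Re_f_sym: "\<And>r. 0 \<le> r \<Longrightarrow> r < 1 \<Longrightarrow> op_le (re_part (f_sym A r)) id_blinfun"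
  defines "D \<equiv> id_blinfun - A (\<lambda>_. 0)"
  shows "(\<Sum>p\<in>multi_indices (Suc k). inner (blinfun_apply (A p) h) (g p)) \<le> inner (blinfun_apply D h) h +
    (\<Sum>p\<in>multi_indices (Suc k). multinomial p * inner (blinfun_apply D (g p)) (g p))" (is "?t \<le> ?d")
proof -
  \<comment> \<open>Prepending a word of length j to a member of \<open>W\<close> stays in
    \<open>W\<close> only if j = 0, or if j = k + 1 and that member is the empty word. So exactly
    two homogeneous parts see the test vector. Its entries depend on letter counts only, which
    brings in the weights.\<close>
  define W where "W = insert [] (words (Suc k) :: 'n list set)"
  define y where "y = (\<lambda>\<beta>. if \<beta> = [] then h else g (count_list \<beta>))"
  define x where "x = (\<Sum>\<beta>\<in>W. fock_unit \<beta> \<otimes>\<^sub>v y \<beta>)"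
  have Nil: "[] \<notin> (words (Suc k) :: 'n list set)" by (simp add: words_def)
  have sum_W: "(\<Sum>\<beta>\<in>W. \<phi> (y \<beta>)) = \<phi> h + (\<Sum>p\<in>multi_indices (Suc k). multinomial p * \<phi> (g p))"
    for \<phi> :: "'h \<Rightarrow> real"
  proof -
    have "(\<Sum>\<beta>\<in>W. \<phi> (y \<beta>)) = \<phi> h + (\<Sum>\<beta>\<in>words (Suc k). \<phi> (y \<beta>))"
      unfolding W_def using Nil by (subst sum.insert) (auto simp: y_def)
    also have "(\<Sum>\<beta>\<in>words (Suc k). \<phi> (y \<beta>)) = (\<Sum>\<beta>\<in>words (Suc k). \<phi> (g (count_list \<beta>)))"
      using Nil by (intro sum.cong refl) (auto simp: y_def)
    finally show ?thesis by (simp add: sum_words_count[where G = "\<lambda>p. \<phi> (g p)"])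
  qed
  have finW: "finite W" by (simp add: W_def)
  have inner_W: "(\<Sum>\<gamma>\<in>W. if \<delta> = \<gamma> then F \<gamma> else 0) = (if \<delta> \<in> W then F \<delta> else 0)" for \<delta> and F :: "'n list \<Rightarrow> real"
    using finW by simp
  have norm_x: "(norm x)\<^sup>2 = (norm h)\<^sup>2 + (\<Sum>p\<in>multi_indices (Suc k). multinomial p * (norm (g p))\<^sup>2)"
  proof -
    have "(norm x)\<^sup>2 = (\<Sum>\<beta>\<in>W. \<Sum>\<gamma>\<in>W. if \<beta> = \<gamma> then inner (y \<beta>) (y \<gamma>) else 0)"
      unfolding power2_norm_eq_inner x_def inner_sum_left unfolding inner_sum_right inner_unit_tensor ..
    also have "\<dots> = (\<Sum>\<beta>\<in>W. (norm (y \<beta>))\<^sup>2)"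
      unfolding inner_W by (simp add: power2_norm_eq_inner)
    finally show ?thesis by (simp only: sum_W[of "\<lambda>z. (norm z)\<^sup>2"])
  qed
  define a where "a = (\<lambda>h. inner (blinfun_apply (A (\<lambda>_. 0)) h) h)"
  have part: "inner (blinfun_apply (f_sym_part A j) x) x = (if j = 0 then \<Sum>\<beta>\<in>W. a (y \<beta>)
      else if j = Suc k then ?t else 0)" for j
  proof -
    have "inner (blinfun_apply (f_sym_part A j) x) x = (\<Sum>\<alpha>\<in>words j. (1 / multinomial (count_list \<alpha>)) *
      (\<Sum>\<beta>\<in>W. if \<alpha> @ \<beta> \<in> W then inner (blinfun_apply (A (count_list \<alpha>)) (y \<beta>)) (y (\<alpha> @ \<beta>)) else 0))"
      unfolding x_def inner_f_sym_part[OF A] inner_W ..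
    also have "\<dots> = (if j = 0 then \<Sum>\<beta>\<in>W. a (y \<beta>) else if j = Suc k then ?t else 0)"
    proof (cases "j = 0 \<or> j = Suc k")
      case False
      have "(\<Sum>\<beta>\<in>W. if \<alpha> @ \<beta> \<in> W then inner (blinfun_apply (A (count_list \<alpha>)) (y \<beta>)) (y (\<alpha> @ \<beta>)) else 0) = 0"
        if "\<alpha> \<in> words j" for \<alpha>
        using that False by (intro sum.neutral) (auto simp: W_def words_def)
      then show ?thesis using False by simp
    next
      case True
      then show ?thesis
      proof
        assume "j = 0"
        then show ?thesis by (simp add: a_def count_list_Nil_fun)
      next
        assume j: "j = Suc k"
        have "(\<Sum>\<beta>\<in>W. if \<alpha> @ \<beta> \<in> W then inner (blinfun_apply (A (count_list \<alpha>)) (y \<beta>)) (y (\<alpha> @ \<beta>)) else 0)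
            = inner (blinfun_apply (A (count_list \<alpha>)) h) (g (count_list \<alpha>))" if \<alpha>: "\<alpha> \<in> words (Suc k)" for \<alpha>
        proof -
          have "\<alpha> @ \<beta> \<in> W \<longleftrightarrow> \<beta> = []" if "\<beta> \<in> W" for \<beta>
            using that \<alpha> by (auto simp: W_def words_def)
          then have "(\<Sum>\<beta>\<in>W. if \<alpha> @ \<beta> \<in> W then inner (blinfun_apply (A (count_list \<alpha>)) (y \<beta>)) (y (\<alpha> @ \<beta>)) else 0)
              = (\<Sum>\<beta>\<in>W. if [] = \<beta> then inner (blinfun_apply (A (count_list \<alpha>)) (y \<beta>)) (y (\<alpha> @ \<beta>)) else 0)"
            by (intro sum.cong refl) auto
          also have "\<dots> = inner (blinfun_apply (A (count_list \<alpha>)) (y [])) (y \<alpha>)"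
            unfolding inner_W by (simp add: W_def)
          finally show ?thesis using \<alpha> Nil by (auto simp: y_def)
        qed
        then have "(\<Sum>\<alpha>\<in>words j. (1 / multinomial (count_list \<alpha>)) *
            (\<Sum>\<beta>\<in>W. if \<alpha> @ \<beta> \<in> W then inner (blinfun_apply (A (count_list \<alpha>)) (y \<beta>)) (y (\<alpha> @ \<beta>)) else 0))
            = (\<Sum>\<alpha>\<in>words (Suc k). (\<lambda>p. (1 / multinomial p) * inner (blinfun_apply (A p) h) (g p)) (count_list \<alpha>))"
          unfolding j by (intro sum.cong refl) simp
        \<comment> \<open>The normalisation 1 / \<open>multinomial p\<close> of the symmetrised
          monomial cancels the number of words with counts p, so \<open>?t\<close> carries no
          weight.\<close>
        also have "\<dots> = ?t"
          using sum_words_count[where k = "Suc k" and G = "\<lambda>p. (1 / multinomial p) * inner (blinfun_apply (A p) h) (g p)"]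
          by simp
        finally show ?thesis using j by simp
      qed
    qed
    finally show ?thesis .
  qed
  have bound: "r ^ Suc k * ?t \<le> ?d" if r: "0 \<le> r" "r < 1" for r
  proof -
    have "summable (\<lambda>j. r ^ j * sqrt (norm (\<Sum>p\<in>multi_indices j. multinomial p *\<^sub>R (adj (A p) o\<^sub>L A p))))"
      by (rule summable_of_limsup_root[OF _ limsup_A r]) simp
    then have "summable (\<lambda>j. r ^ j *\<^sub>R f_sym_part A j)"
      by (rule summable_comparison_test'[where N = 0])
        (use r norm_f_sym_part_le[of A, OF A] in \<open>simp add: mult_left_mono\<close>)
    then have sums: "(\<lambda>j. r ^ j *\<^sub>R f_sym_part A j) sums f_sym A r"
      unfolding f_sym_eq by (rule summable_sums)
    have F: "f_sym A r \<in> bounded_ops"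
      by (rule bounded_ops_limit[OF _ sums[unfolded sums_def]])
        (intro bounded_ops_sum bounded_ops_scaleR f_sym_part_bounded_ops A)
    have "(\<lambda>j. inner (blinfun_apply (r ^ j *\<^sub>R f_sym_part A j) x) x) sums inner (blinfun_apply (f_sym A r) x) x"
      by (intro bounded_linear.sums[OF bounded_linear_inner_left] bounded_linear.sums[OF blinfun.bounded_linear_left] sums)
    moreover have "(\<lambda>j. inner (blinfun_apply (r ^ j *\<^sub>R f_sym_part A j) x) x) sums
        (\<Sum>j\<in>{0, Suc k}. inner (blinfun_apply (r ^ j *\<^sub>R f_sym_part A j) x) x)"
      by (rule sums_finite) (simp_all add: blinfun.scaleR_left part)
    ultimately have f: "inner (blinfun_apply (f_sym A r) x) x = (\<Sum>\<beta>\<in>W. a (y \<beta>)) + r ^ Suc k * ?t"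
      using sums_unique2 by (fastforce simp: blinfun.scaleR_left part)
    have "0 \<le> inner (blinfun_apply (id_blinfun - re_part (f_sym A r)) x) x"
      using Re_f_sym[OF r] by (simp add: op_le_def op_nonneg_def inner_eq_Re_cinner)
    also have "inner (blinfun_apply (id_blinfun - re_part (f_sym A r)) x) x = (norm x)\<^sup>2 - inner (blinfun_apply (f_sym A r) x) x"
      using inner_adj'[OF F, of x x] inner_commute[of x "blinfun_apply (f_sym A r) x"]
      by (simp add: re_part_def blinfun.bilinear_simps inner_diff_left inner_add_left power2_norm_eq_inner)
    finally have "r ^ Suc k * ?t \<le> (norm x)\<^sup>2 - (\<Sum>\<beta>\<in>W. a (y \<beta>))" unfolding f by linarith
    also have "\<dots> = ?d"
      unfolding norm_x sum_W D_def
      by (simp add: blinfun.diff_left inner_diff_left a_def power2_norm_eq_inner right_diff_distrib sum_subtractf)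
    finally show ?thesis .
  qed
  \<comment> \<open>The bound \<open>?d\<close> is independent of r and the left side is a single
    power of r times a constant, so the inequality extends to r = 1 by continuity.\<close>
  have "((\<lambda>r. r ^ Suc k * ?t) \<longlongrightarrow> 1 ^ Suc k * ?t) (at_left 1)"
    by (intro tendsto_intros)
  moreover have "\<forall>\<^sub>F r in at_left 1. r ^ Suc k * ?t \<le> ?d"
  proof (rule eventually_mono)
    show "\<forall>\<^sub>F r :: real in at_left 1. r \<in> {0<..<1}" by (rule eventually_at_left_real) simp
    show "r ^ Suc k * ?t \<le> ?d" if "r \<in> {0<..<1}" for r
      using that by (intro bound) simp_all
  qed
  ultimately have "1 ^ Suc k * ?t \<le> ?d" by (rule tendsto_upperbound) simp
  then show ?thesis by simp
qed

section \<open>Coefficient bounds and the Bohr inequalities\<close>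

lemma ampliated_row_bound:
  fixes T :: "'n::{finite,linorder} \<Rightarrow> 'k::complex_hilbert \<Rightarrow>\<^sub>L 'k"
  assumes T: "\<And>i. T i \<in> bounded_ops" and comm: "\<And>i j. T i o\<^sub>L T j = T j o\<^sub>L T i"
    and C: "norm (\<Sum>i\<in>UNIV. T i o\<^sub>L adj (T i)) \<le> C"
  shows "(norm (\<Sum>p\<in>multi_indices k. blinfun_apply (op_monomial T p \<otimes>\<^sub>o (id_blinfun :: 'h::complex_hilbert \<Rightarrow>\<^sub>L 'h)) (x p)))\<^sup>2
    \<le> C ^ k * (\<Sum>p\<in>multi_indices k. (1 / multinomial p) * (norm (x p))\<^sup>2)"
proof -
  interpret l: star_rep "\<lambda>T. (T :: 'k \<Rightarrow>\<^sub>L 'k) \<otimes>\<^sub>o (id_blinfun :: 'h \<Rightarrow>\<^sub>L 'h)" by (rule star_rep_left)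
  have row: "(norm (\<Sum>i\<in>UNIV. blinfun_apply (T i \<otimes>\<^sub>o (id_blinfun :: 'h \<Rightarrow>\<^sub>L 'h)) (y i)))\<^sup>2 \<le> C * (\<Sum>i\<in>UNIV. (norm (y i))\<^sup>2)" for y
    by (intro order_trans[OF l.norm_sum_row_le mult_right_mono] C T) (auto intro: sum_nonneg)
  have C0: "0 \<le> C" by (rule order_trans[OF norm_ge_zero C])
  have comm': "(T i \<otimes>\<^sub>o (id_blinfun :: 'h \<Rightarrow>\<^sub>L 'h)) o\<^sub>L (T j \<otimes>\<^sub>o id_blinfun) = (T j \<otimes>\<^sub>o id_blinfun) o\<^sub>L (T i \<otimes>\<^sub>o id_blinfun)" for i j
    using comm[of i j] by (simp add: tensor_op_compose T)
  show ?thesis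
    using row_bound_monomial[OF row C0 comm', where k = k and x = x] unfolding l.op_monomial[OF T] .
qed

lemma norm_sym_creation_row_le: "norm (\<Sum>i\<in>(UNIV::'n::finite set). sym_creation i o\<^sub>L adj (sym_creation i)) \<le> 1"
  by (rule norm_sum_op_adj_le[OF _ _ sym_creation_row]) simp_all

lemma norm_column_monomial_le:
  fixes Y :: "'n::{finite,linorder} \<Rightarrow> 'k::complex_hilbert \<Rightarrow>\<^sub>L 'k"
  assumes Y: "\<And>i. Y i \<in> bounded_ops" and comm: "\<And>i j. Y i o\<^sub>L Y j = Y j o\<^sub>L Y i"
    and C: "norm (\<Sum>i\<in>UNIV. adj (Y i) o\<^sub>L Y i) \<le> C"
  shows "norm (\<Sum>p\<in>multi_indices k. multinomial p *\<^sub>R (adj (op_monomial Y p) o\<^sub>L op_monomial Y p)) \<le> C ^ k"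
proof -
  have C0: "0 \<le> C" by (rule order_trans[OF norm_ge_zero C])
  have col: "(\<Sum>i\<in>UNIV. (norm (blinfun_apply (Y i) x))\<^sup>2) \<le> C * (norm x)\<^sup>2" for x
    using sum_norm_sq_le_norm_sum_adj[of UNIV Y "\<lambda>_. 1" x] Y mult_right_mono[OF C, of "(norm x)\<^sup>2"] by simp
  show ?thesis
    by (rule norm_sum_adj_le[OF _ _ _ column_bound_monomial[OF col C0 comm]])
      (simp_all add: op_monomial_bounded_ops Y C0 less_imp_le)
qed

lemma monomial_zero: "monomial 0 p = (if p = (\<lambda>_. 0) then 1 else 0)"
proof (cases "p = (\<lambda>_. 0)")
  case False
  then obtain i where "p i \<noteq> 0" by (auto simp: fun_eq_iff)
  then have "monomial 0 p = 0" unfolding monomial_def by (intro prod_zero) auto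
  then show ?thesis using False by simp
qed (simp add: monomial_def)

lemma op_monomial_zero: "op_monomial (T :: 'n::{finite,linorder} \<Rightarrow> 'k::complex_hilbert \<Rightarrow>\<^sub>L 'k) (\<lambda>_. 0) = id_blinfun"
proof -
  have "canonical_word (\<lambda>_::'n. 0) = []"
    using sum_count_list[of "canonical_word (\<lambda>_::'n. 0)"] by (simp add: count_list_canonical_word)
  then show ?thesis by (simp add: op_monomial_eq)
qed

text \<open>A point of the ball makes the operators z_i I a row contraction. Evaluation at z in
  (iii) is then the same estimate with z_i I in place of B_i.\<close>

lemma scalar_row:
  fixes z :: "(complex, 'n::finite) vec" and x :: "'n \<Rightarrow> 't::complex_normed_vector"
  assumes z: "norm z \<le> 1"
  shows "(norm (\<Sum>i\<in>UNIV. (z $ i) *\<^sub>C x i))\<^sup>2 \<le> 1 * (\<Sum>i\<in>UNIV. (norm (x i))\<^sup>2)"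
proof -
  have "norm (\<Sum>i\<in>UNIV. (z $ i) *\<^sub>C x i) \<le> (\<Sum>i\<in>UNIV. \<bar>norm (z $ i)\<bar> * \<bar>norm (x i)\<bar>)"
    by (rule order_trans[OF norm_sum]) (simp add: norm_scaleC)
  also have "\<dots> \<le> L2_set (\<lambda>i. norm (z $ i)) UNIV * L2_set (\<lambda>i. norm (x i)) UNIV"
    by (rule L2_set_mult_ineq)
  also have "\<dots> \<le> 1 * L2_set (\<lambda>i. norm (x i)) UNIV"
    using z by (intro mult_right_mono) (auto simp: norm_vec_def L2_set_nonneg)
  finally have "(norm (\<Sum>i\<in>UNIV. (z $ i) *\<^sub>C x i))\<^sup>2 \<le> (L2_set (\<lambda>i. norm (x i)) UNIV)\<^sup>2"
    by (intro power_mono) auto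
  then show ?thesis by (simp add: L2_set_def sum_nonneg)
qed

lemma op_monomial_scalar:
  fixes z :: "(complex, 'n::{finite,linorder}) vec"
  shows "op_monomial (\<lambda>i. (z $ i) *\<^sub>C (id_blinfun :: 't::complex_hilbert \<Rightarrow>\<^sub>L 't)) p = monomial z p *\<^sub>C id_blinfun"
proof -
  have "op_word (\<lambda>i. (z $ i) *\<^sub>C (id_blinfun :: 't \<Rightarrow>\<^sub>L 't)) \<alpha> = word_monomial z \<alpha> *\<^sub>C id_blinfun" for \<alpha>
    by (induction \<alpha>)
      (auto intro!: blinfun_eqI simp: word_monomial_def scaleC_blinfun.rep_eq scaleC_scaleC)
  then show ?thesis by (simp add: op_monomial_eq word_monomial_eq count_list_canonical_word)
qed

lemma coefficient_norm_bound:
  fixes A :: "('n::{finite,linorder} \<Rightarrow> nat) \<Rightarrow> 'h::complex_hilbert \<Rightarrow>\<^sub>L 'h"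
  assumes A: "\<And>p. A p \<in> bounded_ops"
    and pos: "\<And>h g. (\<Sum>p\<in>multi_indices (Suc k). inner (blinfun_apply (A p) h) (g p)) \<le> inner (blinfun_apply D h) h +
      (\<Sum>p\<in>multi_indices (Suc k). multinomial p * inner (blinfun_apply D (g p)) (g p))"
  shows "norm (\<Sum>p\<in>multi_indices (Suc k). (1 / multinomial p) *\<^sub>R (adj (A p) o\<^sub>L A p)) \<le> (2 * norm D)\<^sup>2"
proof (rule norm_sum_adj_le[OF A])
  fix h
  define d where "d = norm D"
  define N where "N = (\<Sum>p\<in>multi_indices (Suc k). (1 / multinomial p) * (norm (blinfun_apply (A p) h))\<^sup>2)"
  have D: "inner (blinfun_apply D v) v \<le> d * (norm v)\<^sup>2" for v
    using order_trans[OF norm_cauchy_schwarz mult_right_mono[OF norm_blinfun[of D v] norm_ge_zero[of v]]]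
    by (simp add: d_def power2_eq_square mult.assoc)
  have le: "t * N \<le> d * (norm h)\<^sup>2 + d * t\<^sup>2 * N" for t
  proof -
    \<comment> \<open>With this g both sides become multiples of the same \<open>N\<close>, linear
      in t on the left and quadratic on the right.\<close>
    let ?g = "\<lambda>p. (t / multinomial p) *\<^sub>R blinfun_apply (A p) h"
    have "t * N = (\<Sum>p\<in>multi_indices (Suc k). inner (blinfun_apply (A p) h) (?g p))"
      by (simp add: N_def sum_distrib_left power2_norm_eq_inner)
    also have "\<dots> \<le> inner (blinfun_apply D h) h + (\<Sum>p\<in>multi_indices (Suc k). multinomial p * inner (blinfun_apply D (?g p)) (?g p))"
      by (rule pos)
    also have "\<dots> \<le> d * (norm h)\<^sup>2 + (\<Sum>p\<in>multi_indices (Suc k). multinomial p * (d * (norm (?g p))\<^sup>2))"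
      by (intro add_mono sum_mono mult_left_mono D) (simp add: less_imp_le)
    also have "(\<Sum>p\<in>multi_indices (Suc k). multinomial p * (d * (norm (?g p))\<^sup>2)) = d * t\<^sup>2 * N"
      unfolding N_def sum_distrib_left
      by (intro sum.cong refl) (simp add: power_mult_distrib power_divide, simp add: power2_eq_square)
    finally show ?thesis .
  qed
  have "N \<le> (2 * d)\<^sup>2 * (norm h)\<^sup>2"
  proof (cases "d = 0")
    case True
    then show ?thesis using le[of 1] by simp
  next
    case False
    then have d: "0 < d" by (simp add: d_def)
    \<comment> \<open>t = 1 / (2 d) maximises t - d t^2; the maximum 1 / (4 d) gives N <= 4 d^2
      |h|^2. For d = 0 the choice t = 1 already forced N <= 0.\<close>
    have "N / (2 * d) \<le> d * (norm h)\<^sup>2 + N / (4 * d)"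
      using le[of "1 / (2 * d)"] d by (simp add: power2_eq_square)
    then show ?thesis using d by (simp add: field_simps power2_eq_square)
  qed
  then show "(\<Sum>p\<in>multi_indices (Suc k). (1 / multinomial p) * (norm (blinfun_apply (A p) h))\<^sup>2) \<le> (2 * norm D)\<^sup>2 * (norm h)\<^sup>2"
    by (simp add: N_def d_def)
qed (simp_all add: less_imp_le)

text \<open>The powers of 1/3 with exponent k >= 1 add up to 1/2, which cancels the factor 2 in the
  bound 2 d. The majorant \<open>?b\<close> is a full geometric series whose term at k = 0 is
  corrected from 2 d to \<alpha>.\<close>

lemma bohr_majorant:
  fixes a :: "nat \<Rightarrow> real"
  assumes a: "\<And>k. 0 \<le> a k" "a 0 \<le> \<alpha>" "\<And>k. a (Suc k) \<le> 2 * d" and d: "0 \<le> d" and r: "0 \<le> r" "r \<le> 1 / 3"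
  shows "summable (\<lambda>k. r ^ k * a k) \<and> (\<Sum>k. r ^ k * a k) \<le> \<alpha> + d"
proof -
  let ?b = "\<lambda>k::nat. 2 * d * (1 / 3) ^ k + (if k = 0 then \<alpha> - 2 * d else 0)"
  have "?b sums (2 * d * (1 / (1 - 1 / 3)) + (\<alpha> - 2 * d))"
    by (intro sums_add sums_mult geometric_sums sums_single) simp
  then have b: "?b sums (\<alpha> + d)" by (simp add: algebra_simps)
  have le: "r ^ k * a k \<le> ?b k" for k
  proof (cases k)
    case (Suc m)
    have "r ^ k * a k \<le> (1 / 3) ^ k * (2 * d)"
      using Suc a r by (intro mult_mono power_mono) auto
    then show ?thesis using Suc by (simp add: mult.commute)
  qed (use a in simp)
  have s: "summable (\<lambda>k. r ^ k * a k)"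
    using le a r by (intro summable_comparison_test'[OF sums_summable[OF b], of 0]) simp
  then show ?thesis using suminf_le[OF le s sums_summable[OF b]] sums_unique[OF b] by simp
qed

theorem theorem4p1:
  fixes A :: "('n::{finite,linorder} \<Rightarrow> nat) \<Rightarrow> ('h::complex_hilbert \<Rightarrow>\<^sub>L 'h)"
    and f :: "(complex, 'n) vec \<Rightarrow> ('h \<Rightarrow>\<^sub>L 'h)"
  assumes A: "\<forall>p. A p \<in> bounded_ops"
    and f: "\<forall>z\<in>ball 0 1. ((\<lambda>p. monomial z p *\<^sub>C A p) has_sum f z) UNIV"
    and limsup_A: "limsup (\<lambda>k. ereal (norm (\<Sum>p\<in>multi_indices k. multinomial p *\<^sub>R (adj (A p) o\<^sub>L A p))
      powr (1 / (2 * real k)))) \<le> 1"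
    and f_0: "op_nonneg (f 0)"
    and Re_f_sym: "\<forall>r. 0 \<le> r \<and> r < 1 \<longrightarrow> op_le (re_part (f_sym A r)) id_blinfun"
  shows
    \<comment> \<open>(i)\<close>
    "(\<forall>k\<ge>1. sqrt (norm (\<Sum>p\<in>multi_indices k. (1 / multinomial p) *\<^sub>R (adj (A p) o\<^sub>L A p)))
        \<le> 2 * norm (id_blinfun - A (\<lambda>_. 0)))
    \<comment> \<open>(ii)\<close>
    \<and> (\<forall>r. 0 \<le> r \<and> r \<le> 1/3 \<longrightarrow>
        summable (\<lambda>k. r ^ k *
          sqrt (norm (\<Sum>p\<in>multi_indices k. (1 / multinomial p) *\<^sub>R (adj (A p) o\<^sub>L A p)))) \<and>
        (\<Sum>k. r ^ k *
          sqrt (norm (\<Sum>p\<in>multi_indices k. (1 / multinomial p) *\<^sub>R (adj (A p) o\<^sub>L A p))))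
        \<le> norm (A (\<lambda>_. 0)) + norm (id_blinfun - A (\<lambda>_. 0)))
    \<comment> \<open>(iii)\<close>
    \<and> (\<forall>Y :: ('n \<Rightarrow> nat) \<Rightarrow> ('k::complex_hilbert \<Rightarrow>\<^sub>L 'k).
        (\<forall>p. Y p \<in> bounded_ops) \<and> norm (Y (\<lambda>_. 0)) \<le> 1 \<and>
        summable (\<lambda>k. sqrt (norm (\<Sum>p\<in>multi_indices (Suc k). multinomial p *\<^sub>R (adj (Y p) o\<^sub>L Y p)))) \<and>
        (\<Sum>k. sqrt (norm (\<Sum>p\<in>multi_indices (Suc k). multinomial p *\<^sub>R (adj (Y p) o\<^sub>L Y p)))) \<le> 1/2
        \<longrightarrow>
        (summable (\<lambda>k. \<Sum>p\<in>multi_indices k. op_monomial sym_creation p \<otimes>\<^sub>o A p \<otimes>\<^sub>o Y p) \<and>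
         norm (\<Sum>k. \<Sum>p\<in>multi_indices k. op_monomial sym_creation p \<otimes>\<^sub>o A p \<otimes>\<^sub>o Y p) \<le> 1) \<and>
        (\<forall>z\<in>ball 0 1.
         summable (\<lambda>k. \<Sum>p\<in>multi_indices k. monomial z p *\<^sub>C (A p \<otimes>\<^sub>o Y p)) \<and>
         norm (\<Sum>k. \<Sum>p\<in>multi_indices k. monomial z p *\<^sub>C (A p \<otimes>\<^sub>o Y p)) \<le> 1))
    \<comment> \<open>(iv)\<close>
    \<and> (\<forall>Y :: 'n \<Rightarrow> ('k \<Rightarrow>\<^sub>L 'k).
        (\<forall>i. Y i \<in> bounded_ops) \<and> (\<forall>i j. Y i o\<^sub>L Y j = Y j o\<^sub>L Y i) \<and>
        sqrt (norm (\<Sum>i\<in>UNIV. adj (Y i) o\<^sub>L Y i)) \<le> 1/3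
        \<longrightarrow>
        summable (\<lambda>k. \<Sum>p\<in>multi_indices k. op_monomial sym_creation p \<otimes>\<^sub>o op_monomial Y p \<otimes>\<^sub>o A p) \<and>
        norm (\<Sum>k. \<Sum>p\<in>multi_indices k. op_monomial sym_creation p \<otimes>\<^sub>o op_monomial Y p \<otimes>\<^sub>o A p) \<le> 1)
    \<comment> \<open>(v)\<close>
    \<and> (\<forall>T :: 'n \<Rightarrow> ('k \<Rightarrow>\<^sub>L 'k).
        (\<forall>i. T i \<in> bounded_ops) \<and> (\<forall>i j. T i o\<^sub>L T j = T j o\<^sub>L T i) \<and>
        sqrt (norm (\<Sum>i\<in>UNIV. T i o\<^sub>L adj (T i))) \<le> 1/3
        \<longrightarrow>
        summable (\<lambda>k. norm (\<Sum>p\<in>multi_indices k. op_monomial T p \<otimes>\<^sub>o A p)) \<and>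
        (\<Sum>k. norm (\<Sum>p\<in>multi_indices k. op_monomial T p \<otimes>\<^sub>o A p))
        \<le> norm (A (\<lambda>_. 0)) + norm (id_blinfun - A (\<lambda>_. 0)))"
proof -
  let ?A0 = "A (\<lambda>_. 0)"
  let ?Q = "\<lambda>k. norm (\<Sum>p\<in>multi_indices k. (1 / multinomial p) *\<^sub>R (adj (A p) o\<^sub>L A p))"
  define D where "D = id_blinfun - ?A0"
  have bo [simp]: "A p \<in> bounded_ops" for p using A by blast
  \<comment> \<open>Positivity is assumed for f(0), which is known only as the sum of the series at
    0. Uniqueness of sums identifies it with A_0.\<close>
  have "((\<lambda>p. monomial 0 p *\<^sub>C A p) has_sum f 0) UNIV" using f by simp
  moreover have "((\<lambda>p. monomial 0 p *\<^sub>C A p) has_sum ?A0) UNIV"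
  proof -
    have "((\<lambda>p. monomial 0 p *\<^sub>C A p) has_sum (\<Sum>p\<in>{\<lambda>_. 0}. monomial 0 p *\<^sub>C A p)) {\<lambda>_. 0}"
      by (rule has_sum_finite) simp
    then have "((\<lambda>p. monomial 0 p *\<^sub>C A p) has_sum ?A0) {\<lambda>_. 0}" by (simp add: monomial_zero)
    then show ?thesis
      by (rule iffD1[OF has_sum_cong_neutral, rotated -1]) (auto simp: monomial_zero)
  qed
  ultimately have A0: "op_nonneg ?A0" using f_0 by (metis has_sum_unique)
  have adj_A0: "adj ?A0 = ?A0" by (rule op_nonneg_adj[OF bo A0])
  have A0_pos: "0 \<le> inner (blinfun_apply ?A0 h) h" for h
    using A0 by (simp add: op_nonneg_def inner_eq_Re_cinner)
  have pos: "(\<Sum>p\<in>multi_indices (Suc k). inner (blinfun_apply (A p) h) (g p)) \<le> inner (blinfun_apply D h) h +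
      (\<Sum>p\<in>multi_indices (Suc k). multinomial p * inner (blinfun_apply D (g p)) (g p))" for k h g
    unfolding D_def using Re_f_sym by (intro coefficient_positivity bo limsup_A) blast
  \<comment> \<open>With g = 0 only the form of D at h remains, so D is positive. Any degree k >= 1
    would serve here.\<close>
  have A0_le: "inner (blinfun_apply ?A0 h) h \<le> (norm h)\<^sup>2" for h
    using pos[where k = 0 and h = h and g = "\<lambda>_. 0"] by (simp add: D_def blinfun.diff_left inner_diff_left power2_norm_eq_inner)
  have A_p: "\<forall>k. \<forall>p\<in>multi_indices (Suc k). \<forall>a b. inner (blinfun_apply (A p) a) b
      \<le> inner (blinfun_apply D a) a + multinomial p * inner (blinfun_apply D b) b"
  proof (intro allI ballI)
    fix k a b and p :: "'n \<Rightarrow> nat" assume that: "p \<in> multi_indices (Suc k)"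
    show "inner (blinfun_apply (A p) a) b \<le> inner (blinfun_apply D a) a + multinomial p * inner (blinfun_apply D b) b"
    using pos[where k = k and h = a and g = "\<lambda>q. if q = p then b else 0"] that
    by (simp add: if_distrib[of "inner _"] if_distrib[of "blinfun_apply _"] if_distrib[of "(*) _"] cong: if_cong)
  qed
  have Q_Suc: "sqrt (?Q (Suc k)) \<le> 2 * norm D" for k
    using coefficient_norm_bound[OF bo pos, of k] by (simp add: real_le_lsqrt)
  have Q_0: "sqrt (?Q 0) \<le> norm ?A0"
  proof -
    have "?Q 0 \<le> (norm ?A0)\<^sup>2"
    proof (rule norm_sum_adj_le[OF bo])
      fix x
      have "(norm (blinfun_apply ?A0 x))\<^sup>2 \<le> (norm ?A0 * norm x)\<^sup>2"
        by (intro power_mono norm_blinfun) simp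
      then show "(\<Sum>p\<in>multi_indices 0. 1 / multinomial p * (norm (blinfun_apply (A p) x))\<^sup>2) \<le> (norm ?A0)\<^sup>2 * (norm x)\<^sup>2"
        by (simp add: power_mult_distrib)
    qed (simp_all add: less_imp_le)
    then show ?thesis by (simp add: real_le_lsqrt)
  qed
  have i: "\<forall>k\<ge>1. sqrt (?Q k) \<le> 2 * norm (id_blinfun - ?A0)"
  proof (intro allI impI)
    fix k :: nat assume "1 \<le> k"
    then obtain m where "k = Suc m" by (cases k) auto
    then show "sqrt (?Q k) \<le> 2 * norm (id_blinfun - ?A0)" using Q_Suc[of m] by (simp only: D_def)
  qed
  have ii: "summable (\<lambda>k. r ^ k * sqrt (?Q k)) \<and> (\<Sum>k. r ^ k * sqrt (?Q k)) \<le> norm ?A0 + norm (id_blinfun - ?A0)"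
    if "0 \<le> r" "r \<le> 1/3" for r
    using Q_Suc Q_0 that unfolding D_def by (intro bohr_majorant) auto
  note bohr = bohr_estimate[where A = A, OF _ _ _ _ _ _ bo adj_A0 A0_pos A0_le A_p[unfolded D_def]]
  let ?S = "\<lambda>p. op_monomial sym_creation p :: 'n sym_fock \<Rightarrow>\<^sub>L 'n sym_fock"
  have S_bo: "?S p \<in> bounded_ops" for p by (simp add: op_monomial_bounded_ops)
  have S_row: "(norm (\<Sum>p\<in>multi_indices k. blinfun_apply (?S p \<otimes>\<^sub>o (id_blinfun :: 't::complex_hilbert \<Rightarrow>\<^sub>L 't)) (x p)))\<^sup>2
      \<le> (\<Sum>p\<in>multi_indices k. (1 / multinomial p) * (norm (x p))\<^sup>2)" for k x
    using ampliated_row_bound[OF _ sym_creation_commute norm_sym_creation_row_le, where k = k and x = x] by simp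
  \<comment> \<open>A common source for (iii) and (iv): both tensor orders and the evaluation at z
    are instances of one estimate, distinguished by the choice of \<open>V\<close>,
    \<open>\<phi>\<close> and \<open>\<psi>\<close>. For (iv) the family is Y_p = Y^p.\<close>
  have iii_iv: "(summable (\<lambda>k. \<Sum>p\<in>multi_indices k. ?S p \<otimes>\<^sub>o A p \<otimes>\<^sub>o Y p) \<and>
      norm (\<Sum>k. \<Sum>p\<in>multi_indices k. ?S p \<otimes>\<^sub>o A p \<otimes>\<^sub>o Y p) \<le> 1) \<and>
    (summable (\<lambda>k. \<Sum>p\<in>multi_indices k. ?S p \<otimes>\<^sub>o Y p \<otimes>\<^sub>o A p) \<and>
      norm (\<Sum>k. \<Sum>p\<in>multi_indices k. ?S p \<otimes>\<^sub>o Y p \<otimes>\<^sub>o A p) \<le> 1) \<and>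
    (\<forall>z\<in>ball 0 1.
      summable (\<lambda>k. \<Sum>p\<in>multi_indices k. monomial z p *\<^sub>C (A p \<otimes>\<^sub>o Y p)) \<and>
      norm (\<Sum>k. \<Sum>p\<in>multi_indices k. monomial z p *\<^sub>C (A p \<otimes>\<^sub>o Y p)) \<le> 1)"
    if Y: "\<And>p. Y p \<in> bounded_ops" "norm (Y (\<lambda>_. 0)) \<le> 1"
      and Yc: "\<And>k. norm (\<Sum>p\<in>multi_indices (Suc k). multinomial p *\<^sub>R (adj (Y p) o\<^sub>L Y p)) \<le> (c k)\<^sup>2"
      and c: "\<And>k. 0 \<le> c k" "summable c" "suminf c \<le> 1/2"
    for Y :: "('n \<Rightarrow> nat) \<Rightarrow> ('k \<Rightarrow>\<^sub>L 'k)" and c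
  proof (intro conjI[of "_ \<and> _"] ballI)
    have col: "(\<Sum>p\<in>multi_indices (Suc k). multinomial p * (norm (blinfun_apply (\<psi> (Y p)) x))\<^sup>2) \<le> (c k)\<^sup>2 * (norm x)\<^sup>2"
      if "star_rep \<psi>" for \<psi> :: "('k \<Rightarrow>\<^sub>L 'k) \<Rightarrow> ('t::complex_hilbert \<Rightarrow>\<^sub>L 't)" and k x
      using star_rep.sum_norm_sq_le[OF that, of "multi_indices (Suc k)" Y multinomial x] Y(1)
        mult_right_mono[OF Yc[of k], of "(norm x)\<^sup>2"] by simp
    \<comment> \<open>The tensor product associates to the right: \<open>R1\<close> places an
      operator in the middle factor and \<open>R2\<close> in the last one.\<close>
    note R1 = star_rep_comp[OF star_rep_left star_rep_right]
      and R2 = star_rep_comp[OF star_rep_right star_rep_right]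
    have "(?S p \<otimes>\<^sub>o id_blinfun) o\<^sub>L (id_blinfun \<otimes>\<^sub>o (A p \<otimes>\<^sub>o id_blinfun)) o\<^sub>L (id_blinfun \<otimes>\<^sub>o (id_blinfun \<otimes>\<^sub>o Y p))
        = ?S p \<otimes>\<^sub>o A p \<otimes>\<^sub>o Y p" for p
      by (simp add: tensor_op_compose S_bo Y tensor_op)
    moreover have "summable (\<lambda>k. \<Sum>p\<in>multi_indices k. (?S p \<otimes>\<^sub>o id_blinfun) o\<^sub>L
          (id_blinfun \<otimes>\<^sub>o (A p \<otimes>\<^sub>o id_blinfun)) o\<^sub>L (id_blinfun \<otimes>\<^sub>o (id_blinfun \<otimes>\<^sub>o Y p))) \<and>
        norm (\<Sum>k. \<Sum>p\<in>multi_indices k. (?S p \<otimes>\<^sub>o id_blinfun) o\<^sub>L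
          (id_blinfun \<otimes>\<^sub>o (A p \<otimes>\<^sub>o id_blinfun)) o\<^sub>L (id_blinfun \<otimes>\<^sub>o (id_blinfun \<otimes>\<^sub>o Y p))) \<le> 1"
      by (rule bohr[where V = "\<lambda>p. ?S p \<otimes>\<^sub>o id_blinfun" and \<phi> = "\<lambda>X. id_blinfun \<otimes>\<^sub>o (X \<otimes>\<^sub>o id_blinfun)"
            and \<psi> = "\<lambda>X. id_blinfun \<otimes>\<^sub>o (id_blinfun \<otimes>\<^sub>o X)", OF R1 R2 _ _ _ S_row Y col[OF R2] c])
        (simp_all add: tensor_op_compose tensor_op S_bo op_monomial_zero tensor_op_id)
    ultimately show "summable (\<lambda>k. \<Sum>p\<in>multi_indices k. ?S p \<otimes>\<^sub>o A p \<otimes>\<^sub>o Y p) \<and>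
      norm (\<Sum>k. \<Sum>p\<in>multi_indices k. ?S p \<otimes>\<^sub>o A p \<otimes>\<^sub>o Y p) \<le> 1" by (simp only:)
    have "(?S p \<otimes>\<^sub>o id_blinfun) o\<^sub>L (id_blinfun \<otimes>\<^sub>o (id_blinfun \<otimes>\<^sub>o A p)) o\<^sub>L (id_blinfun \<otimes>\<^sub>o (Y p \<otimes>\<^sub>o id_blinfun))
        = ?S p \<otimes>\<^sub>o Y p \<otimes>\<^sub>o A p" for p
      by (simp add: tensor_op_compose S_bo Y tensor_op)
    moreover have "summable (\<lambda>k. \<Sum>p\<in>multi_indices k. (?S p \<otimes>\<^sub>o id_blinfun) o\<^sub>L
          (id_blinfun \<otimes>\<^sub>o (id_blinfun \<otimes>\<^sub>o A p)) o\<^sub>L (id_blinfun \<otimes>\<^sub>o (Y p \<otimes>\<^sub>o id_blinfun))) \<and>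
        norm (\<Sum>k. \<Sum>p\<in>multi_indices k. (?S p \<otimes>\<^sub>o id_blinfun) o\<^sub>L
          (id_blinfun \<otimes>\<^sub>o (id_blinfun \<otimes>\<^sub>o A p)) o\<^sub>L (id_blinfun \<otimes>\<^sub>o (Y p \<otimes>\<^sub>o id_blinfun))) \<le> 1"
      by (rule bohr[where V = "\<lambda>p. ?S p \<otimes>\<^sub>o id_blinfun" and \<phi> = "\<lambda>X. id_blinfun \<otimes>\<^sub>o (id_blinfun \<otimes>\<^sub>o X)"
            and \<psi> = "\<lambda>X. id_blinfun \<otimes>\<^sub>o (X \<otimes>\<^sub>o id_blinfun)", OF R2 R1 _ _ _ S_row Y col[OF R1] c])
        (simp_all add: tensor_op_compose tensor_op S_bo op_monomial_zero tensor_op_id)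
    ultimately show "summable (\<lambda>k. \<Sum>p\<in>multi_indices k. ?S p \<otimes>\<^sub>o Y p \<otimes>\<^sub>o A p) \<and>
      norm (\<Sum>k. \<Sum>p\<in>multi_indices k. ?S p \<otimes>\<^sub>o Y p \<otimes>\<^sub>o A p) \<le> 1" by (simp only:)
    fix z :: "(complex, 'n) vec" assume z: "z \<in> ball 0 1"
    let ?V = "\<lambda>p. monomial z p *\<^sub>C (id_blinfun :: ('h, 'k) tensor \<Rightarrow>\<^sub>L ('h, 'k) tensor)"
    have V_row: "(norm (\<Sum>p\<in>multi_indices k. blinfun_apply (?V p) (x p)))\<^sup>2
        \<le> (\<Sum>p\<in>multi_indices k. (1 / multinomial p) * (norm (x p))\<^sup>2)" for k x
    proof -
      have row: "(norm (\<Sum>i\<in>UNIV. blinfun_apply ((z $ i) *\<^sub>C id_blinfun) (y i)))\<^sup>2 \<le> 1 * (\<Sum>i\<in>UNIV. (norm (y i))\<^sup>2)"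
        for y :: "'n \<Rightarrow> ('h, 'k) tensor"
        using scalar_row[of z y] z by (simp add: scaleC_blinfun.rep_eq)
      have comm: "((z $ i) *\<^sub>C id_blinfun) o\<^sub>L ((z $ j) *\<^sub>C id_blinfun) =
          ((z $ j) *\<^sub>C id_blinfun) o\<^sub>L ((z $ i) *\<^sub>C (id_blinfun :: ('h, 'k) tensor \<Rightarrow>\<^sub>L ('h, 'k) tensor))" for i j
        by (rule blinfun_eqI) (simp add: scaleC_blinfun.rep_eq scaleC_scaleC mult.commute)
      show ?thesis
        using row_bound_monomial[OF row _ comm, where k = k and x = x] by (simp add: op_monomial_scalar)
    qed
    have V_comm: "?V p o\<^sub>L X = X o\<^sub>L ?V p" if "X \<in> bounded_ops" for p X
      by (rule blinfun_eqI) (simp add: scaleC_blinfun.rep_eq bounded_opsD[OF that])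
    have V_0: "?V (\<lambda>_. 0) = id_blinfun" by (simp add: monomial_def)
    have "?V p o\<^sub>L (A p \<otimes>\<^sub>o id_blinfun) o\<^sub>L (id_blinfun \<otimes>\<^sub>o Y p) = monomial z p *\<^sub>C (A p \<otimes>\<^sub>o Y p)" for p
    proof -
      have "?V p o\<^sub>L (A p \<otimes>\<^sub>o id_blinfun) o\<^sub>L (id_blinfun \<otimes>\<^sub>o Y p) = ?V p o\<^sub>L (A p \<otimes>\<^sub>o Y p)"
        unfolding blinfun_compose_assoc by (simp add: tensor_op_compose Y)
      then show ?thesis by (simp add: blinfun_eqI scaleC_blinfun.rep_eq)
    qed
    moreover have "summable (\<lambda>k. \<Sum>p\<in>multi_indices k. ?V p o\<^sub>L (A p \<otimes>\<^sub>o id_blinfun) o\<^sub>L (id_blinfun \<otimes>\<^sub>o Y p)) \<and>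
        norm (\<Sum>k. \<Sum>p\<in>multi_indices k. ?V p o\<^sub>L (A p \<otimes>\<^sub>o id_blinfun) o\<^sub>L (id_blinfun \<otimes>\<^sub>o Y p)) \<le> 1"
      by (rule bohr[where V = ?V and \<phi> = "\<lambda>X. X \<otimes>\<^sub>o id_blinfun"
            and \<psi> = "\<lambda>X. id_blinfun \<otimes>\<^sub>o X", OF star_rep_left star_rep_right _ _ V_0 V_row Y col[OF star_rep_right] c])
        (simp_all add: tensor_op_compose tensor_op V_comm)
    ultimately show "summable (\<lambda>k. \<Sum>p\<in>multi_indices k. monomial z p *\<^sub>C (A p \<otimes>\<^sub>o Y p)) \<and>
      norm (\<Sum>k. \<Sum>p\<in>multi_indices k. monomial z p *\<^sub>C (A p \<otimes>\<^sub>o Y p)) \<le> 1" by (simp only:)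
  qed
  have iv: "summable (\<lambda>k. \<Sum>p\<in>multi_indices k. ?S p \<otimes>\<^sub>o op_monomial Y p \<otimes>\<^sub>o A p) \<and>
      norm (\<Sum>k. \<Sum>p\<in>multi_indices k. ?S p \<otimes>\<^sub>o op_monomial Y p \<otimes>\<^sub>o A p) \<le> 1"
    if Y: "\<And>i. Y i \<in> bounded_ops" "\<And>i j. Y i o\<^sub>L Y j = Y j o\<^sub>L Y i"
      and le: "sqrt (norm (\<Sum>i\<in>UNIV. adj (Y i) o\<^sub>L Y i)) \<le> 1/3" for Y :: "'n \<Rightarrow> ('k \<Rightarrow>\<^sub>L 'k)"
  proof -
    \<comment> \<open>Index k stands for degree k + 1, so the series starts at 1/3 and its sum is
      exactly the 1/2 allowed in the general estimate.\<close>
    let ?c = "\<lambda>k. (1/3) ^ Suc k :: real"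
    have C: "norm (\<Sum>i\<in>UNIV. adj (Y i) o\<^sub>L Y i) \<le> (1/3)\<^sup>2"
      using le by (simp add: real_sqrt_le_iff' sqrt_le_D)
    have col: "norm (\<Sum>p\<in>multi_indices (Suc k). multinomial p *\<^sub>R (adj (op_monomial Y p) o\<^sub>L op_monomial Y p)) \<le> (?c k)\<^sup>2" for k
      using norm_column_monomial_le[OF Y C, of "Suc k"] by (simp only: power_mult[symmetric] mult.commute)
    have "?c sums (1/3 * (1 / (1 - 1/3)))"
      unfolding power_Suc by (intro sums_mult geometric_sums) simp
    then have "summable ?c" "suminf ?c \<le> 1/2" by (auto simp: sums_iff)
    with iii_iv[of "op_monomial Y" ?c] col show ?thesis
      by (simp add: op_monomial_bounded_ops Y op_monomial_zero norm_id_le)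
  qed
  have v: "summable (\<lambda>k. norm (\<Sum>p\<in>multi_indices k. op_monomial T p \<otimes>\<^sub>o A p)) \<and>
      (\<Sum>k. norm (\<Sum>p\<in>multi_indices k. op_monomial T p \<otimes>\<^sub>o A p)) \<le> norm ?A0 + norm (id_blinfun - ?A0)"
    if T: "\<And>i. T i \<in> bounded_ops" "\<And>i j. T i o\<^sub>L T j = T j o\<^sub>L T i"
      and le: "sqrt (norm (\<Sum>i\<in>UNIV. T i o\<^sub>L adj (T i))) \<le> 1/3" for T :: "'n \<Rightarrow> ('k \<Rightarrow>\<^sub>L 'k)"
  proof -
    interpret r: star_rep "\<lambda>X. (id_blinfun :: 'k \<Rightarrow>\<^sub>L 'k) \<otimes>\<^sub>o (X :: 'h \<Rightarrow>\<^sub>L 'h)" by (rule star_rep_right)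
    have C: "norm (\<Sum>i\<in>UNIV. T i o\<^sub>L adj (T i)) \<le> (1/3)\<^sup>2"
      using le by (simp add: real_sqrt_le_iff' sqrt_le_D)
    have term_le: "norm (\<Sum>p\<in>multi_indices k. op_monomial T p \<otimes>\<^sub>o A p) \<le> (1/3) ^ k * sqrt (?Q k)" for k
    proof (rule norm_blinfun_bound)
      fix x :: "('k, 'h) tensor"
      let ?x = "\<lambda>p. blinfun_apply (id_blinfun \<otimes>\<^sub>o A p) x"
      have "op_monomial T p \<otimes>\<^sub>o A p = (op_monomial T p \<otimes>\<^sub>o id_blinfun) o\<^sub>L (id_blinfun \<otimes>\<^sub>o A p)" for p
        by (simp add: tensor_op_compose op_monomial_bounded_ops T)
      then have "(norm (blinfun_apply (\<Sum>p\<in>multi_indices k. op_monomial T p \<otimes>\<^sub>o A p) x))\<^sup>2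
          = (norm (\<Sum>p\<in>multi_indices k. blinfun_apply (op_monomial T p \<otimes>\<^sub>o id_blinfun) (?x p)))\<^sup>2"
        by (simp add: blinfun.sum_left)
      also have "\<dots> \<le> ((1/3)\<^sup>2) ^ k * (\<Sum>p\<in>multi_indices k. (1 / multinomial p) * (norm (?x p))\<^sup>2)"
        by (rule ampliated_row_bound[OF T C])
      also have "\<dots> \<le> ((1/3)\<^sup>2) ^ k * (?Q k * (norm x)\<^sup>2)"
        by (intro mult_left_mono r.sum_norm_sq_le) simp_all
      also have "\<dots> = ((1/3) ^ k * sqrt (?Q k) * norm x)\<^sup>2"
        by (simp add: power_mult_distrib power_mult[symmetric] mult.commute)
      finally show "norm (blinfun_apply (\<Sum>p\<in>multi_indices k. op_monomial T p \<otimes>\<^sub>o A p) x) \<le> (1/3) ^ k * sqrt (?Q k) * norm x"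
        by (rule power2_le_imp_le) simp
    qed simp
    have ii': "summable (\<lambda>k. (1/3) ^ k * sqrt (?Q k))"
      "(\<Sum>k. (1/3) ^ k * sqrt (?Q k)) \<le> norm ?A0 + norm (id_blinfun - ?A0)"
      using ii[of "1/3"] by simp_all
    have s: "summable (\<lambda>k. norm (\<Sum>p\<in>multi_indices k. op_monomial T p \<otimes>\<^sub>o A p))"
      using term_le by (intro summable_comparison_test'[OF ii'(1), of 0]) simp
    then show ?thesis using suminf_le[OF term_le s ii'(1)] ii'(2) by simp
  qed
  have iii: "(summable (\<lambda>k. \<Sum>p\<in>multi_indices k. ?S p \<otimes>\<^sub>o A p \<otimes>\<^sub>o Y p) \<and>
      norm (\<Sum>k. \<Sum>p\<in>multi_indices k. ?S p \<otimes>\<^sub>o A p \<otimes>\<^sub>o Y p) \<le> 1) \<and>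
    (\<forall>z\<in>ball 0 1.
      summable (\<lambda>k. \<Sum>p\<in>multi_indices k. monomial z p *\<^sub>C (A p \<otimes>\<^sub>o Y p)) \<and>
      norm (\<Sum>k. \<Sum>p\<in>multi_indices k. monomial z p *\<^sub>C (A p \<otimes>\<^sub>o Y p)) \<le> 1)"
    if "\<And>p. Y p \<in> bounded_ops" "norm (Y (\<lambda>_. 0)) \<le> 1"
      "summable (\<lambda>k. sqrt (norm (\<Sum>p\<in>multi_indices (Suc k). multinomial p *\<^sub>R (adj (Y p) o\<^sub>L Y p))))"
      "(\<Sum>k. sqrt (norm (\<Sum>p\<in>multi_indices (Suc k). multinomial p *\<^sub>R (adj (Y p) o\<^sub>L Y p)))) \<le> 1/2"
    for Y :: "('n \<Rightarrow> nat) \<Rightarrow> ('k \<Rightarrow>\<^sub>L 'k)"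
    using iii_iv[of Y "\<lambda>k. sqrt (norm (\<Sum>p\<in>multi_indices (Suc k). multinomial p *\<^sub>R (adj (Y p) o\<^sub>L Y p)))",
        OF that(1,2) _ _ that(3,4)] by simp
  show ?thesis
  proof (intro conjI)
    show "\<forall>k\<ge>1. sqrt (?Q k) \<le> 2 * norm (id_blinfun - ?A0)" by (rule i)
  next
    show "\<forall>r. 0 \<le> r \<and> r \<le> 1/3 \<longrightarrow> summable (\<lambda>k. r ^ k * sqrt (?Q k)) \<and>
        (\<Sum>k. r ^ k * sqrt (?Q k)) \<le> norm ?A0 + norm (id_blinfun - ?A0)"
      by (intro allI impI, elim conjE, rule ii)
  qed (intro allI impI, elim conjE, rule iii iv v; simp)+
qed

end
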